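(* Let $1<p,q<\infty$, let $\sigma,w$ be Radon measures on $\mathbb{R}^N$ and let $\{b_Q\}_{Q\in\mathscr{D}}$ be a collection of real numbers. The following three are equivalent. (i) Two weight inequality: there is a constant $C$ such that $\|S_b^\sigma(f)\|_{L^q(w)}\le C\|f\|_{L^p(\sigma)}$ for all $f\in L^p(\sigma)$. (ii) Global quadratic testing: there is a constant $C$ such that for every collection $\{a_Q\}_{Q\in\mathscr{D}}\subset\mathbb{R}$ $$\Big\|\Big(\sum_{Q\in\mathscr{D}}S_b^\sigma(a_Q1_Q)^2\Big)^{1/2}\Big\|_{L^q(w)}\le C\Big\|\Big(\sum_{Q\in\mathscr{D}}a_Q^21_Q\Big)^{1/2}\Big\|_{L^p(\sigma)}.$$ (iii) Local quadratic testing together with the quadratic $\mathscr{A}^b_{p,q}$-condition: there is a constant $C$ such that for every collection $\{a_Q\}_{Q\in\mathscr{D}}\subset\mathbb{R}$ $$\Big\|\Big(\sum_{Q\in\mathscr{D}}S_{b,Q}^\sigma(a_Q1_Q)^2\Big)^{1/2}\Big\|_{L^q(w)}\le C\Big\|\Big(\sum_{Q\in\mathscr{D}}a_Q^21_Q\Big)^{1/2}\Big\|_{L^p(\sigma)},$$ and $[\sigma,w]^b_{p,q}<\infty$, where $[\sigma,w]_{p,q}^b$ is the best constant such that for every collection $\{a_Q\}_{Q\in\mathscr{D}}\subset\mathbb{R}$ $$\Big\|\Big(\sum_{Q\in\mathscr{D}}\Big(a_Qb_Q\frac{\sigma(Q)}{|Q|}\Big)^21_Q\Big)^{1/2}\Big\|_{L^q(w)}\le[\sigma,w]^b_{p,q}\Big\|\Big(\sum_{Q\in\mathscr{D}}a_Q^21_Q\Big)^{1/2}\Big\|_{L^p(\sigma)}.$$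 In this case the best constant $\|S_b^\sigma\|$ in (i) satisfies $$\|S_b^\sigma\|\simeq\mathfrak{S}_{glob}\simeq\mathfrak{S}_{loc}+[\sigma,w]^b_{p,q},$$ where $\mathfrak{S}_{glob}$ and $\mathfrak{S}_{loc}$ are the best possible constants in the global testing inequality in (ii) and the local testing inequality in (iii), respectively, and the implicit constants depend only on $p$, $q$ and $N$.
   Context: All functions are real valued. A dyadic lattice $\mathscr{D}=\bigcup_{k\in\mathbb{Z}}\mathscr{D}_k$ on $\mathbb{R}^N$ is fixed: each $\mathscr{D}_k$ is a disjoint cover of $\mathbb{R}^N$ by cubes of the form $x+[0,2^{-k})^N$, and every cube $Q\in\mathscr{D}_k$ is a union of $2^N$ cubes of $\mathscr{D}_{k+1}$, forming the set $ch(Q)$ of its dyadic children. $|Q|$ is the Lebesgue measure of $Q$. For a locally $\sigma$-integrable $f$ and $Q\in\mathscr{D}$ put $$\Delta_Q(f\sigma):=\sum_{Q'\in ch(Q)}\frac{\int_{Q'}f\,d\sigma}{|Q'|}1_{Q'}-\frac{\int_Qf\,d\sigma}{|Q|}1_Q.$$ The generalized dyadic square function and its localized version are $$S_b^\sigma(f):=\Big(\sum_{Q\in\mathscr{D}}(b_Q\Delta_Q(f\sigma))^2\Big)^{1/2},\qquad S_{b,Q}^\sigma(f):=\Big(\sum_{Q'\in\mathscr{D}:\,Q'\subset Q}(b_{Q'}\Delta_{Q'}(f\sigma))^2\Big)^{1/2}.$$ *)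

theory Defs
  imports "HOL-Analysis.Analysis"
begin

definition radon_measure :: "'a::topological_space measure \<Rightarrow> bool" where
  "radon_measure M \<longleftrightarrow> sets M = sets borel
     \<and> (\<forall>K. compact K \<longrightarrow> emeasure M K < \<infinity>)
     \<and> (\<forall>B\<in>sets borel. emeasure M B = (SUP K\<in>{K. K \<subseteq> B \<and> compact K}. emeasure M K))"

definition dyadic_cube :: "int \<Rightarrow> real ^ 'n \<Rightarrow> (real ^ 'n) set" where
  "dyadic_cube k x = {y. \<forall>i. x $ i \<le> y $ i \<and> y $ i < x $ i + 2 powi (- k)}"

definition dyadic_lattice :: "(int \<Rightarrow> (real ^ 'n) set set) \<Rightarrow> bool" where
  "dyadic_lattice D \<longleftrightarrow>
     (\<forall>k. (\<forall>Q\<in>D k. \<exists>x. Q = dyadic_cube k x) \<and> disjoint (D k) \<and> \<Union>(D k) = UNIV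
        \<and> (\<forall>Q\<in>D k. \<exists>C. C \<subseteq> D (k + 1) \<and> card C = 2 ^ CARD('n) \<and> Q = \<Union>C))"

definition cubes :: "(int \<Rightarrow> (real ^ 'n) set set) \<Rightarrow> (real ^ 'n) set set" where
  "cubes D = (\<Union>k. D k)"

definition children :: "(int \<Rightarrow> (real ^ 'n) set set) \<Rightarrow> (real ^ 'n) set \<Rightarrow> (real ^ 'n) set set" where
  "children D Q = {Q'. Q' \<subseteq> Q \<and> (\<exists>k. Q \<in> D k \<and> Q' \<in> D (k + 1))}"

definition vol :: "(real ^ 'n::finite) set \<Rightarrow> real" where
  "vol Q = measure lborel Q"

text \<open>Powers of extended nonnegative numbers; used only for exponents \<open>r > 0\<close>, where
  \<open>\<infinity>\<close> to the power \<open>r\<close> is \<open>\<infinity>\<close>.\<close>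

definition epowr :: "ennreal \<Rightarrow> real \<Rightarrow> ennreal" where
  "epowr x r = (if x = \<infinity> then \<infinity> else ennreal (enn2real x powr r))"

definition esqrt :: "ennreal \<Rightarrow> ennreal" where
  "esqrt x = epowr x (1 / 2)"

text \<open>Norms are taken of \<open>[0,\<infinity>]\<close>-valued functions and may be infinite; for a real function
  \<open>f\<close> one passes to \<open>\<bar>f\<bar>\<close>.\<close>

definition Lnorm :: "'a measure \<Rightarrow> real \<Rightarrow> ('a \<Rightarrow> ennreal) \<Rightarrow> ennreal" where
  "Lnorm M p F = epowr (\<integral>\<^sup>+ x. epowr (F x) p \<partial>M) (1 / p)"

definition Lspace :: "'a measure \<Rightarrow> real \<Rightarrow> ('a \<Rightarrow> real) set" where
  "Lspace M p = {f \<in> borel_measurable M. Lnorm M p (\<lambda>x. ennreal \<bar>f x\<bar>) < \<infinity>}"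

text \<open>\<open>Delta D \<sigma> f Q\<close> is the martingale difference of the measure \<open>f\<sigma>\<close>: the averages are taken
  with respect to Lebesgue measure, not \<open>\<sigma>\<close>.\<close>

definition Delta :: "(int \<Rightarrow> (real ^ 'n) set set) \<Rightarrow> (real ^ 'n::finite) measure \<Rightarrow>
    (real ^ 'n \<Rightarrow> real) \<Rightarrow> (real ^ 'n) set \<Rightarrow> real ^ 'n \<Rightarrow> real" where
  "Delta D \<sigma> f Q x =
     (\<Sum>Q'\<in>children D Q. (LINT y:Q'|\<sigma>. f y) / vol Q' * indicator Q' x)
       - (LINT y:Q|\<sigma>. f y) / vol Q * indicator Q x"

definition sq_fun :: "(int \<Rightarrow> (real ^ 'n) set set) \<Rightarrow> ((real ^ 'n) set \<Rightarrow> real) \<Rightarrow>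
    (real ^ 'n::finite) measure \<Rightarrow> (real ^ 'n \<Rightarrow> real) \<Rightarrow> real ^ 'n \<Rightarrow> ennreal" where
  "sq_fun D b \<sigma> f x = esqrt (\<Sum>\<^sub>\<infinity>Q\<in>cubes D. ennreal ((b Q * Delta D \<sigma> f Q x)\<^sup>2))"

definition local_sq_fun :: "(int \<Rightarrow> (real ^ 'n) set set) \<Rightarrow> ((real ^ 'n) set \<Rightarrow> real) \<Rightarrow>
    (real ^ 'n::finite) measure \<Rightarrow> (real ^ 'n) set \<Rightarrow> (real ^ 'n \<Rightarrow> real) \<Rightarrow>
    real ^ 'n \<Rightarrow> ennreal" where
  "local_sq_fun D b \<sigma> Q f x =
     esqrt (\<Sum>\<^sub>\<infinity>Q'\<in>{Q'\<in>cubes D. Q' \<subseteq> Q}. ennreal ((b Q' * Delta D \<sigma> f Q' x)\<^sup>2))"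

text \<open>In the next four inequalities the constant \<open>C\<close> is meant to be nonnegative.
  A coefficient family indexed by \<open>cubes D\<close> is a function on all sets; only its values on
  \<open>cubes D\<close> enter.\<close>

definition two_weight_ineq :: "(int \<Rightarrow> (real ^ 'n) set set) \<Rightarrow> ((real ^ 'n) set \<Rightarrow> real) \<Rightarrow>
    (real ^ 'n::finite) measure \<Rightarrow> (real ^ 'n) measure \<Rightarrow> real \<Rightarrow> real \<Rightarrow> real \<Rightarrow> bool" where
  "two_weight_ineq D b \<sigma> w p q C \<longleftrightarrow>
     (\<forall>f\<in>Lspace \<sigma> p. Lnorm w q (sq_fun D b \<sigma> f) \<le> ennreal C * Lnorm \<sigma> p (\<lambda>x. ennreal \<bar>f x\<bar>))"

definition coeff_norm :: "(int \<Rightarrow> (real ^ 'n) set set) \<Rightarrow> (real ^ 'n::finite) measure \<Rightarrow> real \<Rightarrow>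
    ((real ^ 'n) set \<Rightarrow> real) \<Rightarrow> ennreal" where
  "coeff_norm D \<sigma> p a =
     Lnorm \<sigma> p (\<lambda>x. esqrt (\<Sum>\<^sub>\<infinity>Q\<in>cubes D. ennreal ((a Q)\<^sup>2 * indicator Q x)))"

definition global_testing :: "(int \<Rightarrow> (real ^ 'n) set set) \<Rightarrow> ((real ^ 'n) set \<Rightarrow> real) \<Rightarrow>
    (real ^ 'n::finite) measure \<Rightarrow> (real ^ 'n) measure \<Rightarrow> real \<Rightarrow> real \<Rightarrow> real \<Rightarrow> bool" where
  "global_testing D b \<sigma> w p q C \<longleftrightarrow>
     (\<forall>a. Lnorm w q (\<lambda>x. esqrt (\<Sum>\<^sub>\<infinity>Q\<in>cubes D. (sq_fun D b \<sigma> (\<lambda>y. a Q * indicator Q y) x)\<^sup>2))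
            \<le> ennreal C * coeff_norm D \<sigma> p a)"

definition local_testing :: "(int \<Rightarrow> (real ^ 'n) set set) \<Rightarrow> ((real ^ 'n) set \<Rightarrow> real) \<Rightarrow>
    (real ^ 'n::finite) measure \<Rightarrow> (real ^ 'n) measure \<Rightarrow> real \<Rightarrow> real \<Rightarrow> real \<Rightarrow> bool" where
  "local_testing D b \<sigma> w p q C \<longleftrightarrow>
     (\<forall>a. Lnorm w q (\<lambda>x. esqrt (\<Sum>\<^sub>\<infinity>Q\<in>cubes D. (local_sq_fun D b \<sigma> Q (\<lambda>y. a Q * indicator Q y) x)\<^sup>2))
            \<le> ennreal C * coeff_norm D \<sigma> p a)"

definition quadratic_A :: "(int \<Rightarrow> (real ^ 'n) set set) \<Rightarrow> ((real ^ 'n) set \<Rightarrow> real) \<Rightarrow>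
    (real ^ 'n::finite) measure \<Rightarrow> (real ^ 'n) measure \<Rightarrow> real \<Rightarrow> real \<Rightarrow> real \<Rightarrow> bool" where
  "quadratic_A D b \<sigma> w p q C \<longleftrightarrow>
     (\<forall>a. Lnorm w q (\<lambda>x. esqrt (\<Sum>\<^sub>\<infinity>Q\<in>cubes D.
                ennreal ((a Q * b Q * (measure \<sigma> Q / vol Q))\<^sup>2 * indicator Q x)))
            \<le> ennreal C * coeff_norm D \<sigma> p a)"

text \<open>The best constant is \<open>\<infinity>\<close> when no finite constant is admissible.\<close>

definition best_const :: "(real \<Rightarrow> bool) \<Rightarrow> ennreal" where
  "best_const P = (INF C\<in>{C. 0 \<le> C \<and> P C}. ennreal C)"

definition comparable :: "real \<Rightarrow> ennreal \<Rightarrow> ennreal \<Rightarrow> bool" where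
  "comparable K X Y \<longleftrightarrow> X \<le> ennreal K * Y \<and> Y \<le> ennreal K * X"

end

theory Submission
  imports Defs
begin

text \<open>
  Fix a point \<open>x\<close>, let \<open>Q\<^sub>k\<close> be the cube of generation \<open>k\<close> that contains it, \<open>E\<^sub>k f\<close> the \<open>\<sigma>\<close>-average of \<open>f\<close>
  over \<open>Q\<^sub>k\<close> and \<open>s\<^sub>k = \<sigma>(Q\<^sub>k) / \<bar>Q\<^sub>k\<bar>\<close>. Of the children of \<open>Q\<^sub>k\<close> only \<open>Q\<^sub>k\<^sub>+\<^sub>1\<close> matters at \<open>x\<close>, so the
  martingale difference of \<open>f\<sigma>\<close> has the value
  \<open>s\<^sub>k\<^sub>+\<^sub>1 E\<^sub>k\<^sub>+\<^sub>1 f - s\<^sub>k E\<^sub>k f = (s\<^sub>k\<^sub>+\<^sub>1 - s\<^sub>k) E\<^sub>k f + s\<^sub>k\<^sub>+\<^sub>1 (E\<^sub>k\<^sub>+\<^sub>1 f - E\<^sub>k f)\<close>,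
  and the square function is a sum over \<open>k\<close>. All estimates are made for finitely many consecutive
  generations, with bounds that do not depend on them, and extended by monotone convergence.

  Local testing and the quadratic condition imply the two weight inequality. One may take \<open>f \<ge> 0\<close>. In the
  first term, replace \<open>E\<^sub>k f\<close> by the running maximum \<open>M\<^sub>k\<close> of the averages over the coarser cubes considered and write
  \<open>M\<^sub>k\<^sup>2\<close> as the sum of its increments \<open>a\<^sub>j\<^sup>2\<close>, \<open>j \<le> k\<close>. After interchanging the sums the term is the left
  side of local testing for the family \<open>a\<close>, while the squares of \<open>a\<close> add up to \<open>M\<^sup>2\<close>, whose \<open>L\<^sup>p\<close>
  norm is controlled by Doob's inequality (\<open>maximal_ineq\<close>). In the second term,
  \<open>s\<^sub>k\<^sub>+\<^sub>1 \<bar>E\<^sub>k\<^sub>+\<^sub>1 f - E\<^sub>k f\<bar> \<le> 2\<^sup>N s\<^sub>k A\<^sub>k\<close> where \<open>A\<^sub>k\<close> is the average over \<open>Q\<^sub>k\<close> of \<open>\<bar>E\<^sub>k\<^sub>+\<^sub>1 f - E\<^sub>k f\<bar>\<close>; the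
  quadratic condition with the coefficients \<open>A\<^sub>k\<close> leaves the square function of the \<open>A\<^sub>k\<close>
  to be bounded in \<open>L\<^sup>p(\<sigma>)\<close> by \<open>f\<close>. This is \<open>square_ineq\<close>, an inequality of Burkholder and Stein type. It
  rests on \<open>A\<^sub>k\<^sup>2 \<le> c (E\<^sub>k f)\<^bsup>2-p\<^esup> (E\<^sub>k((E\<^sub>k\<^sub>+\<^sub>1 f)\<^sup>p) - (E\<^sub>k f)\<^sup>p)\<close> for \<open>1 < p \<le> 2\<close>, whose last factor telescopes under the integral; for
  \<open>p > 2\<close> the exponent 2 version is summed by parts.

  The two weight inequality implies global testing because the operator is linear with values in a
  Hilbert space: by Khintchine's inequality the vector valued square function is at most a constant times
  the average over random signs of the square functions of \<open>\<Sum> \<plusminus>a\<^sub>Q 1\<^sub>Q\<close>. One then uses the triangle inequality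
  in \<open>L\<^sup>q(w)\<close> and Khintchine's inequality for scalars in \<open>L\<^sup>p(\<sigma>)\<close>.

  Global testing dominates local testing term by term. It yields the quadratic condition if every
  child is given the coefficient of its parent: for a child \<open>R\<close> of \<open>Q\<close> the difference of \<open>1\<^sub>R\<sigma>\<close> on \<open>Q\<close> has modulus at
  least \<open>\<sigma>(R) / \<bar>Q\<bar>\<close> at every point of \<open>Q\<close>, and \<open>\<sigma>(Q)\<close> is the sum of the \<open>2\<^sup>N\<close> numbers \<open>\<sigma>(R)\<close>.
\<close>

section \<open>Scalar inequalities for powers\<close>

text \<open>
  Taylor's formula: for \<open>p \<le> 2\<close> the second derivative of the power is decreasing, and the intermediate point
  in the remainder is at most \<open>x + y\<close>.
\<close>

lemma powr_tangent_quadratic: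
  fixes x y p :: real
  assumes "1 < p" "p \<le> 2" "0 \<le> x" "0 < y"
  shows "p * (p - 1) / 2 * (x - y)\<^sup>2 * (x + y) powr (p - 2)
           \<le> x powr p - y powr p - p * y powr (p - 1) * (x - y)"
proof (cases "x = 0 \<or> x = y")
  case True
  then show ?thesis
  proof
    assume "x = 0"
    have "y powr p = y powr (p - 2) * y\<^sup>2"
      using assms by (simp add: powr_diff)
    moreover have "y powr p = y powr (p - 1) * y"
      using assms by (simp add: powr_diff)
    moreover have "p * (p - 1) / 2 * y powr p \<le> (p - 1) * y powr p"
      using assms mult_right_mono[of "p / 2" 1 "p - 1"] by (intro mult_right_mono) auto
    ultimately show ?thesis
      using \<open>x = 0\<close> assms by (simp add: algebra_simps)
  qed simp
next
  case False
  then have x: "0 < x" "x \<noteq> y" using assms by auto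
  \<comment> \<open>The derivatives of the power of order 0, 1 and 2, for Taylor expansion about \<open>y\<close>.\<close>
  define D where "D n t = (if n = 0 then t powr p else if n = 1 then p * t powr (p - 1)
                    else p * (p - 1) * t powr (p - 2))" for n :: nat and t :: real
  have "\<exists>t. (if x < y then x < t \<and> t < y else y < t \<and> t < x) \<and>
          x powr p = (\<Sum>m<2. (D m y / fact m) * (x - y) ^ m) + (D 2 t / fact 2) * (x - y) ^ 2"
  proof (rule Taylor[where a = "min x y" and b = "max x y"])
    show "\<forall>m t. m < 2 \<and> min x y \<le> t \<and> t \<le> max x y \<longrightarrow> DERIV (D m) t :> D (Suc m) t"
    proof clarify
      fix m :: nat and t :: real
      assume "m < 2" "min x y \<le> t"
      then have "0 < t" using x assms by (auto simp: min_def split: if_splits)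
      consider "m = 0" | "m = 1" using \<open>m < 2\<close> by linarith
      then show "DERIV (D m) t :> D (Suc m) t"
      proof cases
        case 1
        then show ?thesis unfolding D_def using \<open>0 < t\<close>
          by (auto intro!: derivative_eq_intros)
      next
        case 2
        then show ?thesis unfolding D_def
          using DERIV_cmult[OF has_real_derivative_powr[OF \<open>0 < t\<close>, of "p - 1"], of p]
          by (simp add: mult.assoc)
      qed
    qed
  qed (use x in \<open>auto simp: D_def\<close>)
  then obtain t where t: "if x < y then x < t \<and> t < y else y < t \<and> t < x"
    and eq: "x powr p = y powr p + p * y powr (p - 1) * (x - y)
               + p * (p - 1) / 2 * t powr (p - 2) * (x - y)\<^sup>2"
    by (auto simp: D_def numeral_2_eq_2)
  have "0 < t" "t \<le> x + y" using t x assms by (auto split: if_splits)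
  then have "(x + y) powr (p - 2) \<le> t powr (p - 2)"
    using assms by (intro powr_mono2') auto
  then have "p * (p - 1) / 2 * (x - y)\<^sup>2 * (x + y) powr (p - 2)
      \<le> p * (p - 1) / 2 * (x - y)\<^sup>2 * t powr (p - 2)"
    using assms by (intro mult_left_mono) auto
  then show ?thesis using eq by (simp add: algebra_simps)
qed

lemma powr_tangent:
  fixes x y p :: real
  assumes "1 \<le> p" "0 \<le> x" "0 \<le> y"
  shows "y powr p + p * y powr (p - 1) * (x - y) \<le> x powr p"
proof (cases "x = 0 \<or> y = 0")
  case True
  then show ?thesis
  proof
    assume "x = 0"
    then show ?thesis
      using assms mult_right_mono[of 1 p "y powr (p - 1) * y"]
      by (cases "y = 0") (auto simp: powr_diff field_simps)
  qed (use assms in auto)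
next
  case False
  then have pos: "0 < x" "0 < y" using assms by auto
  have "convex_on {0<..} (\<lambda>t::real. t powr p)"
  proof (rule f''_ge0_imp_convex[where f' = "\<lambda>t. p * t powr (p - 1)" and f'' = "\<lambda>t. p * (p - 1) * t powr (p - 2)"])
    fix t :: real assume "t \<in> {0<..}"
    then show "DERIV (\<lambda>t. p * t powr (p - 1)) t :> p * (p - 1) * t powr (p - 2)"
      using DERIV_cmult[OF has_real_derivative_powr[of t "p - 1"], of p]
      by (simp add: mult.assoc)
    show "DERIV (\<lambda>t. t powr p) t :> p * t powr (p - 1)"
      using \<open>t \<in> {0<..}\<close> by (intro has_real_derivative_powr) auto
  qed (use assms in auto)
  then have "p * y powr (p - 1) * (x - y) \<le> x powr p - y powr p"
    by (rule convex_on_imp_above_tangent[where A = "{0<..}"])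
       (use pos in \<open>auto intro!: derivative_eq_intros simp: interior_open connected_iff_interval\<close>)
  then show ?thesis by simp
qed

text \<open>
  Young's inequality in the form that lets the unknown \<open>v\<close> be absorbed on the left; it is the
  step that closes the maximal inequality and the square function estimate. The proof compares \<open>v\<close> with \<open>2 c u\<close>.
\<close>

lemma powr_absorb:
  fixes c u v s :: real
  assumes "1 \<le> s" "0 \<le> c" "0 \<le> u" "0 \<le> v"
  shows "c * u * v powr (s - 1) \<le> v powr s / 2 + (2 * c * u) powr s"
proof (cases "2 * c * u \<le> v")
  case True
  have "c * u * v powr (s - 1) \<le> v / 2 * v powr (s - 1)"
    using True by (intro mult_right_mono) auto
  also have "\<dots> = v powr s / 2"
    using assms by (cases "v = 0") (auto simp: powr_diff)
  finally show ?thesis by (simp add: add_increasing2)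
next
  case False
  then have pos: "0 < 2 * c * u" using assms by linarith
  have "v powr (s - 1) \<le> (2 * c * u) powr (s - 1)"
    using False assms by (intro powr_mono2) auto
  then have "c * u * v powr (s - 1) \<le> (2 * c * u) * (2 * c * u) powr (s - 1)"
    using assms pos by (intro mult_mono) auto
  also have "\<dots> = (2 * c * u) powr s"
    using pos by (simp add: powr_diff)
  finally show ?thesis by (simp add: add_increasing)
qed

lemma sum_powr_le:
  fixes x y r :: real
  assumes "0 \<le> x" "0 \<le> y" "0 \<le> r"
  shows "(x + y) powr r \<le> 2 powr r * (x powr r + y powr r)"
proof -
  have "(x + y) powr r \<le> (2 * max x y) powr r"
    using assms by (intro powr_mono2) auto
  also have "\<dots> = 2 powr r * max x y powr r"
    using assms by (simp add: powr_mult)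
  also have "\<dots> \<le> 2 powr r * (x powr r + y powr r)"
    by (intro mult_left_mono) (auto simp: max_def)
  finally show ?thesis .
qed

text \<open>
  Optimization over \<open>t\<close>. It replaces the Cauchy-Schwarz inequality for averages when both factors
  are only known through a pointwise bound that is linear in \<open>t\<close> and \<open>1 / t\<close>.
\<close>

lemma balanced_bound_imp_square_le:
  fixes a v c :: real
  assumes "\<And>t. 0 < t \<Longrightarrow> a \<le> t * v + c / t" "0 \<le> a" "0 \<le> v" "0 \<le> c"
  shows "a\<^sup>2 \<le> 4 * c * v"
proof (cases "v = 0 \<or> c = 0")
  case True
  have "a \<le> e" if "0 < e" for e
  proof -
    have "a \<le> (e / (v + 1)) * v + c / (e / (v + 1))" if "c = 0"
      using assms(1)[of "e / (v + 1)"] assms that \<open>0 < e\<close> by auto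
    moreover have "(e / (v + 1)) * v \<le> e"
      using assms \<open>0 < e\<close> by (simp add: field_simps)
    moreover have "a \<le> ((c + 1) / e) * v + c / ((c + 1) / e)"
      by (rule assms(1)) (use assms that in auto)
    moreover have "c / ((c + 1) / e) \<le> e"
      using assms \<open>0 < e\<close> by (simp add: field_simps)
    ultimately show ?thesis using True by auto
  qed
  then have "a \<le> 0" by (rule field_le_epsilon[of a 0, simplified])
  then show ?thesis using assms by auto
next
  case False
  then have pos: "0 < v" "0 < c" using assms by auto
  have "a \<le> sqrt (c / v) * v + c / sqrt (c / v)"
    by (rule assms(1)) (use pos in auto)
  also have "\<dots> = 2 * sqrt (c * v)"
    using pos by (simp add: real_sqrt_divide real_sqrt_mult field_simps)
  finally have "a\<^sup>2 \<le> (2 * sqrt (c * v))\<^sup>2"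
    using assms by (intro power_mono)
  also have "\<dots> = 4 * c * v" using pos by (simp add: power_mult_distrib)
  finally show ?thesis .
qed

lemma powr_jensen_sum:
  fixes \<theta> z :: "'i \<Rightarrow> real"
  assumes "finite I" "1 \<le> q" "\<And>i. i \<in> I \<Longrightarrow> 0 \<le> \<theta> i" "sum \<theta> I = 1" "\<And>i. i \<in> I \<Longrightarrow> 0 \<le> z i"
  shows "(\<Sum>i\<in>I. \<theta> i * z i) powr q \<le> (\<Sum>i\<in>I. \<theta> i * z i powr q)"
proof -
  define y where "y = (\<Sum>i\<in>I. \<theta> i * z i)"
  have "0 \<le> y" unfolding y_def using assms by (intro sum_nonneg) auto
  have "(\<Sum>i\<in>I. \<theta> i * (y powr q + q * y powr (q - 1) * (z i - y))) \<le> (\<Sum>i\<in>I. \<theta> i * z i powr q)"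
    using assms \<open>0 \<le> y\<close> by (intro sum_mono mult_left_mono powr_tangent) auto
  also have "(\<Sum>i\<in>I. \<theta> i * (y powr q + q * y powr (q - 1) * (z i - y)))
      = (y powr q) * sum \<theta> I + q * y powr (q - 1) * (y - y * sum \<theta> I)"
    unfolding sum_distrib_left y_def[symmetric]
    by (subst (3) y_def)
       (simp add: algebra_simps sum.distrib sum_subtractf sum_distrib_left sum_distrib_right)
  finally show ?thesis using assms by (simp add: y_def)
qed

text \<open>
  Both factors are at most the corresponding power of the maximum.
\<close>

lemma powr_geometric_mean_le:
  fixes a b t :: real
  assumes "0 \<le> a" "0 \<le> b" "0 \<le> t" "t \<le> 1"
  shows "a powr (1 - t) * b powr t \<le> a + b"
proof -
  have "a powr (1 - t) * b powr t \<le> max a b powr (1 - t) * max a b powr t"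
    using assms by (intro mult_mono powr_mono2) auto
  also have "\<dots> \<le> max a b"
    using assms by (simp add: powr_add[symmetric])
  also have "\<dots> \<le> a + b" using assms by auto
  finally show ?thesis .
qed

text \<open>
  For a variable \<open>g\<close> with mean \<open>y\<close>, the average of the right side is \<open>t V + 3 c / t\<close>, where \<open>V\<close> is the
  gap in Jensen's inequality for the power \<open>p\<close> and \<open>c\<close> is the coefficient of \<open>(2 + g / y) / t\<close>. The bound is the arithmetic-geometric
  mean inequality for \<open>\<bar>g - y\<bar>\<close>, split with the weight \<open>(g + y)\<^bsup>p-2\<^esup>\<close> of the quadratic tangent estimate.
\<close>

lemma deviation_pointwise:
  fixes g y p t :: real
  assumes p: "1 < p" "p \<le> 2" and "0 \<le> g" "0 < y" "0 < t"
  shows "\<bar>g - y\<bar> \<le> t * (g powr p - y powr p - p * y powr (p - 1) * (g - y))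
           + y powr (2 - p) / (2 * p * (p - 1)) / t * (2 + g / y)"
proof -
  define \<kappa> where "\<kappa> = p * (p - 1) / 2"
  define r where "r = (g + y) powr (p - 2)"
  have pos: "0 < \<kappa>" "0 < r" using assms by (auto simp: \<kappa>_def r_def)
  have inv: "1 / r = (g + y) powr (2 - p)"
    using assms by (simp add: r_def powr_minus_divide[symmetric])
  \<comment> \<open>The arithmetic-geometric mean inequality, by completing the square.\<close>
  have "0 \<le> (2 * t * \<kappa> * r * \<bar>g - y\<bar> - 1)\<^sup>2 / (4 * t * \<kappa> * r)"
    using pos \<open>0 < t\<close> by (intro divide_nonneg_pos) auto
  also have "\<dots> = t * \<kappa> * (g - y)\<^sup>2 * r + 1 / r / (4 * \<kappa> * t) - \<bar>g - y\<bar>"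
    using pos \<open>0 < t\<close> by (simp add: power2_diff power_mult_distrib field_simps power2_eq_square)
  finally have "\<bar>g - y\<bar> \<le> t * (\<kappa> * (g - y)\<^sup>2 * r) + 1 / r / (4 * \<kappa> * t)"
    by (simp add: algebra_simps)
  moreover have "t * (\<kappa> * (g - y)\<^sup>2 * r) \<le> t * (g powr p - y powr p - p * y powr (p - 1) * (g - y))"
    unfolding \<kappa>_def r_def using assms by (intro mult_left_mono powr_tangent_quadratic) auto
  moreover have "1 / r / (4 * \<kappa> * t) \<le> y powr (2 - p) * (2 + g / y) / (4 * \<kappa> * t)"
  proof (rule divide_right_mono)
    define s where "s = (g + y) / y"
    have "1 \<le> s" using assms by (simp add: s_def)
    have "s powr (2 - p) \<le> s powr 1" using p \<open>1 \<le> s\<close> by (intro powr_mono) auto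
    then have "s powr (2 - p) \<le> 1 + s" using \<open>1 \<le> s\<close> by simp
    moreover have "(g + y) powr (2 - p) = y powr (2 - p) * s powr (2 - p)"
      using assms by (simp add: s_def powr_divide)
    moreover have "1 + s = 2 + g / y" using assms by (simp add: s_def field_simps)
    ultimately show "1 / r \<le> y powr (2 - p) * (2 + g / y)"
      unfolding inv by (simp add: mult_left_mono)
  qed (use pos \<open>0 < t\<close> in auto)
  moreover have "y powr (2 - p) * (2 + g / y) / (4 * \<kappa> * t)
      = y powr (2 - p) / (2 * p * (p - 1)) / t * (2 + g / y)"
    by (simp add: \<kappa>_def)
  ultimately show ?thesis by linarith
qed

section \<open>Random signs\<close>

text \<open>
  A sign vector is a subset of \<open>F\<close>, the set of indices with sign \<open>+1\<close>; averages over sign vectors are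
  sums over \<open>Pow F\<close> divided by \<open>2 ^ card F\<close>, and moments are computed by adding one index at a time.
\<close>

definition sgn_of :: "'i set \<Rightarrow> 'i \<Rightarrow> real" where
  "sgn_of A i = (if i \<in> A then 1 else -1)"

definition signed_sum :: "'i set \<Rightarrow> ('i \<Rightarrow> real) \<Rightarrow> 'i set \<Rightarrow> real" where
  "signed_sum F t A = (\<Sum>i\<in>F. sgn_of A i * t i)"

lemma signed_sum_insert:
  assumes "finite F" "i \<notin> F" "A \<subseteq> F"
  shows "signed_sum (insert i F) t A = signed_sum F t A - t i"
    and "signed_sum (insert i F) t (insert i A) = signed_sum F t A + t i"
proof -
  have "i \<notin> A" using assms by auto
  have "(\<Sum>j\<in>F. sgn_of (insert i A) j * t j) = (\<Sum>j\<in>F. sgn_of A j * t j)"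
    using assms by (intro sum.cong) (auto simp: sgn_of_def)
  then show "signed_sum (insert i F) t (insert i A) = signed_sum F t A + t i"
    using assms by (simp add: signed_sum_def sgn_of_def)
  show "signed_sum (insert i F) t A = signed_sum F t A - t i"
    using assms \<open>i \<notin> A\<close> by (simp add: signed_sum_def sgn_of_def)
qed

lemma sum_Pow_insert:
  fixes h :: "'i set \<Rightarrow> real"
  assumes "finite F" "i \<notin> F"
  shows "(\<Sum>A\<in>Pow (insert i F). h A) = (\<Sum>A\<in>Pow F. h A + h (insert i A))"
proof -
  have inj: "inj_on (insert i) (Pow F)"
    using assms by (auto simp: inj_on_def)
  have "(\<Sum>A\<in>Pow (insert i F). h A) = (\<Sum>A\<in>Pow F. h A) + (\<Sum>A\<in>insert i ` Pow F. h A)"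
    unfolding Pow_insert using assms by (intro sum.union_disjoint) auto
  also have "(\<Sum>A\<in>insert i ` Pow F. h A) = (\<Sum>A\<in>Pow F. h (insert i A))"
    by (simp add: sum.reindex[OF inj])
  finally show ?thesis by (simp add: sum.distrib)
qed

lemma signed_sum_second_moment:
  assumes "finite F" "finite K"
  shows "(\<Sum>A\<in>Pow F. \<Sum>k\<in>K. (signed_sum F (\<lambda>i. t i k) A)\<^sup>2)
           = 2 ^ card F * (\<Sum>i\<in>F. \<Sum>k\<in>K. (t i k)\<^sup>2)"
  using assms(1)
proof (induction F rule: finite_induct)
  case empty
  then show ?case by (simp add: signed_sum_def)
next
  case (insert i F)
  have "(\<Sum>A\<in>Pow (insert i F). \<Sum>k\<in>K. (signed_sum (insert i F) (\<lambda>i. t i k) A)\<^sup>2)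
      = (\<Sum>A\<in>Pow F. \<Sum>k\<in>K. 2 * (signed_sum F (\<lambda>i. t i k) A)\<^sup>2 + 2 * (t i k)\<^sup>2)"
    unfolding sum_Pow_insert[OF insert.hyps] sum.distrib[symmetric]
    by (intro sum.cong refl)
       (use insert.hyps in \<open>simp add: signed_sum_insert power2_eq_square algebra_simps\<close>)
  also have "\<dots> = 2 * (\<Sum>A\<in>Pow F. \<Sum>k\<in>K. (signed_sum F (\<lambda>i. t i k) A)\<^sup>2)
      + 2 * 2 ^ card F * (\<Sum>k\<in>K. (t i k)\<^sup>2)"
    using insert.hyps by (simp add: sum.distrib sum_distrib_left card_Pow algebra_simps)
  finally show ?case using insert by (simp add: algebra_simps)
qed

text \<open>
  Fourth moment of a random sum in a Euclidean space, coordinates indexed by \<open>K\<close>. Adding a vector of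
  squared length \<open>b\<close>, with random sign, to one of squared length \<open>a\<close> turns \<open>a\<^sup>2\<close> into at most \<open>a\<^sup>2 + 6 a b + b\<^sup>2\<close> on average, by the Cauchy-Schwarz inequality for the
  cross term, and \<open>3 s\<^sup>2 + 6 s b + b\<^sup>2 \<le> 3 (s + b)\<^sup>2\<close>.
\<close>

lemma signed_sum_fourth_moment:
  assumes "finite F" "finite K"
  shows "(\<Sum>A\<in>Pow F. (\<Sum>k\<in>K. (signed_sum F (\<lambda>i. t i k) A)\<^sup>2)\<^sup>2)
           \<le> 2 ^ card F * (3 * (\<Sum>i\<in>F. \<Sum>k\<in>K. (t i k)\<^sup>2)\<^sup>2)"
  using assms(1)
proof (induction F rule: finite_induct)
  case empty
  then show ?case by (simp add: signed_sum_def)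
next
  case (insert i F)
  define X where "X A k = signed_sum F (\<lambda>i. t i k) A" for A k
  define a where "a A = (\<Sum>k\<in>K. (X A k)\<^sup>2)" for A
  define b where "b = (\<Sum>k\<in>K. (t i k)\<^sup>2)"
  define s where "s = (\<Sum>i\<in>F. \<Sum>k\<in>K. (t i k)\<^sup>2)"
  have "0 \<le> b" "0 \<le> s" by (auto simp: b_def s_def intro!: sum_nonneg)
  have step: "(\<Sum>k\<in>K. (X A k - t i k)\<^sup>2)\<^sup>2 + (\<Sum>k\<in>K. (X A k + t i k)\<^sup>2)\<^sup>2
      \<le> 2 * ((a A)\<^sup>2 + 6 * b * a A + b\<^sup>2)" for A
  proof -
    define c where "c = (\<Sum>k\<in>K. X A k * t i k)"
    have "c\<^sup>2 \<le> a A * b"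
      unfolding c_def a_def b_def by (rule Cauchy_Schwarz_ineq_sum)
    have e: "(\<Sum>k\<in>K. (X A k - t i k)\<^sup>2) = a A + b - 2 * c"
      "(\<Sum>k\<in>K. (X A k + t i k)\<^sup>2) = a A + b + 2 * c"
      unfolding a_def b_def c_def
      by (simp_all add: power2_eq_square algebra_simps sum.distrib sum_subtractf sum_distrib_left)
    show ?thesis
      unfolding e using \<open>c\<^sup>2 \<le> a A * b\<close> by (simp add: power2_eq_square algebra_simps)
  qed
  have "(\<Sum>A\<in>Pow (insert i F). (\<Sum>k\<in>K. (signed_sum (insert i F) (\<lambda>i. t i k) A)\<^sup>2)\<^sup>2)
      = (\<Sum>A\<in>Pow F. (\<Sum>k\<in>K. (X A k - t i k)\<^sup>2)\<^sup>2 + (\<Sum>k\<in>K. (X A k + t i k)\<^sup>2)\<^sup>2)"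
    unfolding sum_Pow_insert[OF insert.hyps] X_def
    by (intro sum.cong refl) (use insert.hyps in \<open>simp add: signed_sum_insert\<close>)
  also have "\<dots> \<le> (\<Sum>A\<in>Pow F. 2 * ((a A)\<^sup>2 + 6 * b * a A + b\<^sup>2))"
    by (intro sum_mono step)
  also have "\<dots> = 2 * (\<Sum>A\<in>Pow F. (a A)\<^sup>2) + 12 * b * (\<Sum>A\<in>Pow F. a A) + 2 * 2 ^ card F * b\<^sup>2"
    using insert.hyps
    by (simp add: sum.distrib sum_distrib_left sum_distrib_right card_Pow algebra_simps)
  also have "(\<Sum>A\<in>Pow F. a A) = 2 ^ card F * s"
    unfolding a_def X_def s_def using insert.hyps assms(2) by (intro signed_sum_second_moment)
  also have "(\<Sum>A\<in>Pow F. (a A)\<^sup>2) \<le> 2 ^ card F * (3 * s\<^sup>2)"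
    using insert.IH by (simp add: a_def X_def s_def)
  also have "2 * (2 ^ card F * (3 * s\<^sup>2)) + 12 * b * (2 ^ card F * s) + 2 * 2 ^ card F * b\<^sup>2
      = 2 ^ card (insert i F) * (3 * s\<^sup>2 + 6 * b * s + b\<^sup>2)"
    using insert.hyps by (simp add: algebra_simps)
  also have "\<dots> \<le> 2 ^ card (insert i F) * (3 * (s + b)\<^sup>2)"
    by (intro mult_left_mono) (auto simp: power2_eq_square algebra_simps)
  also have "s + b = (\<Sum>i\<in>insert i F. \<Sum>k\<in>K. (t i k)\<^sup>2)"
    using insert.hyps by (simp add: s_def b_def)
  finally show ?case by simp
qed

text \<open>
  The \<open>L\<^sup>1\<close> mean controls the \<open>L\<^sup>2\<close> mean: interpolate \<open>Y\<^sup>2 \<le> l Y + Y\<^sup>4 / l\<^sup>2\<close> and use the fourth moment. The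
  exponent one on the right is what allows the triangle inequality in every \<open>L\<^sup>q\<close>, \<open>q \<ge> 1\<close>, later on.
\<close>

lemma khintchine_lower:
  assumes "finite F" "finite K"
  shows "sqrt (\<Sum>i\<in>F. \<Sum>k\<in>K. (t i k)\<^sup>2)
           \<le> 5 / 2 ^ card F * (\<Sum>A\<in>Pow F. sqrt (\<Sum>k\<in>K. (signed_sum F (\<lambda>i. t i k) A)\<^sup>2))"
proof -
  define Y where "Y A = sqrt (\<Sum>k\<in>K. (signed_sum F (\<lambda>i. t i k) A)\<^sup>2)" for A
  define s where "s = (\<Sum>i\<in>F. \<Sum>k\<in>K. (t i k)\<^sup>2)"
  define c :: real where "c = 2 ^ card F"
  have "0 < c" by (simp add: c_def)
  have Y0: "0 \<le> Y A" and Y2: "(Y A)\<^sup>2 = (\<Sum>k\<in>K. (signed_sum F (\<lambda>i. t i k) A)\<^sup>2)" for A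
    by (auto simp: Y_def intro!: sum_nonneg)
  have "0 \<le> s" by (auto simp: s_def intro!: sum_nonneg)
  show ?thesis
  proof (cases "s = 0")
    case True
    then show ?thesis using Y0 unfolding s_def[symmetric] Y_def[symmetric]
      by (auto intro!: sum_nonneg divide_nonneg_nonneg)
  next
    case False
    \<comment> \<open>With this threshold the fourth moment contributes exactly half of the left side.\<close>
    define l where "l = sqrt (6 * s)"
    have l: "0 < l" "l\<^sup>2 = 6 * s" using False \<open>0 \<le> s\<close> by (auto simp: l_def)
    have pw: "(Y A)\<^sup>2 \<le> l * Y A + ((Y A)\<^sup>2)\<^sup>2 / (6 * s)" for A
    proof (cases "Y A \<le> l")
      case True
      then have "(Y A)\<^sup>2 \<le> l * Y A"
        using Y0[of A] by (simp add: power2_eq_square mult_right_mono)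
      then show ?thesis using \<open>0 \<le> s\<close> by (simp add: add_increasing2)
    next
      case False
      then have "l\<^sup>2 \<le> (Y A)\<^sup>2" using l by (intro power_mono) auto
      then have "(Y A)\<^sup>2 * l\<^sup>2 \<le> ((Y A)\<^sup>2)\<^sup>2"
        unfolding power2_eq_square[of "(Y A)\<^sup>2"] by (rule mult_left_mono) auto
      then have "(Y A)\<^sup>2 \<le> ((Y A)\<^sup>2)\<^sup>2 / (6 * s)"
        using l \<open>s \<noteq> 0\<close> \<open>0 \<le> s\<close> by (simp add: field_simps)
      then show ?thesis using Y0[of A] l by (simp add: add_increasing)
    qed
    have "c * s = (\<Sum>A\<in>Pow F. (Y A)\<^sup>2)"
      unfolding Y2 s_def c_def by (rule signed_sum_second_moment[symmetric]) (fact assms)+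
    also have "\<dots> \<le> (\<Sum>A\<in>Pow F. l * Y A + ((Y A)\<^sup>2)\<^sup>2 / (6 * s))"
      by (intro sum_mono pw)
    also have "\<dots> = l * (\<Sum>A\<in>Pow F. Y A) + (\<Sum>A\<in>Pow F. ((Y A)\<^sup>2)\<^sup>2) / (6 * s)"
      by (simp add: sum.distrib sum_distrib_left sum_divide_distrib)
    also have "(\<Sum>A\<in>Pow F. ((Y A)\<^sup>2)\<^sup>2) \<le> c * (3 * s\<^sup>2)"
      unfolding Y2 s_def c_def by (rule signed_sum_fourth_moment) (fact assms)+
    also have "c * (3 * s\<^sup>2) / (6 * s) = c * s / 2"
      using False by (simp add: power2_eq_square)
    finally have "c * s \<le> 2 * l * (\<Sum>A\<in>Pow F. Y A)"
      using \<open>0 \<le> s\<close> by (simp add: divide_right_mono)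
    moreover have "l = sqrt 6 * sqrt s" by (simp add: l_def real_sqrt_mult)
    ultimately have "sqrt s * (c * sqrt s) \<le> sqrt s * (2 * sqrt 6 * (\<Sum>A\<in>Pow F. Y A))"
      using \<open>0 \<le> s\<close> by (simp add: algebra_simps)
    then have "c * sqrt s \<le> 2 * sqrt 6 * (\<Sum>A\<in>Pow F. Y A)"
      using False \<open>0 \<le> s\<close> by simp
    also have "2 * sqrt 6 \<le> (5::real)"
      using real_le_lsqrt[of "5/2" 6] by (simp add: power2_eq_square)
    finally have "c * sqrt s \<le> 5 * (\<Sum>A\<in>Pow F. Y A)"
      using Y0 by (simp add: mult_right_mono sum_nonneg)
    then show ?thesis
      using \<open>0 < c\<close> unfolding s_def[symmetric] Y_def[symmetric] c_def[symmetric]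
      by (simp add: field_simps)
  qed
qed

lemma tanh_le_self: "0 \<le> x \<Longrightarrow> tanh x \<le> (x::real)"
proof -
  assume "0 \<le> x"
  have "0 - tanh 0 \<le> x - tanh x"
    by (rule DERIV_nonneg_imp_nondecreasing[OF \<open>0 \<le> x\<close>])
       (auto intro!: exI derivative_eq_intros)
  then show ?thesis by simp
qed

lemma cosh_le_exp_half_square: "cosh x \<le> exp (x\<^sup>2 / 2)" for x :: real
proof -
  have "cosh x \<le> exp (x\<^sup>2 / 2)" if "0 \<le> x" for x :: real
  proof -
    have "0\<^sup>2 / 2 - ln (cosh 0) \<le> x\<^sup>2 / 2 - ln (cosh x)"
    proof (rule DERIV_nonneg_imp_nondecreasing[OF that])
      fix y :: real assume "0 \<le> y"
      have "DERIV (\<lambda>x. x\<^sup>2 / 2 - ln (cosh x)) y :> y - tanh y"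
        by (auto intro!: derivative_eq_intros simp: tanh_def)
      then show "\<exists>d. DERIV (\<lambda>x. x\<^sup>2 / 2 - ln (cosh x)) y :> d \<and> 0 \<le> d"
        using tanh_le_self[OF \<open>0 \<le> y\<close>] by (intro exI[of _ "y - tanh y"]) auto
    qed
    then have "ln (cosh x) \<le> x\<^sup>2 / 2" by simp
    then have "exp (ln (cosh x)) \<le> exp (x\<^sup>2 / 2)" by (simp only: exp_le_cancel_iff)
    then show ?thesis by simp
  qed
  from this[of "\<bar>x\<bar>"] show ?thesis by simp
qed

lemma signed_sum_exp_moment:
  assumes "finite F"
  shows "(\<Sum>A\<in>Pow F. exp (signed_sum F t A)) \<le> 2 ^ card F * exp ((\<Sum>i\<in>F. (t i)\<^sup>2) / 2)"
  using assms
proof (induction F rule: finite_induct)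
  case empty
  then show ?case by (simp add: signed_sum_def)
next
  case (insert i F)
  have "(\<Sum>A\<in>Pow (insert i F). exp (signed_sum (insert i F) t A))
      = (\<Sum>A\<in>Pow F. exp (signed_sum F t A) * (2 * cosh (t i)))"
    unfolding sum_Pow_insert[OF insert.hyps]
    by (intro sum.cong refl)
       (use insert.hyps in \<open>simp add: signed_sum_insert cosh_field_def exp_add exp_diff exp_minus field_simps\<close>)
  also have "\<dots> = 2 * cosh (t i) * (\<Sum>A\<in>Pow F. exp (signed_sum F t A))"
    by (simp add: sum_distrib_left mult.commute)
  also have "\<dots> \<le> 2 * exp ((t i)\<^sup>2 / 2) * (2 ^ card F * exp ((\<Sum>i\<in>F. (t i)\<^sup>2) / 2))"
    by (intro mult_mono insert.IH cosh_le_exp_half_square) (auto intro!: sum_nonneg)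
  also have "\<dots> = 2 ^ card (insert i F) * exp ((\<Sum>i\<in>insert i F. (t i)\<^sup>2) / 2)"
    using insert.hyps by (simp add: exp_add[symmetric] add_divide_distrib algebra_simps)
  finally show ?case .
qed

lemma powr_le_exp:
  fixes x p :: real
  assumes "0 \<le> x" "0 < p"
  shows "x powr p \<le> p powr p * exp x"
proof (cases "x = 0")
  case False
  then have "0 < x / p" using assms by auto
  then have "ln (x / p) \<le> x / p - 1" by (rule ln_le_minus_one)
  then have "p * ln (x / p) \<le> x"
    using assms by (simp add: field_simps)
  then have "(x / p) powr p \<le> exp x"
    using False assms by (simp add: powr_def)
  then show ?thesis using assms by (simp add: powr_divide field_simps)
qed (use assms in auto)

text \<open>
  After normalization the random sum has exponential moments bounded by \<open>exp (1/2)\<close>, which dominate every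
  power.
\<close>

lemma khintchine_upper:
  assumes "finite F" "0 < p"
  shows "(\<Sum>A\<in>Pow F. \<bar>signed_sum F t A\<bar> powr p)
           \<le> 2 ^ card F * (2 * p powr p * exp (1/2)) * (\<Sum>i\<in>F. (t i)\<^sup>2) powr (p / 2)"
proof (cases "(\<Sum>i\<in>F. (t i)\<^sup>2) = 0")
  case True
  then have "t i = 0" if "i \<in> F" for i
    using that assms by (simp add: sum_nonneg_eq_0_iff)
  then have "signed_sum F t A = 0" for A by (simp add: signed_sum_def)
  then show ?thesis by (simp add: sum_nonneg)
next
  case False
  define s where "s = (\<Sum>i\<in>F. (t i)\<^sup>2)"
  have "0 \<le> s" by (auto simp: s_def intro!: sum_nonneg)
  then have "0 < s" using False by (simp add: s_def)
  define u where "u i = t i / sqrt s" for i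
  have u: "(\<Sum>i\<in>F. (u i)\<^sup>2) = 1"
    using \<open>0 < s\<close> by (simp add: u_def power_divide sum_divide_distrib[symmetric]) (simp add: s_def)
  have su: "signed_sum F t A = sqrt s * signed_sum F u A" for A
    using \<open>0 < s\<close> by (simp add: signed_sum_def u_def sum_distrib_left mult.left_commute)
  have neg: "- signed_sum F u A = signed_sum F (\<lambda>i. - u i) A" for A
    by (simp add: signed_sum_def sum_negf)
  have "(\<Sum>A\<in>Pow F. \<bar>signed_sum F u A\<bar> powr p)
      \<le> (\<Sum>A\<in>Pow F. p powr p * (exp (signed_sum F u A) + exp (signed_sum F (\<lambda>i. - u i) A)))"
  proof (intro sum_mono)
    fix A
    have "\<bar>signed_sum F u A\<bar> powr p \<le> p powr p * exp \<bar>signed_sum F u A\<bar>"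
      using assms by (intro powr_le_exp) auto
    also have "\<dots> \<le> p powr p * (exp (signed_sum F u A) + exp (- signed_sum F u A))"
      by (intro mult_left_mono) (auto simp: abs_if)
    finally show "\<bar>signed_sum F u A\<bar> powr p
        \<le> p powr p * (exp (signed_sum F u A) + exp (signed_sum F (\<lambda>i. - u i) A))"
      by (simp add: neg)
  qed
  also have "\<dots> = p powr p * ((\<Sum>A\<in>Pow F. exp (signed_sum F u A))
      + (\<Sum>A\<in>Pow F. exp (signed_sum F (\<lambda>i. - u i) A)))"
    by (simp only: sum_distrib_left[symmetric] sum.distrib)
  also have "\<dots> \<le> p powr p * (2 ^ card F * exp (1/2) + 2 ^ card F * exp (1/2))"
    using signed_sum_exp_moment[OF assms(1), of u] signed_sum_exp_moment[OF assms(1), of "\<lambda>i. - u i"] u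
    by (intro mult_left_mono add_mono) auto
  finally have *: "(\<Sum>A\<in>Pow F. \<bar>signed_sum F u A\<bar> powr p) \<le> 2 ^ card F * (2 * p powr p * exp (1/2))"
    by (simp add: algebra_simps)
  have "(\<Sum>A\<in>Pow F. \<bar>signed_sum F t A\<bar> powr p)
      = s powr (p / 2) * (\<Sum>A\<in>Pow F. \<bar>signed_sum F u A\<bar> powr p)"
    using \<open>0 < s\<close>
    by (simp add: su abs_mult powr_mult sum_distrib_left powr_half_sqrt[symmetric] powr_powr mult.commute)
  also have "\<dots> \<le> s powr (p / 2) * (2 ^ card F * (2 * p powr p * exp (1/2)))"
    by (intro mult_left_mono *) auto
  finally show ?thesis by (simp add: s_def mult.commute)
qed

definition khintchine_const :: "real \<Rightarrow> real" where
  "khintchine_const p = (2 * p powr p * exp (1 / 2)) powr (1 / p)"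

section \<open>Powers of extended nonnegative reals\<close>

lemma epowr_ennreal [simp]: "0 \<le> x \<Longrightarrow> epowr (ennreal x) r = ennreal (x powr r)"
  by (simp add: epowr_def)

lemma epowr_infinity [simp]: "epowr \<infinity> r = \<infinity>" "epowr top r = top"
  by (simp_all add: epowr_def)

lemma epowr_eq_infinity [simp]: "epowr x r = \<infinity> \<longleftrightarrow> x = \<infinity>" "epowr x r = top \<longleftrightarrow> x = top"
  by (simp_all add: epowr_def)

lemma epowr_mono: "0 \<le> r \<Longrightarrow> x \<le> y \<Longrightarrow> epowr x r \<le> epowr y r"
  by (cases x; cases y) (auto simp: epowr_def top_unique intro!: ennreal_leI powr_mono2)

lemma epowr_epowr: "epowr (epowr x r) s = epowr x (r * s)"
  by (cases x) (auto simp: powr_powr)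

lemma epowr_one [simp]: "epowr x 1 = x"
  by (cases x) auto

text \<open>
  The power map and its inverse form a Galois connection, so the power map preserves suprema.
\<close>

lemma epowr_le_iff: "0 < r \<Longrightarrow> epowr x r \<le> y \<longleftrightarrow> x \<le> epowr y (1 / r)"
  using epowr_mono[of "1/r" "epowr x r" y] epowr_mono[of r x "epowr y (1/r)"]
  by (auto simp: epowr_epowr)

lemma epowr_SUP: "0 < r \<Longrightarrow> epowr (SUP i\<in>I. X i) r = (SUP i\<in>I. epowr (X i) r)"
proof (rule antisym)
  assume "0 < r"
  show "epowr (SUP i\<in>I. X i) r \<le> (SUP i\<in>I. epowr (X i) r)"
    unfolding epowr_le_iff[OF \<open>0 < r\<close>]
    using \<open>0 < r\<close> by (intro SUP_least) (auto simp: epowr_le_iff[symmetric] intro: SUP_upper)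
  show "(SUP i\<in>I. epowr (X i) r) \<le> epowr (SUP i\<in>I. X i) r"
    by (intro SUP_least epowr_mono SUP_upper) (use \<open>0 < r\<close> in auto)
qed

lemma esqrt_power2 [simp]: "(esqrt x)\<^sup>2 = x"
  unfolding power2_eq_square
  by (cases x) (auto simp: esqrt_def powr_half_sqrt ennreal_mult[symmetric])

lemma epowr_esqrt: "epowr (esqrt x) r = epowr x (r / 2)"
  by (simp add: esqrt_def epowr_epowr)

lemma epowr_mult: "epowr (x * y) r = epowr x r * epowr y r" if "0 < r"
proof (cases x; cases y)
  fix s t assume "x = ennreal s" "0 \<le> s" "y = ennreal t" "0 \<le> t"
  then show ?thesis by (simp add: ennreal_mult[symmetric] powr_mult)
qed (use that in \<open>auto simp: ennreal_mult_top ennreal_top_mult epowr_def\<close>)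

lemma borel_measurable_epowr [measurable]:
  assumes [measurable]: "f \<in> borel_measurable M"
  shows "(\<lambda>x. epowr (f x) r) \<in> borel_measurable M"
  unfolding epowr_def by measurable

lemma Lnorm_le_iff:
  assumes "0 < p"
  shows "Lnorm M p F \<le> y \<longleftrightarrow> (\<integral>\<^sup>+ x. epowr (F x) p \<partial>M) \<le> epowr y p"
  unfolding Lnorm_def using assms by (subst epowr_le_iff) auto

text \<open>Continuity of the power function: strict slack in the base may be dropped.\<close>

lemma ennreal_le_powr_limit:
  assumes "\<And>d. 0 < d \<Longrightarrow> X \<le> ennreal ((L + d) powr q)" "0 \<le> L" "0 < q"
  shows "X \<le> ennreal (L powr q)"
proof -
  have "((\<lambda>d. ennreal ((L + d) powr q)) \<longlongrightarrow> ennreal ((L + 0) powr q)) (at_right 0)"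
    using assms by (intro tendsto_ennrealI tendsto_powr' tendsto_intros)
      (auto simp: eventually_at_filter)
  then have lim: "((\<lambda>d. ennreal ((L + d) powr q)) \<longlongrightarrow> ennreal (L powr q)) (at_right 0)"
    by simp
  show ?thesis
    by (rule tendsto_lowerbound[OF lim]) (use assms in \<open>auto simp: eventually_at_filter\<close>)
qed

lemma nn_integral_cmult_real:
  assumes "0 \<le> c" "\<And>x. 0 \<le> f x" "(\<lambda>x. ennreal (f x)) \<in> borel_measurable M"
  shows "(\<integral>\<^sup>+ x. ennreal (c * f x) \<partial>M) = ennreal c * (\<integral>\<^sup>+ x. ennreal (f x) \<partial>M)"
  using assms by (subst nn_integral_cmult[symmetric]) (auto simp: ennreal_mult)

abbreviation moment :: "'a measure \<Rightarrow> real \<Rightarrow> ('a \<Rightarrow> real) \<Rightarrow> ennreal" where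
  "moment M r f \<equiv> (\<integral>\<^sup>+ x. ennreal (f x powr r) \<partial>M)"

text \<open>
  The triangle inequality for finite sums, with upper bounds \<open>l i\<close> for the norms: after division by their
  sum it is convexity of the power.
\<close>

lemma minkowski_sum:
  fixes u :: "'i \<Rightarrow> 'a \<Rightarrow> real"
  assumes "finite I" "1 \<le> q"
    and [measurable]: "\<And>i. i \<in> I \<Longrightarrow> u i \<in> borel_measurable M"
    and u: "\<And>i x. i \<in> I \<Longrightarrow> 0 \<le> u i x"
    and l: "\<And>i. i \<in> I \<Longrightarrow> 0 \<le> l i"
    and le: "\<And>i. i \<in> I \<Longrightarrow> moment M q (u i) \<le> ennreal (l i powr q)"
  shows "moment M q (\<lambda>x. \<Sum>i\<in>I. u i x) \<le> ennreal ((\<Sum>i\<in>I. l i) powr q)"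
proof (cases "I = {}")
  case False
  show ?thesis
  proof (rule ennreal_le_powr_limit)
    fix d :: real assume "0 < d"
    \<comment> \<open>The slack \<open>d\<close> makes the weights of the convex combination positive.\<close>
    define c where "c i = l i + d / card I" for i
    define L where "L = (\<Sum>i\<in>I. c i)"
    have card: "0 < card I" using False assms(1) by (simp add: card_gt_0_iff)
    have c: "0 < c i" "l i \<le> c i" if "i \<in> I" for i
      using l[OF that] \<open>0 < d\<close> card by (auto simp: c_def intro!: add_nonneg_pos)
    have L: "L = (\<Sum>i\<in>I. l i) + d"
      using card by (simp add: L_def c_def sum.distrib)
    have "0 < L" unfolding L_def using assms(1) False c by (intro sum_pos) auto
    have pw: "(\<Sum>i\<in>I. u i x) powr q \<le> L powr q * (\<Sum>i\<in>I. c i / L * (1 / c i powr q * u i x powr q))" for x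
    proof -
      have jensen: "(\<Sum>i\<in>I. c i / L * (u i x / c i)) powr q \<le> (\<Sum>i\<in>I. c i / L * (u i x / c i) powr q)"
      proof (rule powr_jensen_sum)
        show "(\<Sum>i\<in>I. c i / L) = 1"
          using \<open>0 < L\<close> by (simp add: sum_divide_distrib[symmetric] L_def[symmetric])
      qed (use assms c \<open>0 < L\<close> in \<open>auto intro!: divide_nonneg_nonneg simp: less_imp_le\<close>)
      have mean: "(\<Sum>i\<in>I. c i / L * (u i x / c i)) = (\<Sum>i\<in>I. u i x) / L"
        unfolding sum_divide_distrib using c by (intro sum.cong) (auto simp: less_le)
      have terms: "(\<Sum>i\<in>I. c i / L * (u i x / c i) powr q)
          = (\<Sum>i\<in>I. c i / L * (1 / c i powr q * u i x powr q))"
        using c u by (intro sum.cong) (auto simp: powr_divide less_imp_le)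
      have "(\<Sum>i\<in>I. u i x) powr q / L powr q \<le> (\<Sum>i\<in>I. c i / L * (1 / c i powr q * u i x powr q))"
        using jensen \<open>0 < L\<close> u unfolding mean terms by (simp add: powr_divide sum_nonneg)
      then show ?thesis
        using \<open>0 < L\<close> by (simp add: divide_le_eq mult.commute)
    qed
    have "moment M q (\<lambda>x. \<Sum>i\<in>I. u i x)
        \<le> (\<integral>\<^sup>+ x. ennreal (L powr q) * (\<Sum>i\<in>I. ennreal (c i / L * (1 / c i powr q)) * ennreal (u i x powr q)) \<partial>M)"
    proof (rule nn_integral_mono)
      fix x
      have "ennreal (L powr q) * (\<Sum>i\<in>I. ennreal (c i / L * (1 / c i powr q)) * ennreal (u i x powr q))
          = ennreal (L powr q * (\<Sum>i\<in>I. c i / L * (1 / c i powr q * u i x powr q)))"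
        using c \<open>0 < L\<close>
        by (simp add: ennreal_mult[symmetric] sum_nonneg less_imp_le mult.assoc)
      then show "ennreal ((\<Sum>i\<in>I. u i x) powr q) \<le> ennreal (L powr q) * (\<Sum>i\<in>I. ennreal (c i / L * (1 / c i powr q)) * ennreal (u i x powr q))"
        using pw[of x] by (simp add: ennreal_leI)
    qed
    also have "\<dots> = ennreal (L powr q) * (\<Sum>i\<in>I. ennreal (c i / L * (1 / c i powr q)) * moment M q (u i))"
      by (simp add: nn_integral_cmult nn_integral_sum)
    also have "\<dots> \<le> ennreal (L powr q) * (\<Sum>i\<in>I. ennreal (c i / L * (1 / c i powr q)) * ennreal (c i powr q))"
      using c l assms(2)
      by (intro mult_left_mono sum_mono order_trans[OF le]) (auto intro!: ennreal_leI powr_mono2)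
    also have "(\<Sum>i\<in>I. ennreal (c i / L * (1 / c i powr q)) * ennreal (c i powr q)) = (\<Sum>i\<in>I. ennreal (c i / L))"
      using c \<open>0 < L\<close> by (intro sum.cong refl) (subst ennreal_mult[symmetric], auto simp: less_imp_le less_le)
    also have "\<dots> = 1"
      using c \<open>0 < L\<close> by (subst sum_ennreal) (auto simp: sum_divide_distrib[symmetric] L_def[symmetric] less_imp_le)
    finally show "moment M q (\<lambda>x. \<Sum>i\<in>I. u i x) \<le> ennreal (((\<Sum>i\<in>I. l i) + d) powr q)"
      by (simp add: L)
  qed (use assms in \<open>auto intro!: sum_nonneg\<close>)
qed simp

text \<open>
  The finiteness hypothesis is essential; the maximal and square function estimates therefore first
  establish a crude finite bound.
\<close>

lemma ennreal_absorb_half: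
  fixes I B :: ennreal
  assumes "I \<le> ennreal (1 / 2) * I + B" "I < \<infinity>"
  shows "I \<le> ennreal 2 * B"
proof (cases B)
  case (real b)
  from assms(2) obtain i where i: "I = ennreal i" "0 \<le> i" by (cases I) auto
  have "ennreal i \<le> ennreal (1 / 2 * i + b)"
    using assms(1) ennreal_plus[of "1 / 2 * i" b] ennreal_mult[of "1 / 2" i] i real by simp
  then have "i \<le> 2 * b" using i real by (subst (asm) ennreal_le_iff) auto
  then have "ennreal i \<le> ennreal (2 * b)" by (rule ennreal_leI)
  then show ?thesis using i real ennreal_mult[of 2 b] by simp
qed (simp add: ennreal_mult_top)

section \<open>Sums of nonnegative terms\<close>

lemma infsum_ennreal_SUP: "infsum f A = (SUP F\<in>{F. finite F \<and> F \<subseteq> A}. sum f F)" for f :: "'a \<Rightarrow> ennreal"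
  by (rule nonneg_infsum_complete) simp

lemma sum_le_infsum_ennreal: "finite F \<Longrightarrow> F \<subseteq> A \<Longrightarrow> sum f F \<le> infsum f A" for f :: "'a \<Rightarrow> ennreal"
  unfolding infsum_ennreal_SUP by (intro SUP_upper) auto

lemma infsum_ennreal_SUP_incseq:
  fixes f :: "'a \<Rightarrow> ennreal"
  assumes "incseq G" "\<And>n. finite (G n)" "(\<Union>n. G n) = A"
  shows "infsum f A = (SUP n. sum f (G n))"
proof (rule antisym)
  show "infsum f A \<le> (SUP n. sum f (G n))"
    unfolding infsum_ennreal_SUP
  proof (intro SUP_least)
    fix F assume "F \<in> {F. finite F \<and> F \<subseteq> A}"
    then have "finite F" "F \<subseteq> (\<Union>n. G n)" using assms(3) by auto
    then have "\<exists>n. F \<subseteq> G n"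
    proof (induction F rule: finite_induct)
      case (insert y F)
      then obtain n m where "F \<subseteq> G n" "y \<in> G m" by auto
      moreover have "G n \<subseteq> G (max n m)" "G m \<subseteq> G (max n m)"
        by (intro incseqD[OF assms(1)], simp)+
      ultimately have "insert y F \<subseteq> G (max n m)" by blast
      then show ?case ..
    qed auto
    then obtain n where "F \<subseteq> G n" ..
    then have "sum f F \<le> sum f (G n)" by (intro sum_mono2 assms) auto
    then show "sum f F \<le> (SUP n. sum f (G n))" by (rule order_trans) (auto intro: SUP_upper)
  qed
  show "(SUP n. sum f (G n)) \<le> infsum f A"
    using assms by (intro SUP_least sum_le_infsum_ennreal) auto
qed

lemma countable_exhaustion:
  assumes "countable A"
  shows "\<exists>G :: nat \<Rightarrow> 'a set. incseq G \<and> (\<forall>n. finite (G n)) \<and> (\<Union>n. G n) = A"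
proof (intro exI conjI allI)
  let ?G = "\<lambda>n. A \<inter> {x. to_nat_on A x < n}"
  show "incseq ?G" by (auto simp: incseq_def)
  show "finite (?G n)" for n
  proof (rule inj_on_finite)
    show "inj_on (to_nat_on A) (?G n)"
      by (rule inj_on_subset[OF inj_on_to_nat_on[OF assms]]) auto
    show "to_nat_on A ` ?G n \<subseteq> {..<n}" by auto
  qed auto
  show "(\<Union>n. ?G n) = A" by auto
qed

lemma borel_measurable_infsum [measurable]:
  fixes f :: "'a \<Rightarrow> 'b \<Rightarrow> ennreal"
  assumes "countable A" and [measurable]: "\<And>a. a \<in> A \<Longrightarrow> f a \<in> borel_measurable M"
  shows "(\<lambda>x. infsum (\<lambda>a. f a x) A) \<in> borel_measurable M"
proof -
  obtain G :: "nat \<Rightarrow> 'a set" where G: "incseq G" "\<And>n. finite (G n)" "(\<Union>n. G n) = A"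
    using countable_exhaustion[OF assms(1)] by blast
  have "f a \<in> borel_measurable M" if "a \<in> G n" for n a
    by (rule assms(2)) (use that G(3) in auto)
  then show ?thesis
    unfolding infsum_ennreal_SUP_incseq[OF G] by (intro borel_measurable_SUP borel_measurable_sum) auto
qed

lemma nn_integral_epowr_SUP:
  assumes "incseq G" "0 < r" and [measurable]: "\<And>n::nat. G n \<in> borel_measurable M"
  shows "(\<integral>\<^sup>+ x. epowr (SUP n. G n x) r \<partial>M) = (SUP n. \<integral>\<^sup>+ x. epowr (G n x) r \<partial>M)"
  unfolding epowr_SUP[OF assms(2)]
  by (rule nn_integral_monotone_convergence_SUP)
     (use assms in \<open>auto simp: incseq_def le_fun_def intro!: epowr_mono\<close>)

section \<open>Geometry of a dyadic lattice\<close>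

lemma dyadic_cube_sandwich:
  "box x (\<chi> i. x $ i + 2 powi (- k)) \<subseteq> dyadic_cube k x"
  "dyadic_cube k x \<subseteq> cbox x (\<chi> i. x $ i + 2 powi (- k))"
  by (auto simp: dyadic_cube_def mem_box_cart less_imp_le)

lemma dyadic_cube_borel [measurable]: "dyadic_cube k x \<in> sets borel"
proof -
  have "closed {y. x $ i \<le> y $ i}" "open {y. y $ i < x $ i + 2 powi (- k)}" for i
    by (rule closed_halfspace_component_ge_cart
          open_halfspace_component_lt_cart)+
  then have "{y. x $ i \<le> y $ i} \<inter> {y. y $ i < x $ i + 2 powi (- k)} \<in> sets borel" for i
    by (intro sets.Int borel_closed borel_open)
  then have "(\<Inter>i\<in>UNIV. {y. x $ i \<le> y $ i} \<inter> {y. y $ i < x $ i + 2 powi (- k)}) \<in> sets borel"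
    by (intro sets.finite_INT) auto
  also have "(\<Inter>i\<in>UNIV. {y. x $ i \<le> y $ i} \<inter> {y. y $ i < x $ i + 2 powi (- k)}) = dyadic_cube k x"
    by (auto simp: dyadic_cube_def)
  finally show ?thesis .
qed

lemma vol_dyadic_cube: "vol (dyadic_cube k (x :: real ^ 'n::finite)) = (2 powi (- k)) ^ CARD('n)"
proof -
  let ?u = "\<chi> i. x $ i + 2 powi (- k)"
  have le: "x $ i \<le> ?u $ i" for i by simp
  have "measure lborel (cbox x ?u) = (2 powi (- k)) ^ CARD('n)"
    by (subst content_cbox_cart) (auto simp: interval_ne_empty_cart)
  moreover have "measure lborel (box x ?u) = measure lborel (cbox x ?u)"
    by (simp add: measure_def emeasure_lborel_box_eq emeasure_lborel_cbox_eq)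
  moreover have "measure lborel (box x ?u) \<le> measure lborel (dyadic_cube k x)"
    using fmeasurableI2[OF fmeasurable_cbox dyadic_cube_sandwich(2)[of k x]]
    by (intro measure_mono_fmeasurable dyadic_cube_sandwich) auto
  moreover have "measure lborel (dyadic_cube k x) \<le> measure lborel (cbox x ?u)"
    by (intro measure_mono_fmeasurable dyadic_cube_sandwich) auto
  ultimately show ?thesis by (simp add: vol_def)
qed

locale dyadic_grid =
  fixes D :: "int \<Rightarrow> (real ^ 'n::finite) set set"
  assumes lattice: "dyadic_lattice D"
begin

definition cube :: "int \<Rightarrow> real ^ 'n \<Rightarrow> (real ^ 'n) set" where
  "cube k x = (THE Q. Q \<in> D k \<and> x \<in> Q)"

lemmas lattice_at = lattice[unfolded dyadic_lattice_def, THEN spec]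

lemma D_dyadic: "Q \<in> D k \<Longrightarrow> \<exists>x. Q = dyadic_cube k x"
  using lattice_at[of k, THEN conjunct1] by blast

lemma D_disjoint: "Q \<in> D k \<Longrightarrow> R \<in> D k \<Longrightarrow> x \<in> Q \<Longrightarrow> x \<in> R \<Longrightarrow> Q = R"
  using disjointD[OF lattice_at[of k, THEN conjunct2, THEN conjunct1], of Q R] by blast

lemma D_cover: "\<exists>Q\<in>D k. x \<in> Q"
proof -
  have "x \<in> \<Union>(D k)" using lattice_at[of k, THEN conjunct2, THEN conjunct2, THEN conjunct1] by simp
  then show ?thesis by blast
qed

lemma D_children:
  assumes "Q \<in> D k"
  shows "\<exists>C \<subseteq> D (k + 1). card C = 2 ^ CARD('n) \<and> Q = \<Union>C"
  using lattice_at[of k, THEN conjunct2, THEN conjunct2, THEN conjunct2, THEN bspec, OF assms] by blast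

lemma D_nonempty: "Q \<in> D k \<Longrightarrow> \<exists>x. x \<in> Q"
  using D_dyadic[of Q k] by (auto simp: dyadic_cube_def)

lemma cube_in [simp]: "cube k x \<in> D k" and mem_cube [simp]: "x \<in> cube k x"
proof -
  have "\<exists>!Q. Q \<in> D k \<and> x \<in> Q" using D_cover[of k x] D_disjoint by blast
  from theI'[OF this] show "cube k x \<in> D k" "x \<in> cube k x" by (auto simp: cube_def)
qed

lemma cube_eq: "Q \<in> D k \<Longrightarrow> x \<in> Q \<Longrightarrow> cube k x = Q"
  using D_disjoint[OF cube_in _ mem_cube] by blast

lemma mem_cube_iff: "y \<in> cube k x \<longleftrightarrow> cube k y = cube k x"
  using cube_eq[OF cube_in, of y k x] mem_cube[of y k] by blast

lemma cube_in_cubes [simp]: "cube k x \<in> cubes D"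
  by (auto simp: cubes_def intro!: exI[of _ k])

lemma D_eq_cube: "Q \<in> D k \<Longrightarrow> \<exists>x. Q = cube k x"
  using D_nonempty[of Q k] cube_eq[of Q k] by blast

lemma cube_Suc_subset: "cube (k + 1) x \<subseteq> cube k x"
proof -
  obtain C where C: "C \<subseteq> D (k + 1)" "cube k x = \<Union>C"
    using D_children[OF cube_in, of k x] by auto
  then have "x \<in> \<Union>C" using mem_cube[of x k] by simp
  then obtain Q where "Q \<in> C" "x \<in> Q" by blast
  then have "cube (k + 1) x = Q" using C(1) by (intro cube_eq) auto
  then show ?thesis unfolding C(2) using \<open>Q \<in> C\<close> by blast
qed

lemma cube_antimono: "j \<le> k \<Longrightarrow> cube k x \<subseteq> cube j x"
proof (induction k rule: int_ge_induct)
  case (step k)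
  show ?case by (rule order_trans[OF cube_Suc_subset step.IH])
qed simp

lemma cube_coarser: "cube k y = cube k x \<Longrightarrow> j \<le> k \<Longrightarrow> cube j y = cube j x"
  using cube_antimono[of j k x] mem_cube[of y k] mem_cube_iff[of y j x] by blast

lemma D_borel [measurable]: "Q \<in> D k \<Longrightarrow> Q \<in> sets borel"
  using D_dyadic[of Q k] dyadic_cube_borel by auto

lemma cubes_borel [measurable]: "Q \<in> cubes D \<Longrightarrow> Q \<in> sets borel"
  by (auto simp: cubes_def)

lemma cube_borel [measurable]: "cube k x \<in> sets borel"
  using D_borel[OF cube_in] .

lemma D_bounded: "Q \<in> D k \<Longrightarrow> bounded Q"
  using D_dyadic[of Q k] bounded_subset[OF bounded_cbox dyadic_cube_sandwich(2)] by blast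

lemma vol_D: "Q \<in> D k \<Longrightarrow> vol Q = (2 powi (- k)) ^ CARD('n)"
  using D_dyadic[of Q k] vol_dyadic_cube by auto

lemma vol_cube: "vol (cube k x) = (2 powi (- k)) ^ CARD('n)"
  by (rule vol_D) simp

lemma vol_cube_pos: "0 < vol (cube k x)"
  by (simp add: vol_cube)

lemma vol_cube_Suc: "vol (cube k x) = 2 ^ CARD('n) * vol (cube (k + 1) x)"
  by (simp add: vol_cube power_mult_distrib[symmetric] power_int_diff power_int_minus power_int_add)

lemma D_inj: "Q \<in> D k \<Longrightarrow> Q \<in> D j \<Longrightarrow> k = j"
proof -
  assume "Q \<in> D k" "Q \<in> D j"
  then have "(2 powi (- k) :: real) ^ CARD('n) = (2 powi (- j)) ^ CARD('n)"
    by (rule trans[OF vol_D[symmetric] vol_D])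
  then have "(2 powi (- k) :: real) = 2 powi (- j)"
    by (rule power_eq_imp_eq_base) auto
  then show "k = j"
    using power_int_strict_increasing[of "- k" "- j" "2::real"]
      power_int_strict_increasing[of "- j" "- k" "2::real"] by linarith
qed

lemma cube_gen_inj: "cube k x = cube j y \<Longrightarrow> k = j"
  using D_inj[OF cube_in, of k x j] by simp

lemma mem_D_iff: "Q \<in> D k \<Longrightarrow> x \<in> Q \<longleftrightarrow> cube k x = Q"
proof
  assume "cube k x = Q"
  then show "x \<in> Q" using mem_cube[of x k] by (simp only:)
qed (rule cube_eq)

lemma countable_D: "countable (D k)"
proof (rule countable_disjoint_nonempty_interior_subsets)
  show "pairwise disjnt (D k)"
  proof (rule pairwiseI)
    fix Q R assume "Q \<in> D k" "R \<in> D k" "Q \<noteq> R"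
    then show "disjnt Q R" using D_disjoint[of Q k R] unfolding disjnt_iff by blast
  qed
  fix Q assume "Q \<in> D k" "interior Q = {}"
  then obtain x where x: "Q = dyadic_cube k x" using D_dyadic by blast
  let ?u = "(\<chi> i. x $ i + 2 powi (- k)) :: real ^ 'n"
  have "box x ?u \<subseteq> interior Q"
    unfolding x by (rule interior_maximal[OF dyadic_cube_sandwich(1) open_box])
  moreover have "box x ?u \<noteq> {}"
    by (simp add: interval_ne_empty_cart)
  ultimately show "Q = {}" using \<open>interior Q = {}\<close> by blast
qed

lemma countable_cubes: "countable (cubes D)"
  unfolding cubes_def using countable_D by auto

lemma cube_measurable: "cube k \<in> measurable borel (count_space (D k))"
proof (subst measurable_count_space_eq_countable[OF countable_D], intro conjI ballI)
  fix Q assume "Q \<in> D k"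
  then have "cube k -` {Q} \<inter> space borel = Q"
    by (intro set_eqI) (simp add: mem_D_iff)
  then show "cube k -` {Q} \<inter> space borel \<in> sets borel" using \<open>Q \<in> D k\<close> by (simp add: D_borel)
qed auto

text \<open>Measurability with respect to the cubes of generation \<open>k\<close>, which are the atoms.\<close>

definition adapted :: "int \<Rightarrow> (real ^ 'n \<Rightarrow> 'b) \<Rightarrow> bool" where
  "adapted k h \<longleftrightarrow> (\<forall>x y. cube k y = cube k x \<longrightarrow> h y = h x)"

lemma adaptedD: "adapted k h \<Longrightarrow> cube k y = cube k x \<Longrightarrow> h y = h x"
  unfolding adapted_def by blast

lemma adapted_mono: "adapted j h \<Longrightarrow> j \<le> k \<Longrightarrow> adapted k h"
  using cube_coarser unfolding adapted_def by blast

lemma adapted_cube [simp]: "adapted k (\<lambda>x. g (cube k x))"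
  unfolding adapted_def by simp

lemma adapted_measurable:
  fixes h :: "real ^ 'n \<Rightarrow> real"
  assumes "adapted k h"
  shows "h \<in> borel_measurable borel"
proof -
  define g where "g Q = h (SOME x. x \<in> Q)" for Q
  have "h x = g (cube k x)" for x
  proof -
    have "(SOME y. y \<in> cube k x) \<in> cube k x" by (rule someI) (rule mem_cube)
    then show ?thesis
      unfolding g_def mem_cube_iff by (rule adaptedD[OF assms, symmetric])
  qed
  then have "h = (\<lambda>x. g (cube k x))" by auto
  also have "\<dots> \<in> borel_measurable borel"
    by (rule measurable_compose[OF cube_measurable]) simp
  finally show ?thesis .
qed

lemma children_cube: "children D (cube k x) = {Q \<in> D (k + 1). Q \<subseteq> cube k x}"
  using D_inj[OF cube_in, of k x] cube_in[of k x] unfolding children_def by blast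

lemma children_cube_lattice:
  shows "finite (children D (cube k x))" "card (children D (cube k x)) = 2 ^ CARD('n)"
    "cube k x = \<Union>(children D (cube k x))"
proof -
  obtain C where C: "C \<subseteq> D (k + 1)" "card C = 2 ^ CARD('n)" "cube k x = \<Union>C"
    using D_children[OF cube_in, of k x] by auto
  have "children D (cube k x) = C"
  proof
    show "children D (cube k x) \<subseteq> C"
    proof
      fix Q assume "Q \<in> children D (cube k x)"
      then have "Q \<in> D (k + 1)" "Q \<subseteq> cube k x" by (simp_all add: children_cube)
      then have Q: "Q \<in> D (k + 1)" "Q \<subseteq> \<Union>C" using C(3) by simp_all
      then obtain y where "y \<in> Q" using D_nonempty by blast
      then obtain R where "R \<in> C" "y \<in> R" using Q by blast
      then have "Q = R" using D_disjoint[of Q "k + 1" R y] Q C(1) \<open>y \<in> Q\<close> by blast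
      then show "Q \<in> C" using \<open>R \<in> C\<close> by simp
    qed
    show "C \<subseteq> children D (cube k x)"
      unfolding children_cube unfolding C(3) using C(1) by blast
  qed
  moreover have "finite C" using C(2) by (intro card_ge_0_finite) simp
  ultimately show "finite (children D (cube k x))" "card (children D (cube k x)) = 2 ^ CARD('n)"
    "cube k x = \<Union>(children D (cube k x))"
    using C by simp_all
qed

lemma child_cube_mem: "cube (k + 1) x \<in> children D (cube k x)"
  using cube_Suc_subset by (auto simp: children_cube)

lemma child_mem_iff: "Q \<in> children D (cube k x) \<Longrightarrow> x \<in> Q \<longleftrightarrow> Q = cube (k + 1) x"
  using mem_D_iff[of Q "k + 1" x] by (auto simp: children_cube)

text \<open>
  Sums over all cubes of terms supported in the cube are, at a fixed point, sums over generations.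
\<close>

lemma infsum_cubes_containing:
  fixes F :: "(real ^ 'n) set \<Rightarrow> ennreal"
  assumes "\<And>Q. Q \<in> cubes D \<Longrightarrow> x \<notin> Q \<Longrightarrow> F Q = 0"
  shows "infsum F (cubes D) = (\<Sum>\<^sub>\<infinity>k. F (cube k x))"
proof -
  have "infsum F (cubes D) = infsum F (range (\<lambda>k. cube k x))"
  proof (rule infsum_cong_neutral)
    fix Q assume "Q \<in> cubes D - range (\<lambda>k. cube k x)"
    then obtain k where "Q \<in> D k" "Q \<noteq> cube k x" by (auto simp: cubes_def)
    then have "x \<notin> Q" using mem_D_iff[of Q k x] by simp
    then show "F Q = 0" using assms[of Q] \<open>Q \<in> cubes D - _\<close> by simp
  qed auto
  also have "\<dots> = (\<Sum>\<^sub>\<infinity>k. F (cube k x))"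
    by (subst infsum_reindex) (auto simp: o_def inj_on_def dest: cube_gen_inj)
  finally show ?thesis .
qed

lemma Delta_outside: "Q \<in> cubes D \<Longrightarrow> x \<notin> Q \<Longrightarrow> Delta D \<sigma> f Q x = 0"
  unfolding Delta_def by (auto simp: children_def indicator_def intro!: sum.neutral)

text \<open>
  At the point \<open>x\<close> only one child of the cube contributes.
\<close>

lemma Delta_cube:
  "Delta D \<sigma> f (cube k x) x =
     (LINT y:cube (k + 1) x|\<sigma>. f y) / vol (cube (k + 1) x) - (LINT y:cube k x|\<sigma>. f y) / vol (cube k x)"
proof -
  have fin: "finite (children D (cube k x))" by (rule children_cube_lattice)
  have "(\<Sum>Q\<in>children D (cube k x). (LINT y:Q|\<sigma>. f y) / vol Q * indicator Q x)
      = (\<Sum>Q\<in>children D (cube k x). if Q = cube (k + 1) x then (LINT y:Q|\<sigma>. f y) / vol Q else 0)"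
    by (intro sum.cong refl) (simp add: child_mem_iff indicator_def)
  also have "\<dots> = (LINT y:cube (k + 1) x|\<sigma>. f y) / vol (cube (k + 1) x)"
    using fin child_cube_mem by simp
  finally show ?thesis by (simp add: Delta_def)
qed

end

section \<open>Dyadic averages\<close>

locale dyadic_measure = dyadic_grid D
  for D :: "int \<Rightarrow> (real ^ 'n::finite) set set" +
  fixes \<sigma> :: "(real ^ 'n) measure"
  assumes sets_eq [measurable_cong]: "sets \<sigma> = sets borel"
    and finite_cube: "emeasure \<sigma> (cube k x) < \<infinity>"
begin

lemma borel_measurable_iff: "f \<in> borel_measurable \<sigma> \<longleftrightarrow> f \<in> borel_measurable borel"
  by (simp add: measurable_cong_sets[OF sets_eq refl])

lemma cube_sets [measurable]: "cube k x \<in> sets \<sigma>"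
  using cube_borel by (simp add: sets_eq)

text \<open>
  The average over the cube of generation \<open>k\<close> containing \<open>x\<close>, the conditional expectation with respect
  to \<open>\<sigma>\<close>. On a cube of measure zero it is \<open>0\<close>; the integral over that cube vanishes as well.
\<close>

definition cond :: "int \<Rightarrow> (real ^ 'n \<Rightarrow> real) \<Rightarrow> real ^ 'n \<Rightarrow> real" where
  "cond k f x = (LINT y:cube k x|\<sigma>. f y) / measure \<sigma> (cube k x)"

definition loc_int :: "int \<Rightarrow> (real ^ 'n \<Rightarrow> real) \<Rightarrow> bool" where
  "loc_int k f \<longleftrightarrow> (\<forall>x. set_integrable \<sigma> (cube k x) f)"

lemma loc_intD: "loc_int k f \<Longrightarrow> set_integrable \<sigma> (cube k x) f"
  unfolding loc_int_def by blast

lemma emeasure_cube: "emeasure \<sigma> (cube k x) = ennreal (measure \<sigma> (cube k x))"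
  using finite_cube[of k x] by (intro emeasure_eq_ennreal_measure) auto

lemma adapted_cond: "adapted k (cond k f)"
  unfolding adapted_def cond_def by simp

lemma nn_set_integral:
  assumes "set_integrable M A h" "\<And>x. 0 \<le> h x"
  shows "(\<integral>\<^sup>+ x. ennreal (h x) * indicator A x \<partial>M) = ennreal (LINT x:A|M. h x)"
proof -
  have "(\<integral>\<^sup>+ x. ennreal (h x) * indicator A x \<partial>M) = (\<integral>\<^sup>+ x. ennreal (indicator A x *\<^sub>R h x) \<partial>M)"
    by (intro nn_integral_cong) (simp add: indicator_def)
  also have "\<dots> = ennreal (LINT x:A|M. h x)"
    using assms unfolding set_integrable_def set_lebesgue_integral_def
    by (intro nn_integral_eq_integral) auto
  finally show ?thesis .
qed

lemma measure_mult_cond: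
  assumes "loc_int k f"
  shows "measure \<sigma> (cube k x) * cond k f x = (LINT y:cube k x|\<sigma>. f y)"
proof (cases "measure \<sigma> (cube k x) = 0")
  case True
  then have "cube k x \<in> null_sets \<sigma>"
    using emeasure_cube[of k x] by (auto simp: null_sets_def)
  then have "AE y in \<sigma>. y \<notin> cube k x" by (rule AE_not_in)
  then have "AE y in \<sigma>. indicator (cube k x) y *\<^sub>R f y = 0"
    by eventually_elim simp
  then have "(LINT y:cube k x|\<sigma>. f y) = 0"
    unfolding set_lebesgue_integral_def by (rule integral_eq_zero_AE)
  then show ?thesis using True by simp
qed (simp add: cond_def)

lemma set_integral_indicator_Int:
  assumes "A \<in> sets \<sigma>" "B \<in> sets \<sigma>" "emeasure \<sigma> A < \<infinity>"
  shows "(LINT y:A|\<sigma>. a * indicator B y) = a * measure \<sigma> (A \<inter> B)"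
proof -
  have "emeasure \<sigma> (A \<inter> B) \<le> emeasure \<sigma> A"
    using assms(1) by (intro emeasure_mono) auto
  then have "emeasure \<sigma> (A \<inter> B) < \<infinity>"
    using assms(3) by (rule order.strict_trans1)
  have "indicator A y *\<^sub>R (a * indicator B y) = a * indicator (A \<inter> B) y" for y :: "real ^ 'n"
    by (simp add: indicator_def)
  then have "(LINT y:A|\<sigma>. a * indicator B y) = (LINT y|\<sigma>. a * indicator (A \<inter> B) y)"
    unfolding set_lebesgue_integral_def by (simp only:)
  also have "\<dots> = a * measure \<sigma> (A \<inter> B)"
    using assms \<open>emeasure \<sigma> (A \<inter> B) < \<infinity>\<close> by (simp add: less_top)
  finally show ?thesis .
qed

lemma cond_nonneg: "(\<And>y. 0 \<le> f y) \<Longrightarrow> 0 \<le> cond k f x"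
  unfolding cond_def set_lebesgue_integral_def
  by (intro divide_nonneg_nonneg Bochner_Integration.integral_nonneg) auto

lemma cond_mono:
  assumes "loc_int k f" "loc_int k g" "\<And>y. y \<in> cube k x \<Longrightarrow> f y \<le> g y"
  shows "cond k f x \<le> cond k g x"
  unfolding cond_def
  by (intro divide_right_mono set_integral_mono) (use assms loc_intD in auto)

lemma cond_cong:
  assumes "\<And>y. y \<in> cube k x \<Longrightarrow> f y = g y"
  shows "cond k f x = cond k g x"
proof -
  have "(LINT y:cube k x|\<sigma>. f y) = (LINT y:cube k x|\<sigma>. g y)"
    unfolding set_lebesgue_integral_def
    by (intro Bochner_Integration.integral_cong) (use assms in \<open>auto simp: indicator_def\<close>)
  then show ?thesis by (simp add: cond_def)
qed

lemma cond_add: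
  assumes "loc_int k f" "loc_int k g"
  shows "cond k (\<lambda>y. f y + g y) x = cond k f x + cond k g x"
  using set_integral_add(2)[OF loc_intD[OF assms(1)] loc_intD[OF assms(2)], of x]
  by (simp add: cond_def add_divide_distrib)

lemma cond_cmult: "cond k (\<lambda>y. c * f y) x = c * cond k f x"
  by (simp add: cond_def)

lemma cond_const:
  assumes "measure \<sigma> (cube k x) \<noteq> 0"
  shows "cond k (\<lambda>y. c) x = c"
  using assms finite_cube[of k x] by (simp add: cond_def set_lebesgue_integral_def less_top)

lemma loc_int_add: "loc_int k f \<Longrightarrow> loc_int k g \<Longrightarrow> loc_int k (\<lambda>y. f y + g y)"
  by (simp add: loc_int_def)

lemma loc_int_cmult: "loc_int k f \<Longrightarrow> loc_int k (\<lambda>y. c * f y)"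
  by (simp add: loc_int_def)

lemma loc_int_bounded:
  fixes h :: "real ^ 'n \<Rightarrow> real"
  assumes [measurable]: "h \<in> borel_measurable borel" and "\<And>x. \<exists>B. \<forall>y\<in>cube k x. \<bar>h y\<bar> \<le> B"
  shows "loc_int k h"
  unfolding loc_int_def set_integrable_def
proof
  fix x
  from assms(2)[of x] obtain B where B: "\<forall>y\<in>cube k x. \<bar>h y\<bar> \<le> B" ..
  show "integrable \<sigma> (\<lambda>y. indicator (cube k x) y *\<^sub>R h y)"
  proof (rule integrableI_bounded_set_indicator)
    show "emeasure \<sigma> (cube k x) < \<infinity>" by (rule finite_cube)
    show "h \<in> borel_measurable \<sigma>" by measurable
    show "AE y in \<sigma>. y \<in> cube k x \<longrightarrow> norm (h y) \<le> B" using B by auto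
  qed simp
qed

lemma loc_int_const: "loc_int k (\<lambda>y. c)"
  by (rule loc_int_bounded) auto

lemma adapted_Suc_loc_int:
  fixes h :: "real ^ 'n \<Rightarrow> real"
  assumes "adapted (k + 1) h"
  shows "loc_int k h"
proof (rule loc_int_bounded)
  show "h \<in> borel_measurable borel" using assms by (rule adapted_measurable)
  fix x
  let ?r = "\<lambda>Q. h (SOME y. y \<in> Q)"
  have "h y \<in> ?r ` children D (cube k x)" if "y \<in> cube k x" for y
  proof
    have "cube k y = cube k x" using that mem_cube_iff by blast
    then show "cube (k + 1) y \<in> children D (cube k x)" using child_cube_mem[of k y] by simp
    have "(SOME z. z \<in> cube (k + 1) y) \<in> cube (k + 1) y" by (rule someI) (rule mem_cube)
    then show "h y = ?r (cube (k + 1) y)"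
      unfolding mem_cube_iff by (rule adaptedD[OF assms, symmetric])
  qed
  note image = this
  have "\<bar>h y\<bar> \<le> (\<Sum>Q\<in>children D (cube k x). \<bar>?r Q\<bar>)" if y: "y \<in> cube k x" for y
  proof -
    from image[OF y] obtain Q where Q: "h y = ?r Q" "Q \<in> children D (cube k x)" by (rule imageE)
    have "\<bar>?r Q\<bar> \<le> (\<Sum>Q\<in>children D (cube k x). \<bar>?r Q\<bar>)"
      using children_cube_lattice(1)[of k x] Q(2) by (intro member_le_sum) auto
    then show ?thesis by (simp only: Q(1))
  qed
  then have "\<forall>y\<in>cube k x. \<bar>h y\<bar> \<le> (\<Sum>Q\<in>children D (cube k x). \<bar>?r Q\<bar>)" by blast
  then show "\<exists>B. \<forall>y\<in>cube k x. \<bar>h y\<bar> \<le> B" ..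
qed

text \<open>
  The cubes of one generation are a countable partition, so integrals may be compared cube by cube.
\<close>

lemma nn_integral_mono_on_cubes:
  assumes [measurable]: "F \<in> borel_measurable borel" "G \<in> borel_measurable borel"
    and le: "\<And>x. (\<integral>\<^sup>+ y. F y * indicator (cube k x) y \<partial>\<sigma>) \<le> (\<integral>\<^sup>+ y. G y * indicator (cube k x) y \<partial>\<sigma>)"
  shows "(\<integral>\<^sup>+ y. F y \<partial>\<sigma>) \<le> (\<integral>\<^sup>+ y. G y \<partial>\<sigma>)"
proof -
  obtain E :: "nat \<Rightarrow> (real ^ 'n) set set" where E: "incseq E" "\<And>n. finite (E n)" "(\<Union>n. E n) = D k"
    using countable_exhaustion[OF countable_D[of k]] by blast
  have ED: "Q \<in> D k" if "Q \<in> E n" for Q n using that E(3) by blast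
  have [measurable]: "Q \<in> sets borel" if "Q \<in> E n" for Q n using D_borel[OF ED[OF that]] .
  have expand: "(\<integral>\<^sup>+ y. H y \<partial>\<sigma>) = (SUP n. \<Sum>Q\<in>E n. \<integral>\<^sup>+ y. H y * indicator Q y \<partial>\<sigma>)"
    if [measurable]: "H \<in> borel_measurable borel" for H :: "real ^ 'n \<Rightarrow> ennreal"
  proof -
    have "H y = (\<Sum>\<^sub>\<infinity>Q\<in>D k. H y * indicator Q y)" for y
    proof -
      have "(\<Sum>\<^sub>\<infinity>Q\<in>D k. H y * indicator Q y) = (\<Sum>\<^sub>\<infinity>Q\<in>{cube k y}. H y * indicator Q y)"
        by (rule infsum_cong_neutral) (auto simp: mem_D_iff indicator_def)
      then show ?thesis by simp
    qed
    then have "(\<integral>\<^sup>+ y. H y \<partial>\<sigma>) = (\<integral>\<^sup>+ y. (SUP n. \<Sum>Q\<in>E n. H y * indicator Q y) \<partial>\<sigma>)"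
      using infsum_ennreal_SUP_incseq[OF E] by simp
    also have "\<dots> = (SUP n. \<integral>\<^sup>+ y. (\<Sum>Q\<in>E n. H y * indicator Q y) \<partial>\<sigma>)"
    proof (rule nn_integral_monotone_convergence_SUP)
      show "incseq (\<lambda>n y. \<Sum>Q\<in>E n. H y * indicator Q y)"
        unfolding incseq_def le_fun_def
        by (intro allI impI sum_mono2 E(2) incseqD[OF E(1)]) (assumption, rule zero_le)
    qed simp
    also have "\<dots> = (SUP n. \<Sum>Q\<in>E n. \<integral>\<^sup>+ y. H y * indicator Q y \<partial>\<sigma>)"
      by (simp add: nn_integral_sum)
    finally show ?thesis .
  qed
  have "(\<Sum>Q\<in>E n. \<integral>\<^sup>+ y. F y * indicator Q y \<partial>\<sigma>) \<le> (\<Sum>Q\<in>E n. \<integral>\<^sup>+ y. G y * indicator Q y \<partial>\<sigma>)" for n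
  proof (rule sum_mono)
    fix Q assume "Q \<in> E n"
    then obtain x where "Q = cube k x" using D_eq_cube[OF ED] by blast
    then show "(\<integral>\<^sup>+ y. F y * indicator Q y \<partial>\<sigma>) \<le> (\<integral>\<^sup>+ y. G y * indicator Q y \<partial>\<sigma>)"
      using le[of x] by simp
  qed
  then show ?thesis
    unfolding expand[OF assms(1)] expand[OF assms(2)] by (intro SUP_mono) auto
qed

text \<open>
  The defining property of conditional expectation. Both integrals agree on each cube of generation \<open>k\<close>, where
  \<open>h\<close> and the average are constant.
\<close>

lemma nn_integral_mult_cond:
  assumes f: "loc_int k f" "\<And>x. 0 \<le> f x" and [measurable]: "f \<in> borel_measurable borel"
    and h: "adapted k h" "\<And>x. 0 \<le> h x"
  shows "(\<integral>\<^sup>+ x. ennreal (h x * cond k f x) \<partial>\<sigma>) = (\<integral>\<^sup>+ x. ennreal (h x * f x) \<partial>\<sigma>)"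
proof -
  have [measurable]: "h \<in> borel_measurable borel" "cond k f \<in> borel_measurable borel"
    using h(1) adapted_cond by (auto intro: adapted_measurable)
  have on_cube: "(\<integral>\<^sup>+ y. ennreal (h y * cond k f y) * indicator (cube k x) y \<partial>\<sigma>)
      = (\<integral>\<^sup>+ y. ennreal (h y * f y) * indicator (cube k x) y \<partial>\<sigma>)" for x
  proof -
    have const: "h y = h x" "cond k f y = cond k f x" if "y \<in> cube k x" for y
      using adaptedD[OF h(1) that[unfolded mem_cube_iff]]
        adaptedD[OF adapted_cond that[unfolded mem_cube_iff]] by auto
    have "(\<integral>\<^sup>+ y. ennreal (h y * cond k f y) * indicator (cube k x) y \<partial>\<sigma>)
        = (\<integral>\<^sup>+ y. ennreal (h x * cond k f x) * indicator (cube k x) y \<partial>\<sigma>)"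
    proof (intro nn_integral_cong)
      fix y
      show "ennreal (h y * cond k f y) * indicator (cube k x) y
          = ennreal (h x * cond k f x) * indicator (cube k x) y"
      proof (cases "y \<in> cube k x")
        case True
        show ?thesis unfolding const[OF True] ..
      qed simp
    qed
    also have "\<dots> = ennreal (h x * cond k f x) * ennreal (measure \<sigma> (cube k x))"
      by (simp add: emeasure_cube nn_integral_cmult_indicator)
    also have "\<dots> = ennreal (h x) * ennreal (LINT y:cube k x|\<sigma>. f y)"
      unfolding measure_mult_cond[OF f(1), symmetric]
      using h(2) cond_nonneg[OF f(2)] by (simp add: ennreal_mult[symmetric] mult_ac)
    also have "\<dots> = ennreal (h x) * (\<integral>\<^sup>+ y. ennreal (f y) * indicator (cube k x) y \<partial>\<sigma>)"
      using nn_set_integral[OF loc_intD[OF f(1)] f(2)] by simp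
    also have "\<dots> = (\<integral>\<^sup>+ y. ennreal (h x) * (ennreal (f y) * indicator (cube k x) y) \<partial>\<sigma>)"
      by (rule nn_integral_cmult[symmetric]) measurable
    also have "\<dots> = (\<integral>\<^sup>+ y. ennreal (h y * f y) * indicator (cube k x) y \<partial>\<sigma>)"
    proof (intro nn_integral_cong)
      fix y
      show "ennreal (h x) * (ennreal (f y) * indicator (cube k x) y)
          = ennreal (h y * f y) * indicator (cube k x) y"
      proof (cases "y \<in> cube k x")
        case True
        show ?thesis
          unfolding const(1)[OF True] using h(2) f(2) by (simp add: ennreal_mult mult.assoc)
      qed simp
    qed
    finally show ?thesis .
  qed
  show ?thesis
    by (rule antisym; rule nn_integral_mono_on_cubes[where k = k]) (simp_all add: on_cube)
qed

lemma cond_tower: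
  assumes f: "loc_int k f" "loc_int (k + 1) f" "\<And>x. 0 \<le> f x" "f \<in> borel_measurable borel"
  shows "cond k (cond (k + 1) f) x = cond k f x"
proof -
  have 1: "loc_int k (cond (k + 1) f)"
    by (rule adapted_Suc_loc_int[OF adapted_cond])
  have ind: "adapted (k + 1) (indicator (cube k x) :: _ \<Rightarrow> real)"
    unfolding adapted_def
  proof (intro allI impI)
    fix y z assume "cube (k + 1) z = cube (k + 1) y"
    then have "cube k z = cube k y" by (rule cube_coarser) simp
    then have "z \<in> cube k x \<longleftrightarrow> y \<in> cube k x" unfolding mem_cube_iff by simp
    then show "(indicator (cube k x) z :: real) = indicator (cube k x) y" by (simp add: indicator_def)
  qed
  have conv: "ennreal (indicator A y * c) = ennreal c * indicator A y" for A :: "(real ^ 'n) set" and y c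
    by (simp add: indicator_def)
  have "ennreal (LINT y:cube k x|\<sigma>. cond (k + 1) f y) = ennreal (LINT y:cube k x|\<sigma>. f y)"
    using nn_integral_mult_cond[OF f(2,3,4) ind]
    unfolding conv nn_set_integral[OF loc_intD[OF 1] cond_nonneg[OF f(3)]]
      nn_set_integral[OF loc_intD[OF f(1)] f(3)] by simp
  moreover have "0 \<le> (LINT y:cube k x|\<sigma>. cond (k + 1) f y)" "0 \<le> (LINT y:cube k x|\<sigma>. f y)"
    unfolding measure_mult_cond[OF 1, symmetric] measure_mult_cond[OF f(1), symmetric]
    using cond_nonneg[OF cond_nonneg[OF f(3)]] cond_nonneg[OF f(3)] by simp_all
  ultimately show ?thesis by (simp add: cond_def)
qed

end

section \<open>Martingale inequalities for dyadic averages\<close>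

definition doob_const :: "real \<Rightarrow> real" where
  "doob_const p = 2 * (2 * (p / (p - 1))) powr p"

definition square_const :: "real \<Rightarrow> real" where
  "square_const p = (if p \<le> 2 then (6 / (p * (p - 1))) powr (p / 2) * (doob_const p + 1)
                     else 2 * (3 * p) powr (p / 2))"

context dyadic_measure
begin

lemma loc_int_powr:
  assumes [measurable]: "f \<in> borel_measurable borel"
    and "\<And>x. 0 \<le> f x" "moment \<sigma> p f < \<infinity>"
  shows "loc_int k (\<lambda>x. f x powr p)"
proof -
  have "integrable \<sigma> (\<lambda>x. f x powr p)"
    using assms by (intro integrableI_nonneg) auto
  then show ?thesis
    unfolding loc_int_def set_integrable_def by (intro allI integrable_mult_indicator) auto
qed

lemma loc_int_of_Lp:
  assumes [measurable]: "f \<in> borel_measurable borel"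
    and "\<And>x. 0 \<le> f x" "1 \<le> p" "moment \<sigma> p f < \<infinity>"
  shows "loc_int k f"
  unfolding loc_int_def set_integrable_def
proof
  fix x
  have le: "f y \<le> 1 + f y powr p" for y
  proof (cases "f y \<le> 1")
    case False
    then have "f y powr 1 \<le> f y powr p" using assms by (intro powr_mono) auto
    then show ?thesis using False by simp
  qed (simp add: add_increasing2)
  have "integrable \<sigma> (\<lambda>y. indicator (cube k x) y *\<^sub>R (1 + f y powr p))"
    using loc_intD[OF loc_int_add[OF loc_int_const loc_int_powr[OF assms(1,2,4)]]]
    unfolding set_integrable_def .
  then show "integrable \<sigma> (\<lambda>y. indicator (cube k x) y *\<^sub>R f y)"
  proof (rule Bochner_Integration.integrable_bound)
    show "AE y in \<sigma>. norm (indicator (cube k x) y *\<^sub>R f y) \<le> norm (indicator (cube k x) y *\<^sub>R (1 + f y powr p))"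
      using le assms(2) by (intro AE_I2) (simp add: indicator_def)
  qed measurable
qed

text \<open>
  Jensen's inequality: average the tangent of the power at the mean value.
\<close>

lemma cond_powr_le:
  assumes "loc_int k f" "loc_int k (\<lambda>y. f y powr p)" "\<And>y. 0 \<le> f y" "1 \<le> p"
  shows "cond k f x powr p \<le> cond k (\<lambda>y. f y powr p) x"
proof (cases "measure \<sigma> (cube k x) = 0")
  case False
  define y where "y = cond k f x"
  have "0 \<le> y" unfolding y_def by (rule cond_nonneg) (rule assms)
  have "cond k (\<lambda>z. p * y powr (p - 1) * f z + (y powr p - p * y powr (p - 1) * y)) x
      \<le> cond k (\<lambda>z. f z powr p) x"
  proof (rule cond_mono)
    fix z
    show "p * y powr (p - 1) * f z + (y powr p - p * y powr (p - 1) * y) \<le> f z powr p"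
      using powr_tangent[OF assms(4) assms(3)[of z] \<open>0 \<le> y\<close>] by (simp add: algebra_simps)
  qed (intro loc_int_add loc_int_cmult loc_int_const assms)+
  also have "cond k (\<lambda>z. p * y powr (p - 1) * f z + (y powr p - p * y powr (p - 1) * y)) x
      = p * y powr (p - 1) * y + (y powr p - p * y powr (p - 1) * y)"
    using False
    by (simp add: cond_add loc_int_cmult loc_int_const assms cond_cmult cond_const y_def)
  finally show ?thesis by (simp add: y_def)
qed (simp add: cond_def)

lemma nn_integral_cond:
  assumes "loc_int k f" "\<And>x. 0 \<le> f x" "f \<in> borel_measurable borel"
  shows "(\<integral>\<^sup>+ x. ennreal (cond k f x) \<partial>\<sigma>) = (\<integral>\<^sup>+ x. ennreal (f x) \<partial>\<sigma>)"
  using nn_integral_mult_cond[OF assms, of "\<lambda>_. 1"] by (simp add: adapted_def)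

lemma cond_Lp_contraction:
  assumes f: "f \<in> borel_measurable borel" "\<And>x. 0 \<le> f x" "1 \<le> p"
    "moment \<sigma> p f < \<infinity>"
  shows "moment \<sigma> p (cond k f) \<le> moment \<sigma> p f"
proof -
  note li = loc_int_of_Lp[OF f] and lip = loc_int_powr[OF f(1,2,4)]
  have "moment \<sigma> p (cond k f) \<le> (\<integral>\<^sup>+ x. ennreal (cond k (\<lambda>y. f y powr p) x) \<partial>\<sigma>)"
    by (intro nn_integral_mono ennreal_leI cond_powr_le li lip f)
  also have "\<dots> = moment \<sigma> p f"
    using f(1) by (intro nn_integral_cond lip) auto
  finally show ?thesis .
qed

text \<open>
  The mean oscillation between two generations. It is constant on cubes of generation \<open>k\<close> and so may serve
  as a coefficient; the increment itself is only constant on their children.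
\<close>

definition dev :: "int \<Rightarrow> (real ^ 'n \<Rightarrow> real) \<Rightarrow> real ^ 'n \<Rightarrow> real" where
  "dev k f x = cond k (\<lambda>z. \<bar>cond (k + 1) f z - cond k f z\<bar>) x"

lemma adapted_dev: "adapted k (dev k f)"
  unfolding dev_def[abs_def] by (rule adapted_cond)

lemma dev_nonneg: "0 \<le> dev k f x"
  unfolding dev_def by (rule cond_nonneg) simp

lemma cond_on_cube: "z \<in> cube k x \<Longrightarrow> cond k f z = cond k f x"
  unfolding mem_cube_iff by (rule adaptedD[OF adapted_cond])

lemma dev_eq: "dev k f x = cond k (\<lambda>z. \<bar>cond (k + 1) f z - cond k f x\<bar>) x"
  unfolding dev_def by (rule cond_cong) (simp only: cond_on_cube)

lemma loc_int_cond_Suc: "loc_int k (cond (k + 1) f)"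
  by (rule adapted_Suc_loc_int[OF adapted_cond])

lemma adapted_comp: "adapted k h \<Longrightarrow> adapted k (\<lambda>x. F (h x))"
  unfolding adapted_def by (intro allI impI arg_cong[where f = F]) blast

lemma loc_int_cond_Suc_comp: "loc_int k (\<lambda>x. F (cond (k + 1) f x))" for F :: "real \<Rightarrow> real"
  by (rule adapted_Suc_loc_int[OF adapted_comp[OF adapted_cond]])

text \<open>
  The square of the mean oscillation is controlled by the gap in Jensen's inequality for the power \<open>p\<close>, which
  telescopes under the integral. The weight is a power of the average on the coarser cube.
\<close>

lemma dev_square_le:
  assumes f: "loc_int k f" "loc_int (k + 1) f" "\<And>x. 0 \<le> f x" "f \<in> borel_measurable borel"
    and p: "1 < p" "p \<le> 2"
  shows "(dev k f x)\<^sup>2 \<le> 6 / (p * (p - 1)) * cond k f x powr (2 - p)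
           * (cond k (\<lambda>z. cond (k + 1) f z powr p) x - cond k f x powr p)"
    and "cond k f x powr p \<le> cond k (\<lambda>z. cond (k + 1) f z powr p) x"
proof -
  define y where "y = cond k f x"
  define g where "g = cond (k + 1) f"
  define V where "V = cond k (\<lambda>z. g z powr p) x - y powr p"
  have g0: "0 \<le> g z" for z unfolding g_def by (rule cond_nonneg) (rule f)
  have lg: "loc_int k g" unfolding g_def by (rule loc_int_cond_Suc)
  have lgp: "loc_int k (\<lambda>z. g z powr p)" unfolding g_def by (rule loc_int_cond_Suc_comp)
  have mean: "cond k g x = y" unfolding g_def y_def by (rule cond_tower[OF f])
  have "0 \<le> y" unfolding y_def by (rule cond_nonneg) (rule f)
  have "cond k g x powr p \<le> cond k (\<lambda>z. g z powr p) x"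
    using p by (intro cond_powr_le lg lgp g0) auto
  then have "0 \<le> V" by (simp add: V_def mean)
  then show "cond k f x powr p \<le> cond k (\<lambda>z. cond (k + 1) f z powr p) x"
    by (simp add: V_def y_def g_def)
  have dev: "dev k f x = cond k (\<lambda>z. \<bar>g z - y\<bar>) x" unfolding dev_eq g_def y_def ..
  have "(dev k f x)\<^sup>2 \<le> 6 / (p * (p - 1)) * y powr (2 - p) * V"
  proof (cases "y = 0 \<or> measure \<sigma> (cube k x) = 0")
    case True
    have "dev k f x = 0"
    proof (cases "measure \<sigma> (cube k x) = 0")
      case False
      then have "y = 0" using True by simp
      then show ?thesis using g0 mean by (simp add: dev)
    qed (simp add: dev cond_def)
    then show ?thesis using \<open>0 \<le> V\<close> p by simp
  next
    case False
    then have "0 < y" and m: "measure \<sigma> (cube k x) \<noteq> 0" using \<open>0 \<le> y\<close> by auto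
    define c where "c = y powr (2 - p) / (2 * p * (p - 1))"
    have "0 \<le> c" using p by (simp add: c_def)
    have "(dev k f x)\<^sup>2 \<le> 4 * (3 * c) * V"
    proof (rule balanced_bound_imp_square_le)
      fix t :: real assume "0 < t"
      \<comment> \<open>The bound of \<open>deviation_pointwise\<close> is a power of \<open>g\<close> plus an affine function of \<open>g\<close>.\<close>
      define \<beta> where "\<beta> = c / t / y - t * (p * y powr (p - 1))"
      define \<gamma> where "\<gamma> = 2 * (c / t) + t * (p * y powr (p - 1) * y) - t * y powr p"
      have "dev k f x \<le> cond k (\<lambda>z. t * g z powr p + (\<beta> * g z + \<gamma>)) x"
        unfolding dev
      proof (rule cond_mono)
        show "loc_int k (\<lambda>z. \<bar>g z - y\<bar>)" unfolding g_def by (rule loc_int_cond_Suc_comp)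
        show "loc_int k (\<lambda>z. t * g z powr p + (\<beta> * g z + \<gamma>))"
          by (intro loc_int_add loc_int_cmult lg lgp loc_int_const)
        fix z
        show "\<bar>g z - y\<bar> \<le> t * g z powr p + (\<beta> * g z + \<gamma>)"
          using deviation_pointwise[OF p g0[of z] \<open>0 < y\<close> \<open>0 < t\<close>] \<open>0 < y\<close> \<open>0 < t\<close>
          unfolding c_def[symmetric] \<beta>_def \<gamma>_def by (simp add: algebra_simps)
      qed
      also have "\<dots> = t * (V + y powr p) + (\<beta> * y + \<gamma>)"
        using m by (simp add: cond_add loc_int_add loc_int_cmult lg lgp loc_int_const
            cond_cmult cond_const mean V_def)
      also have "\<dots> = t * V + 3 * c / t"
        using \<open>0 < y\<close> \<open>0 < t\<close> by (simp add: \<beta>_def \<gamma>_def field_simps)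
      finally show "dev k f x \<le> t * V + 3 * c / t" .
    qed (use \<open>0 \<le> V\<close> \<open>0 \<le> c\<close> dev_nonneg in auto)
    also have "4 * (3 * c) * V = 6 / (p * (p - 1)) * y powr (2 - p) * V"
      using p by (simp add: c_def field_simps)
    finally show ?thesis .
  qed
  then show "(dev k f x)\<^sup>2 \<le> 6 / (p * (p - 1)) * cond k f x powr (2 - p)
           * (cond k (\<lambda>z. cond (k + 1) f z powr p) x - cond k f x powr p)"
    by (simp add: V_def y_def g_def)
qed

text \<open>
  A crude bound that makes the integrals finite in the absorption argument for \<open>p > 2\<close>.
\<close>

lemma dev_le:
  assumes f: "loc_int k f" "loc_int (k + 1) f" "\<And>x. 0 \<le> f x" "f \<in> borel_measurable borel"
  shows "dev k f x \<le> 2 * cond k f x"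
proof (cases "measure \<sigma> (cube k x) = 0")
  case False
  define y where "y = cond k f x"
  have "0 \<le> y" unfolding y_def by (rule cond_nonneg) (rule f)
  have "dev k f x \<le> cond k (\<lambda>z. cond (k + 1) f z + y) x"
    unfolding dev_eq y_def[symmetric]
  proof (rule cond_mono)
    show "loc_int k (\<lambda>z. \<bar>cond (k + 1) f z - y\<bar>)" by (rule loc_int_cond_Suc_comp)
    show "loc_int k (\<lambda>z. cond (k + 1) f z + y)" by (rule loc_int_cond_Suc_comp)
    fix z
    have "0 \<le> cond (k + 1) f z" by (rule cond_nonneg) (rule f)
    then show "\<bar>cond (k + 1) f z - y\<bar> \<le> cond (k + 1) f z + y" using \<open>0 \<le> y\<close> by simp
  qed
  also have "\<dots> = y + y"
    using False by (simp add: cond_add loc_int_cond_Suc loc_int_const cond_const cond_tower[OF f] y_def)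
  finally show ?thesis by (simp add: y_def)
qed (simp add: dev_eq cond_def)

text \<open>
  Recursion on the number of generations, for the pathwise argument in \<open>maximal_ineq\<close>.
\<close>

primrec runmax :: "int \<Rightarrow> (real ^ 'n \<Rightarrow> real) \<Rightarrow> nat \<Rightarrow> real ^ 'n \<Rightarrow> real" where
  "runmax m f 0 = cond m f"
| "runmax m f (Suc n) = (\<lambda>x. max (runmax m f n x) (cond (m + int (Suc n)) f x))"

lemma adapted_runmax: "adapted (m + int n) (runmax m f n)"
proof (induction n)
  case (Suc n)
  have "adapted (m + int (Suc n)) (runmax m f n)" by (rule adapted_mono[OF Suc]) simp
  then show ?case
    using adapted_cond[of "m + int (Suc n)" f] unfolding runmax.simps adapted_def by metis
qed (simp add: adapted_cond)

lemma runmax_nonneg: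
  assumes "\<And>x. 0 \<le> f x" shows "0 \<le> runmax m f n x"
  by (induction n) (auto simp: cond_nonneg assms intro: max.coboundedI1)

lemma cond_le_runmax: "cond (m + int n) f x \<le> runmax m f n x"
  by (cases n) auto

lemma runmax_mono: "i \<le> n \<Longrightarrow> runmax m f i x \<le> runmax m f n x"
  by (induction n rule: dec_induct) auto

lemma cond_borel [measurable]: "cond k f \<in> borel_measurable borel"
  and dev_borel [measurable]: "dev k f \<in> borel_measurable borel"
  and runmax_borel [measurable]: "runmax m f n \<in> borel_measurable borel"
  using adapted_cond adapted_dev adapted_runmax adapted_measurable by blast+

lemma adapted_comp2: "adapted k g \<Longrightarrow> adapted k h \<Longrightarrow> adapted k (\<lambda>x. F (g x) (h x))"
  unfolding adapted_def by metis

text \<open>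
  Doob's inequality by a pathwise argument: the increments of \<open>M\<^sup>p\<close> are at most \<open>p / (p - 1)\<close> times the current average times the
  increment of \<open>M\<^bsup>p-1\<^esup>\<close>, because the maximum only grows when it equals the current average. Under the
  integral each average may be replaced by \<open>f\<close>, the increments sum up, and \<open>M\<^sup>p\<close> is absorbed.
\<close>

lemma maximal_ineq:
  assumes f: "f \<in> borel_measurable borel" "\<And>x. 0 \<le> f x"
    "moment \<sigma> p f < \<infinity>" and p: "1 < p"
  shows "moment \<sigma> p (runmax m f n)
           \<le> ennreal (doob_const p) * moment \<sigma> p f"
    and "moment \<sigma> p (runmax m f n) < \<infinity>"
proof -
  note [measurable] = f(1)
  define M where "M = runmax m f"
  define C where "C = p / (p - 1)"
  define c where "c i x = M i x powr (p - 1)" for i x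
  \<comment> \<open>The increments of \<open>c\<close>, starting from zero: their sum up to \<open>n\<close> is \<open>c n\<close>.\<close>
  define d where "d i x = (case i of 0 \<Rightarrow> c 0 x | Suc j \<Rightarrow> c i x - c j x)" for i x
  have C: "0 < C" using p by (simp add: C_def)
  have M0: "0 \<le> M i x" for i x unfolding M_def by (rule runmax_nonneg) (rule f)
  have E0: "0 \<le> cond k f x" for k x by (rule cond_nonneg) (rule f)
  have Mmeas [measurable]: "M i \<in> borel_measurable borel" for i unfolding M_def by measurable
  have d0: "0 \<le> d i x" for i x
    using p M0 runmax_mono[of _ i m f x]
    by (cases i) (auto simp: d_def c_def M_def[symmetric] intro!: powr_mono2 simp del: runmax.simps)
  have li: "loc_int k f" for k by (rule loc_int_of_Lp[OF f(1,2) _ f(3)]) (use p in auto)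
  have adM: "adapted (m + int i) (M j)" if "j \<le> i" for i j
    unfolding M_def by (rule adapted_mono[OF adapted_runmax]) (use that in simp)
  have adc: "adapted (m + int i) (c j)" if "j \<le> i" for i j
    unfolding c_def by (rule adapted_comp[OF adM[OF that]])
  have add: "adapted (m + int i) (d i)" for i
  proof (cases i)
    case 0
    then show ?thesis using adc[of 0 0] by (simp add: d_def[abs_def])
  next
    case (Suc j)
    then show ?thesis using adapted_comp2[OF adc[of i i] adc[of j i], of "(-)"] by (simp add: d_def[abs_def])
  qed
  have [measurable]: "d i \<in> borel_measurable borel" for i using add by (rule adapted_measurable)
  have step: "x powr p - y powr p \<le> C * (x * (x powr (p - 1) - y powr (p - 1)))"
    if "0 \<le> y" "0 \<le> x" for x y :: real
  proof -
    have e: "z powr (p - 1) * z = z powr p" if "0 \<le> z" for z :: real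
      using that by (cases "z = 0") (auto simp: powr_diff)
    have "p * y powr (p - 1) * (x - y) \<le> x powr p - y powr p"
      using powr_tangent[of p x y] p that by simp
    then have "(p - 1) * (x powr p - y powr p) \<le> p * (x * (x powr (p - 1) - y powr (p - 1)))"
      using e[OF \<open>0 \<le> x\<close>] e[OF \<open>0 \<le> y\<close>] by (simp add: algebra_simps)
    then show ?thesis using p by (simp add: C_def field_simps)
  qed
  have path: "M n x powr p \<le> C * (\<Sum>i\<le>n. d i x * cond (m + int i) f x)" for n x
  proof (induction n)
    case 0
    show ?case using step[of 0 "cond m f x"] E0[of m x] p by (simp add: M_def d_def c_def mult_ac)
  next
    case (Suc n)
    have "M (Suc n) x powr p - M n x powr p \<le> C * (d (Suc n) x * cond (m + int (Suc n)) f x)"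
    proof (cases "cond (m + int (Suc n)) f x \<le> M n x")
      case True
      then have "M (Suc n) x = M n x" by (simp add: M_def)
      then show ?thesis by (simp add: d_def c_def)
    next
      case False
      then have "M (Suc n) x = cond (m + int (Suc n)) f x" by (simp add: M_def)
      then show ?thesis
        using step[OF M0[of n x] M0[of "Suc n" x]] by (simp add: d_def c_def mult_ac)
    qed
    then show ?case using Suc by (simp add: algebra_simps)
  qed
  have tele: "(\<Sum>i\<le>n. d i x) = c n x" for n x
    by (induction n) (auto simp: d_def)
  show fin: "moment \<sigma> p (runmax m f n) < \<infinity>" for n
  proof (induction n)
    case 0
    show ?case
      using cond_Lp_contraction[OF f(1,2) _ f(3), of m] p f(3) by (simp add: order.strict_trans1)
  next
    case (Suc n)
    have "moment \<sigma> p (runmax m f (Suc n))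
        \<le> (\<integral>\<^sup>+ x. ennreal (runmax m f n x powr p) + ennreal (cond (m + int (Suc n)) f x powr p) \<partial>\<sigma>)"
      by (intro nn_integral_mono) (auto simp: max_def add_increasing add_increasing2)
    also have "\<dots> = moment \<sigma> p (runmax m f n)
        + moment \<sigma> p (cond (m + int (Suc n)) f)"
      by (intro nn_integral_add) measurable
    also have "\<dots> < \<infinity>"
      using Suc cond_Lp_contraction[OF f(1,2) _ f(3), of "m + int (Suc n)"] p f(3)
      by (simp add: order.strict_trans1 ennreal_add_less_top)
    finally show ?case .
  qed
  have "moment \<sigma> p (M n)
      \<le> (\<integral>\<^sup>+ x. ennreal (C * (\<Sum>i\<le>n. d i x * cond (m + int i) f x)) \<partial>\<sigma>)"
    by (intro nn_integral_mono ennreal_leI path)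
  also have "\<dots> = (\<integral>\<^sup>+ x. ennreal C * (\<Sum>i\<le>n. ennreal (d i x * cond (m + int i) f x)) \<partial>\<sigma>)"
    using C d0 E0 by (intro nn_integral_cong, subst ennreal_mult) (auto intro!: sum_nonneg)
  also have "\<dots> = ennreal C * (\<Sum>i\<le>n. \<integral>\<^sup>+ x. ennreal (d i x * cond (m + int i) f x) \<partial>\<sigma>)"
    by (simp add: nn_integral_cmult nn_integral_sum)
  also have "\<dots> = ennreal C * (\<Sum>i\<le>n. \<integral>\<^sup>+ x. ennreal (d i x * f x) \<partial>\<sigma>)"
    by (simp only: nn_integral_mult_cond[OF li f(2) f(1) add d0])
  also have "\<dots> = (\<integral>\<^sup>+ x. ennreal C * (\<Sum>i\<le>n. ennreal (d i x * f x)) \<partial>\<sigma>)"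
    by (simp add: nn_integral_cmult nn_integral_sum)
  also have "\<dots> = (\<integral>\<^sup>+ x. ennreal (C * f x * c n x) \<partial>\<sigma>)"
  proof (rule nn_integral_cong)
    fix x
    have "C * f x * c n x = C * (\<Sum>i\<le>n. d i x * f x)"
      unfolding tele[symmetric] sum_distrib_right[symmetric] by (simp add: mult_ac)
    then show "ennreal C * (\<Sum>i\<le>n. ennreal (d i x * f x)) = ennreal (C * f x * c n x)"
      using C d0 f(2) by (simp only:, subst ennreal_mult) (auto intro!: sum_nonneg)
  qed
  also have "\<dots> \<le> (\<integral>\<^sup>+ x. ennreal (1 / 2) * ennreal (M n x powr p)
      + ennreal ((2 * C) powr p) * ennreal (f x powr p) \<partial>\<sigma>)"
  proof (rule nn_integral_mono)
    fix x
    have "C * f x * c n x \<le> M n x powr p / 2 + (2 * C * f x) powr p"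
      unfolding c_def using p C f(2) M0 by (intro powr_absorb) auto
    also have "\<dots> = 1 / 2 * M n x powr p + (2 * C) powr p * f x powr p"
      using C f(2) by (simp add: powr_mult)
    finally have "ennreal (C * f x * c n x) \<le> ennreal (1 / 2 * M n x powr p + (2 * C) powr p * f x powr p)"
      by (rule ennreal_leI)
    then show "ennreal (C * f x * c n x) \<le> ennreal (1 / 2) * ennreal (M n x powr p)
      + ennreal ((2 * C) powr p) * ennreal (f x powr p)"
      by (subst ennreal_mult[symmetric] ennreal_plus[symmetric]; simp)+
  qed
  also have "\<dots> = ennreal (1 / 2) * moment \<sigma> p (M n)
      + ennreal ((2 * C) powr p) * moment \<sigma> p f"
    by (simp add: nn_integral_add nn_integral_cmult)
  finally have "moment \<sigma> p (M n)
      \<le> ennreal 2 * (ennreal ((2 * C) powr p) * moment \<sigma> p f)"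
    using fin unfolding M_def by (intro ennreal_absorb_half)
  also have "ennreal 2 * (ennreal ((2 * C) powr p) * moment \<sigma> p f)
      = ennreal (doob_const p) * moment \<sigma> p f"
    unfolding doob_const_def C_def[symmetric] by (subst ennreal_mult) (auto simp: mult.assoc)
  finally show "moment \<sigma> p (runmax m f n)
           \<le> ennreal (doob_const p) * moment \<sigma> p f"
    by (simp add: M_def)
qed

text \<open>
  Bound the weights in \<open>dev_square_le\<close> by a power of the maximal function. The remaining sum \<open>S\<close> of
  Jensen gaps telescopes in the integral, and the exponents \<open>1 - p / 2\<close> and \<open>p / 2\<close> of \<open>M\<^sup>p\<close> and \<open>S\<close> add up to one.
\<close>

lemma square_ineq_small_exponent:
  assumes f: "f \<in> borel_measurable borel" "\<And>x. 0 \<le> f x"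
    "moment \<sigma> p f < \<infinity>" and p: "1 < p" "p \<le> 2"
  shows "moment \<sigma> (p / 2) (\<lambda>x. \<Sum>i<n. (dev (m + int i) f x)\<^sup>2)
           \<le> ennreal (square_const p) * moment \<sigma> p f"
proof -
  note [measurable] = f(1)
  define \<kappa> where "\<kappa> = 6 / (p * (p - 1))"
  have \<kappa>: "0 < \<kappa>" using p by (simp add: \<kappa>_def)
  define M where "M = runmax m f n"
  define V where "V i x = cond (m + int i) (\<lambda>z. cond (m + int i + 1) f z powr p) x - cond (m + int i) f x powr p" for i x
  define S where "S k x = (\<Sum>i<k. V i x)" for k x
  have [measurable]: "M \<in> borel_measurable borel" "V i \<in> borel_measurable borel"
    "S i \<in> borel_measurable borel" for i unfolding M_def V_def S_def by measurable
  have li: "loc_int k f" for k by (rule loc_int_of_Lp[OF f(1,2) _ f(3)]) (use p in auto)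
  have M0: "0 \<le> M x" for x unfolding M_def by (rule runmax_nonneg) (rule f)
  have E0: "0 \<le> cond k f x" for k x by (rule cond_nonneg) (rule f)
  have V0: "0 \<le> V i x" for i x
    using dev_square_le(2)[OF li li f(2) f(1) p, of "m + int i" x] by (simp add: V_def)
  then have S0: "0 \<le> S k x" for k x unfolding S_def by (intro sum_nonneg)
  have pw: "(\<Sum>i<n. (dev (m + int i) f x)\<^sup>2) powr (p / 2)
      \<le> \<kappa> powr (p / 2) * (M x powr p + S n x)" for x
  proof -
    have "(\<Sum>i<n. (dev (m + int i) f x)\<^sup>2) \<le> (\<Sum>i<n. \<kappa> * M x powr (2 - p) * V i x)"
    proof (rule sum_mono)
      fix i assume "i \<in> {..<n}"
      then have "cond (m + int i) f x \<le> M x"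
        unfolding M_def using cond_le_runmax[of m i f x] runmax_mono[of i n m f x] by simp
      then have "cond (m + int i) f x powr (2 - p) \<le> M x powr (2 - p)"
        using p E0 by (intro powr_mono2) auto
      then have "\<kappa> * cond (m + int i) f x powr (2 - p) * V i x \<le> \<kappa> * M x powr (2 - p) * V i x"
        using \<kappa> V0 by (intro mult_right_mono mult_left_mono) auto
      moreover have "(dev (m + int i) f x)\<^sup>2 \<le> \<kappa> * cond (m + int i) f x powr (2 - p) * V i x"
        unfolding \<kappa>_def V_def by (rule dev_square_le(1)[OF li li f(2) f(1) p])
      ultimately show "(dev (m + int i) f x)\<^sup>2 \<le> \<kappa> * M x powr (2 - p) * V i x" by simp
    qed
    also have "\<dots> = \<kappa> * (M x powr (2 - p) * S n x)"
      by (simp add: S_def sum_distrib_left sum_distrib_right mult_ac)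
    finally have "(\<Sum>i<n. (dev (m + int i) f x)\<^sup>2) powr (p / 2)
        \<le> (\<kappa> * (M x powr (2 - p) * S n x)) powr (p / 2)"
      using p by (intro powr_mono2 sum_nonneg) auto
    also have "\<dots> = \<kappa> powr (p / 2) * ((M x powr p) powr (1 - p / 2) * S n x powr (p / 2))"
    proof -
      have "(2 - p) * (p / 2) = p * (1 - p / 2)" by (simp add: field_simps)
      then have "(M x powr (2 - p)) powr (p / 2) = (M x powr p) powr (1 - p / 2)"
        by (simp only: powr_powr)
      then show ?thesis using \<kappa> S0 M0 by (simp add: powr_mult)
    qed
    also have "\<dots> \<le> \<kappa> powr (p / 2) * (M x powr p + S n x)"
      using p S0 by (intro mult_left_mono powr_geometric_mean_le) auto
    finally show ?thesis .
  qed
  have SV: "(\<integral>\<^sup>+ x. ennreal (S k x) \<partial>\<sigma>) \<le> moment \<sigma> p (cond (m + int k) f)" for k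
  proof (induction k)
    case (Suc k)
    have next_gen: "m + int (Suc k) = m + int k + 1" by simp
    have "(\<integral>\<^sup>+ x. ennreal (S (Suc k) x) \<partial>\<sigma>) = (\<integral>\<^sup>+ x. ennreal (S k x) + ennreal (V k x) \<partial>\<sigma>)"
      using S0 V0 by (simp add: S_def sum_nonneg)
    also have "\<dots> = (\<integral>\<^sup>+ x. ennreal (S k x) \<partial>\<sigma>) + (\<integral>\<^sup>+ x. ennreal (V k x) \<partial>\<sigma>)"
      by (intro nn_integral_add) measurable
    also have "\<dots> \<le> moment \<sigma> p (cond (m + int k) f) + (\<integral>\<^sup>+ x. ennreal (V k x) \<partial>\<sigma>)"
      by (intro add_right_mono Suc)
    also have "\<dots> = (\<integral>\<^sup>+ x. ennreal (cond (m + int k) f x powr p) + ennreal (V k x) \<partial>\<sigma>)"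
      by (intro nn_integral_add[symmetric]) measurable
    also have "\<dots> = (\<integral>\<^sup>+ x. ennreal (cond (m + int k) (\<lambda>z. cond (m + int k + 1) f z powr p) x) \<partial>\<sigma>)"
      using V0 by (intro nn_integral_cong) (simp add: V_def flip: ennreal_plus)
    also have "\<dots> = moment \<sigma> p (cond (m + int (Suc k)) f)"
      unfolding next_gen by (intro nn_integral_cond loc_int_cond_Suc_comp) auto
    finally show ?case .
  qed (simp add: S_def)
  have "moment \<sigma> (p / 2) (\<lambda>x. \<Sum>i<n. (dev (m + int i) f x)\<^sup>2)
      \<le> (\<integral>\<^sup>+ x. ennreal (\<kappa> powr (p / 2)) * (ennreal (M x powr p) + ennreal (S n x)) \<partial>\<sigma>)"
  proof (rule nn_integral_mono)
    fix x
    have "ennreal (\<kappa> powr (p / 2)) * (ennreal (M x powr p) + ennreal (S n x))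
        = ennreal (\<kappa> powr (p / 2) * (M x powr p + S n x))"
      using S0[of n x] by (simp add: ennreal_mult)
    then show "ennreal ((\<Sum>i<n. (dev (m + int i) f x)\<^sup>2) powr (p / 2))
        \<le> ennreal (\<kappa> powr (p / 2)) * (ennreal (M x powr p) + ennreal (S n x))"
      using ennreal_leI[OF pw[of x]] by simp
  qed
  also have "\<dots> = ennreal (\<kappa> powr (p / 2)) * (moment \<sigma> p M + (\<integral>\<^sup>+ x. ennreal (S n x) \<partial>\<sigma>))"
    by (simp add: nn_integral_cmult nn_integral_add)
  also have "\<dots> \<le> ennreal (\<kappa> powr (p / 2)) * (ennreal (doob_const p) * moment \<sigma> p f
      + moment \<sigma> p f)"
    unfolding M_def
    by (intro mult_left_mono add_mono maximal_ineq(1)[OF f p(1)] order_trans[OF SV]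
          cond_Lp_contraction[OF f(1,2) _ f(3)]) (use p in auto)
  also have "\<dots> = ennreal (square_const p) * moment \<sigma> p f"
  proof -
    have "0 \<le> doob_const p" by (simp add: doob_const_def)
    then have "ennreal (square_const p) = ennreal (\<kappa> powr (p / 2)) * (ennreal (doob_const p) + 1)"
      using p by (simp add: square_const_def \<kappa>_def ennreal_mult flip: ennreal_1)
    then show ?thesis by (simp add: distrib_right mult.assoc)
  qed
  finally show ?thesis .
qed

text \<open>
  Let \<open>B\<close> be the sum of the squared oscillations. Its power \<open>r = p / 2\<close> has increments at most \<open>r\<close> times the new term times
  \<open>B\<^bsup>r-1\<^esup>\<close>. The new term is bounded by the gap in Jensen's inequality for squares, and since \<open>B\<^bsup>r-1\<^esup>\<close>
  increases and is constant on the coarser cubes, summation by parts leaves only the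
  last average squared times \<open>B\<^bsup>r-1\<^esup>\<close>, which is absorbed.
\<close>

lemma square_ineq_large_exponent:
  assumes f: "f \<in> borel_measurable borel" "\<And>x. 0 \<le> f x"
    "moment \<sigma> p f < \<infinity>" and p: "2 < p"
  shows "moment \<sigma> (p / 2) (\<lambda>x. \<Sum>i<n. (dev (m + int i) f x)\<^sup>2)
           \<le> ennreal (square_const p) * moment \<sigma> p f"
proof -
  note [measurable] = f(1)
  define r where "r = p / 2"
  have r: "1 < r" using p by (simp add: r_def)
  define b where "b i x = (dev (m + int i) f x)\<^sup>2" for i x
  define B where "B k x = (\<Sum>i<k. b i x)" for k x
  define F where "F i x = cond (m + int i) f x powr 2" for i x
  have [measurable]: "b i \<in> borel_measurable borel" "B i \<in> borel_measurable borel"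
    "F i \<in> borel_measurable borel" for i unfolding b_def B_def F_def by measurable
  have li: "loc_int k f" for k by (rule loc_int_of_Lp[OF f(1,2) _ f(3)]) (use p in auto)
  have E0: "0 \<le> cond k f x" for k x by (rule cond_nonneg) (rule f)
  have b0: "0 \<le> b i x" for i x by (simp add: b_def)
  have B0: "0 \<le> B k x" for k x unfolding B_def by (intro sum_nonneg b0)
  have F0: "0 \<le> F i x" for i x by (simp add: F_def)
  have Bmono: "B k x \<le> B (Suc k) x" for k x using b0 by (simp add: B_def)
  have adB: "adapted (m + int k) (B (Suc k))" for k
  proof (induction k)
    case 0
    show ?case using adapted_comp[OF adapted_dev[of m f]] by (simp add: B_def b_def)
  next
    case (Suc k)
    have "adapted (m + int (Suc k)) (B (Suc k))" by (rule adapted_mono[OF Suc]) simp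
    from adapted_comp2[OF this adapted_dev, of "\<lambda>u v. u + v\<^sup>2"]
    show ?case by (simp add: B_def b_def)
  qed
  have b_le: "b i x \<le> 3 * (cond (m + int i) (F (Suc i)) x - F i x)"
    and V0: "F i x \<le> cond (m + int i) (F (Suc i)) x" for i x
  proof -
    have next_gen: "m + int (Suc i) = m + int i + 1" by simp
    note sq = dev_square_le[OF li li f(2) f(1), of 2 "m + int i" x]
    show V: "F i x \<le> cond (m + int i) (F (Suc i)) x"
      unfolding F_def next_gen by (rule sq(2)) auto
    have "b i x \<le> 3 * cond (m + int i) f x powr 0 * (cond (m + int i) (F (Suc i)) x - F i x)"
      unfolding b_def F_def next_gen using sq(1) by simp
    also have "\<dots> \<le> 3 * 1 * (cond (m + int i) (F (Suc i)) x - F i x)"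
      using V by (intro mult_right_mono mult_left_mono) auto
    finally show "b i x \<le> 3 * (cond (m + int i) (F (Suc i)) x - F i x)" by simp
  qed
  have path: "B k x powr r \<le> r * (\<Sum>i<k. b i x * B (Suc i) x powr (r - 1))" for k x
  proof (induction k)
    case (Suc k)
    have "B (Suc k) x powr r + r * B (Suc k) x powr (r - 1) * (B k x - B (Suc k) x) \<le> B k x powr r"
      using r B0 by (intro powr_tangent) auto
    moreover have "B k x - B (Suc k) x = - b k x" by (simp add: B_def)
    ultimately show ?case using Suc by (simp add: algebra_simps)
  qed (simp add: B_def)
  \<comment> \<open>Summation by parts, in a form without subtraction: the bound for \<open>k\<close> is carried to \<open>k + 1\<close>.\<close>
  have abel: "(\<integral>\<^sup>+ x. ennreal (\<Sum>i<k. b i x * B (Suc i) x powr (r - 1)) \<partial>\<sigma>)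
      \<le> (\<integral>\<^sup>+ x. ennreal (3 * F k x * B k x powr (r - 1)) \<partial>\<sigma>)" for k
  proof (induction k)
    case (Suc k)
    define c where "c x = B (Suc k) x powr (r - 1)" for x
    have c0: "0 \<le> c x" for x by (simp add: c_def)
    have [measurable]: "c \<in> borel_measurable borel" unfolding c_def by measurable
    have next_gen: "m + int (Suc k) = m + int k + 1" by simp
    have "(\<integral>\<^sup>+ x. ennreal (\<Sum>i<Suc k. b i x * B (Suc i) x powr (r - 1)) \<partial>\<sigma>)
        = (\<integral>\<^sup>+ x. ennreal (\<Sum>i<k. b i x * B (Suc i) x powr (r - 1)) + ennreal (b k x * c x) \<partial>\<sigma>)"
      using b0 c0 by (simp add: c_def sum_nonneg)
    also have "\<dots> = (\<integral>\<^sup>+ x. ennreal (\<Sum>i<k. b i x * B (Suc i) x powr (r - 1)) \<partial>\<sigma>)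
        + (\<integral>\<^sup>+ x. ennreal (b k x * c x) \<partial>\<sigma>)"
      by (intro nn_integral_add) measurable
    also have "\<dots> \<le> (\<integral>\<^sup>+ x. ennreal (3 * F k x * B k x powr (r - 1)) \<partial>\<sigma>)
        + (\<integral>\<^sup>+ x. ennreal (b k x * c x) \<partial>\<sigma>)"
      by (intro add_right_mono Suc)
    also have "\<dots> = (\<integral>\<^sup>+ x. ennreal (3 * F k x * B k x powr (r - 1)) + ennreal (b k x * c x) \<partial>\<sigma>)"
      by (intro nn_integral_add[symmetric]) measurable
    also have "\<dots> \<le> (\<integral>\<^sup>+ x. ennreal ((3 * c x) * cond (m + int k) (F (Suc k)) x) \<partial>\<sigma>)"
    proof (rule nn_integral_mono)
      fix x
      have "B k x powr (r - 1) \<le> c x"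
        unfolding c_def using Bmono B0 r by (intro powr_mono2) auto
      then have "3 * F k x * B k x powr (r - 1) \<le> 3 * F k x * c x"
        using F0[of k x] by (intro mult_left_mono) auto
      moreover have "b k x * c x \<le> 3 * (cond (m + int k) (F (Suc k)) x - F k x) * c x"
        using b_le c0 by (intro mult_right_mono) auto
      ultimately have "3 * F k x * B k x powr (r - 1) + b k x * c x
          \<le> (3 * c x) * cond (m + int k) (F (Suc k)) x"
        by (simp add: algebra_simps)
      then have "ennreal (3 * F k x * B k x powr (r - 1) + b k x * c x)
          \<le> ennreal ((3 * c x) * cond (m + int k) (F (Suc k)) x)"
        by (rule ennreal_leI)
      then show "ennreal (3 * F k x * B k x powr (r - 1)) + ennreal (b k x * c x)
          \<le> ennreal ((3 * c x) * cond (m + int k) (F (Suc k)) x)"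
        using F0[of k x] b0[of k x] c0[of x] by (subst ennreal_plus[symmetric]) auto
    qed
    also have "\<dots> = (\<integral>\<^sup>+ x. ennreal ((3 * c x) * F (Suc k) x) \<partial>\<sigma>)"
    proof (rule nn_integral_mult_cond)
      show "loc_int (m + int k) (F (Suc k))"
        unfolding F_def next_gen by (rule loc_int_cond_Suc_comp)
      show "adapted (m + int k) (\<lambda>x. 3 * c x)"
        unfolding c_def by (rule adapted_comp[OF adB])
    qed (use F0 c0 in auto)
    also have "\<dots> = (\<integral>\<^sup>+ x. ennreal (3 * F (Suc k) x * B (Suc k) x powr (r - 1)) \<partial>\<sigma>)"
      by (simp add: c_def mult_ac)
    finally show ?case .
  qed (simp add: B_def)
  have Fr: "F n x powr r = cond (m + int n) f x powr p" for x
    by (simp add: F_def powr_powr r_def)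
  have fin: "moment \<sigma> r (B n) < \<infinity>"
  proof -
    define M where "M = runmax m f n"
    have [measurable]: "M \<in> borel_measurable borel" unfolding M_def by measurable
    have M0: "0 \<le> M x" for x unfolding M_def by (rule runmax_nonneg) (rule f)
    have "B n x powr r \<le> (4 * real n) powr r * M x powr p" for x
    proof -
      have "B n x \<le> (\<Sum>i<n. (2 * M x)\<^sup>2)"
        unfolding B_def b_def
      proof (rule sum_mono)
        fix i assume "i \<in> {..<n}"
        then have "cond (m + int i) f x \<le> M x"
          unfolding M_def using cond_le_runmax[of m i f x] runmax_mono[of i n m f x] by simp
        then have "dev (m + int i) f x \<le> 2 * M x"
          using dev_le[OF li li f(2) f(1), of "m + int i" x] by simp
        then show "(dev (m + int i) f x)\<^sup>2 \<le> (2 * M x)\<^sup>2"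
          by (intro power_mono dev_nonneg)
      qed
      also have "\<dots> = (4 * real n) * M x powr 2"
        using M0[of x] by (cases "M x = 0") (auto simp: power_mult_distrib powr_numeral)
      finally have "B n x powr r \<le> ((4 * real n) * M x powr 2) powr r"
        using r B0 by (intro powr_mono2) auto
      also have "\<dots> = (4 * real n) powr r * M x powr p"
        by (simp add: powr_mult powr_powr r_def)
      finally show ?thesis .
    qed
    then have "moment \<sigma> r (B n)
        \<le> (\<integral>\<^sup>+ x. ennreal ((4 * real n) powr r * M x powr p) \<partial>\<sigma>)"
      by (intro nn_integral_mono ennreal_leI)
    also have "\<dots> = ennreal ((4 * real n) powr r) * moment \<sigma> p M"
      by (intro nn_integral_cmult_real) auto
    also have "\<dots> < \<infinity>"
      using maximal_ineq(2)[OF f, of m n] p by (simp add: M_def ennreal_mult_less_top)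
    finally show ?thesis .
  qed
  have "moment \<sigma> r (B n)
      \<le> (\<integral>\<^sup>+ x. ennreal (r * (\<Sum>i<n. b i x * B (Suc i) x powr (r - 1))) \<partial>\<sigma>)"
    by (intro nn_integral_mono ennreal_leI path)
  also have "\<dots> = ennreal r * (\<integral>\<^sup>+ x. ennreal (\<Sum>i<n. b i x * B (Suc i) x powr (r - 1)) \<partial>\<sigma>)"
    using r b0 by (intro nn_integral_cmult_real) (auto intro!: sum_nonneg)
  also have "\<dots> \<le> ennreal r * (\<integral>\<^sup>+ x. ennreal (3 * F n x * B n x powr (r - 1)) \<partial>\<sigma>)"
    by (intro mult_left_mono abel) auto
  also have "\<dots> = (\<integral>\<^sup>+ x. ennreal (r * (3 * F n x * B n x powr (r - 1))) \<partial>\<sigma>)"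
    using r F0 by (intro nn_integral_cmult_real[symmetric]) auto
  also have "\<dots> \<le> (\<integral>\<^sup>+ x. ennreal (1 / 2) * ennreal (B n x powr r)
      + ennreal ((6 * r) powr r) * ennreal (cond (m + int n) f x powr p) \<partial>\<sigma>)"
  proof (rule nn_integral_mono)
    fix x
    have "3 * r * F n x * B n x powr (r - 1) \<le> B n x powr r / 2 + (2 * (3 * r) * F n x) powr r"
      using r F0 B0 by (intro powr_absorb) auto
    also have "\<dots> = 1 / 2 * B n x powr r + (6 * r) powr r * cond (m + int n) f x powr p"
      using r F0[of n x] by (simp add: powr_mult Fr)
    finally have "ennreal (r * (3 * F n x * B n x powr (r - 1)))
        \<le> ennreal (1 / 2 * B n x powr r + (6 * r) powr r * cond (m + int n) f x powr p)"
      by (intro ennreal_leI) (simp add: mult_ac)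
    then show "ennreal (r * (3 * F n x * B n x powr (r - 1))) \<le> ennreal (1 / 2) * ennreal (B n x powr r)
      + ennreal ((6 * r) powr r) * ennreal (cond (m + int n) f x powr p)"
      by (subst ennreal_mult[symmetric] ennreal_plus[symmetric]; simp)+
  qed
  also have "\<dots> = ennreal (1 / 2) * moment \<sigma> r (B n)
      + ennreal ((6 * r) powr r) * moment \<sigma> p (cond (m + int n) f)"
    by (simp add: nn_integral_add nn_integral_cmult)
  finally have "moment \<sigma> r (B n)
      \<le> ennreal 2 * (ennreal ((6 * r) powr r) * moment \<sigma> p (cond (m + int n) f))"
    using fin by (intro ennreal_absorb_half)
  also have "\<dots> \<le> ennreal 2 * (ennreal ((6 * r) powr r) * moment \<sigma> p f)"
    using p by (intro mult_left_mono cond_Lp_contraction[OF f(1,2) _ f(3)]) auto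
  also have "\<dots> = ennreal (square_const p) * moment \<sigma> p f"
    using p by (simp add: square_const_def r_def ennreal_mult mult.assoc)
  finally show ?thesis by (simp add: B_def b_def r_def)
qed

lemma square_ineq:
  assumes f: "f \<in> borel_measurable borel" "\<And>x. 0 \<le> f x"
    "moment \<sigma> p f < \<infinity>" and p: "1 < p"
  shows "moment \<sigma> (p / 2) (\<lambda>x. \<Sum>i<n. (dev (m + int i) f x)\<^sup>2)
           \<le> ennreal (square_const p) * moment \<sigma> p f"
  using square_ineq_small_exponent[OF f p] square_ineq_large_exponent[OF f] by (cases "p \<le> 2") auto

end

section \<open>From local testing and the quadratic condition to the two weight inequality\<close>

lemma sum_window_le_infsum:
  fixes t :: "int \<Rightarrow> ennreal"
  shows "(\<Sum>i<N. t (m + int i)) \<le> (\<Sum>\<^sub>\<infinity>k. t k)"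
proof -
  have "(\<Sum>i<N. t (m + int i)) = sum t ((\<lambda>i. m + int i) ` {..<N})"
    by (subst sum.reindex) (auto simp: inj_on_def)
  also have "\<dots> \<le> (\<Sum>\<^sub>\<infinity>k. t k)" by (rule sum_le_infsum_ennreal) auto
  finally show ?thesis .
qed

lemma infsum_window:
  fixes t :: "int \<Rightarrow> ennreal"
  assumes "\<And>k. k \<notin> (\<lambda>i. m + int i) ` {..<N} \<Longrightarrow> t k = 0"
  shows "(\<Sum>\<^sub>\<infinity>k. t k) = (\<Sum>i<N. t (m + int i))"
proof -
  have "(\<Sum>\<^sub>\<infinity>k. t k) = (\<Sum>\<^sub>\<infinity>k\<in>(\<lambda>i. m + int i) ` {..<N}. t k)"
    by (rule infsum_cong_neutral) (use assms in auto)
  also have "\<dots> = sum t ((\<lambda>i. m + int i) ` {..<N})" by (rule infsum_finite) simp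
  also have "\<dots> = (\<Sum>i<N. t (m + int i))"
    by (subst sum.reindex) (auto simp: inj_on_def)
  finally show ?thesis .
qed

lemma sum_symmetric_window:
  fixes t :: "int \<Rightarrow> ennreal"
  shows "sum t {- int n..<int n} = (\<Sum>i<2 * n. t (- int n + int i))"
proof -
  have "bij_betw (\<lambda>i. - int n + int i) {..<2 * n} {- int n..<int n}"
    by (rule bij_betw_byWitness[where f' = "\<lambda>k. nat (k + int n)"]) auto
  from sum.reindex_bij_betw[OF this, of t] show ?thesis by simp
qed

lemma incseq_symmetric_window:
  fixes t :: "int \<Rightarrow> ennreal"
  shows "incseq (\<lambda>n. \<Sum>i<2 * n. t (- int n + int i))"
  unfolding incseq_def sum_symmetric_window[symmetric] by (intro allI impI sum_mono2) auto

lemma infsum_int_SUP: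
  fixes t :: "int \<Rightarrow> ennreal"
  shows "(\<Sum>\<^sub>\<infinity>k. t k) = (SUP n::nat. \<Sum>i<2 * n. t (- int n + int i))"
  unfolding sum_symmetric_window[symmetric]
proof (rule infsum_ennreal_SUP_incseq)
  show "(\<Union>n::nat. {- int n..<int n}) = UNIV"
  proof (intro equalityI subsetI UNIV_I)
    fix k :: int
    have "k \<in> {- int (nat (\<bar>k\<bar> + 1))..<int (nat (\<bar>k\<bar> + 1))}" by auto
    then show "k \<in> (\<Union>n::nat. {- int n..<int n})" by blast
  qed
qed (auto simp: incseq_def)

lemma sum_triangle:
  fixes F :: "nat \<Rightarrow> nat \<Rightarrow> 'a::comm_monoid_add"
  shows "(\<Sum>i<N. \<Sum>j\<in>{i..<N}. F i j) = (\<Sum>j<N. \<Sum>i\<le>j. F i j)"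
proof (induction N)
  case (Suc N)
  have "(\<Sum>i<N. \<Sum>j\<in>{i..<Suc N}. F i j) = (\<Sum>i<N. (\<Sum>j\<in>{i..<N}. F i j) + F i N)"
    by (intro sum.cong) auto
  then show ?case
    using Suc by (simp add: sum.distrib lessThan_Suc_atMost[symmetric] ac_simps)
qed simp

text \<open>
  The quasi-triangle inequality in \<open>L\<^bsup>q/2\<^esup>\<close>, phrased for the norms \<open>u\<close> and \<open>v\<close> of the square roots.
\<close>

lemma nn_integral_powr_combine:
  fixes X Y Z :: "'a \<Rightarrow> real"
  assumes [measurable]: "X \<in> borel_measurable M" "Y \<in> borel_measurable M"
    and X: "\<And>x. 0 \<le> X x" and Y: "\<And>x. 0 \<le> Y x" and Z: "\<And>x. 0 \<le> Z x"
    and le: "\<And>x. Z x \<le> \<alpha> * (X x + Y x)" and "0 \<le> \<alpha>" "1 \<le> q" "0 \<le> u" "0 \<le> v"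
    and XI: "moment M (q / 2) X \<le> ennreal (u powr q)"
    and YI: "moment M (q / 2) Y \<le> ennreal (v powr q)"
  shows "moment M (q / 2) Z \<le> ennreal ((2 * sqrt (2 * \<alpha>) * (u + v)) powr q)"
proof -
  define c where "c = sqrt (2 * \<alpha>) powr q"
  have c: "2 powr (q / 2) * \<alpha> powr (q / 2) = c"
    using assms by (simp add: c_def powr_mult[symmetric] powr_half_sqrt[symmetric] powr_powr)
  have "moment M (q / 2) Z
      \<le> (\<integral>\<^sup>+ x. ennreal c * (ennreal (X x powr (q / 2)) + ennreal (Y x powr (q / 2))) \<partial>M)"
  proof (rule nn_integral_mono)
    fix x
    have "Z x powr (q / 2) \<le> (\<alpha> * (X x + Y x)) powr (q / 2)"
      using assms by (intro powr_mono2) auto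
    also have "\<dots> = \<alpha> powr (q / 2) * (X x + Y x) powr (q / 2)"
      using assms by (simp add: powr_mult)
    also have "\<dots> \<le> \<alpha> powr (q / 2) * (2 powr (q / 2) * (X x powr (q / 2) + Y x powr (q / 2)))"
      using assms by (intro mult_left_mono sum_powr_le) auto
    also have "\<dots> = c * (X x powr (q / 2) + Y x powr (q / 2))"
      unfolding c[symmetric] by simp
    finally have "ennreal (Z x powr (q / 2)) \<le> ennreal (c * (X x powr (q / 2) + Y x powr (q / 2)))"
      by (rule ennreal_leI)
    then show "ennreal (Z x powr (q / 2)) \<le> ennreal c * (ennreal (X x powr (q / 2)) + ennreal (Y x powr (q / 2)))"
      by (simp add: ennreal_mult c_def)
  qed
  also have "\<dots> = ennreal c * (moment M (q / 2) X + moment M (q / 2) Y)"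
    by (simp add: nn_integral_cmult nn_integral_add)
  also have "\<dots> \<le> ennreal c * (ennreal (u powr q) + ennreal (v powr q))"
    by (intro mult_left_mono add_mono XI YI) auto
  also have "\<dots> = ennreal (c * (u powr q + v powr q))"
    by (simp add: ennreal_mult c_def)
  also have "\<dots> \<le> ennreal ((2 * sqrt (2 * \<alpha>) * (u + v)) powr q)"
  proof (rule ennreal_leI)
    have "u powr q \<le> (u + v) powr q" "v powr q \<le> (u + v) powr q"
      using assms by (auto intro!: powr_mono2)
    then have "u powr q + v powr q \<le> 2 powr 1 * (u + v) powr q" by simp
    also have "\<dots> \<le> 2 powr q * (u + v) powr q"
      using assms by (intro mult_right_mono powr_mono) auto
    finally have "c * (u powr q + v powr q) \<le> c * (2 powr q * (u + v) powr q)"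
      by (intro mult_left_mono) (auto simp: c_def)
    then show "c * (u powr q + v powr q) \<le> (2 * sqrt (2 * \<alpha>) * (u + v)) powr q"
      using assms by (simp add: c_def powr_mult mult_ac)
  qed
  finally show ?thesis .
qed

definition local_const :: "real \<Rightarrow> nat \<Rightarrow> real" where
  "local_const p d = 4 * 2 ^ d * (doob_const p powr (1 / p) + square_const p powr (1 / p))"

lemma doob_const_nonneg: "0 \<le> doob_const p"
  by (simp add: doob_const_def)

lemma square_const_nonneg: "0 \<le> square_const p"
  by (simp add: square_const_def doob_const_nonneg)

lemma local_const_nonneg: "0 \<le> local_const p d"
  by (simp add: local_const_def)

locale two_weights = dyadic_measure D \<sigma>
  for D :: "int \<Rightarrow> (real ^ 'n::finite) set set" and \<sigma> :: "(real ^ 'n) measure" +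
  fixes w :: "(real ^ 'n) measure" and b :: "(real ^ 'n) set \<Rightarrow> real"
  assumes sets_w [measurable_cong]: "sets w = sets borel"
begin

definition ratio :: "int \<Rightarrow> real ^ 'n \<Rightarrow> real" where
  "ratio k x = measure \<sigma> (cube k x) / vol (cube k x)"

lemma ratio_nonneg: "0 \<le> ratio k x"
  using vol_cube_pos[of k x] by (simp add: ratio_def)

lemma adapted_ratio: "adapted k (ratio k)"
  unfolding adapted_def ratio_def by simp

text \<open>
  The summand of generation \<open>k\<close> in the square function. It depends on the cube of generation \<open>k + 1\<close>.
\<close>

definition term_at :: "(real ^ 'n \<Rightarrow> real) \<Rightarrow> int \<Rightarrow> real ^ 'n \<Rightarrow> real" where
  "term_at f k x = b (cube k x) * Delta D \<sigma> f (cube k x) x"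

lemma adapted_term_at: "adapted (k + 1) (term_at f k)"
  unfolding adapted_def
proof (intro allI impI)
  fix x y assume e: "cube (k + 1) y = cube (k + 1) x"
  then have "cube k y = cube k x" by (rule cube_coarser) simp
  then show "term_at f k y = term_at f k x"
    using e unfolding term_at_def Delta_cube by simp
qed

lemma term_at_borel [measurable]: "term_at f k \<in> borel_measurable borel"
  by (rule adapted_measurable[OF adapted_term_at])

lemma sq_fun_eq: "sq_fun D b \<sigma> f x = esqrt (\<Sum>\<^sub>\<infinity>k. ennreal ((term_at f k x)\<^sup>2))"
  unfolding sq_fun_def term_at_def
  by (subst infsum_cubes_containing[of x]) (auto simp: Delta_outside)

lemma Delta_cond:
  assumes "loc_int k f" "loc_int (k + 1) f"
  shows "Delta D \<sigma> f (cube k x) x = cond (k + 1) f x * ratio (k + 1) x - cond k f x * ratio k x"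
  unfolding Delta_cube measure_mult_cond[OF assms(1), symmetric] measure_mult_cond[OF assms(2), symmetric]
  by (simp add: ratio_def mult.commute)

lemma sq_fun_from_windows:
  assumes "\<And>m N. moment w (q / 2) (\<lambda>x. \<Sum>i<N. (term_at f (m + int i) x)\<^sup>2) \<le> Y" "0 < q"
  shows "(\<integral>\<^sup>+ x. epowr (sq_fun D b \<sigma> f x) q \<partial>w) \<le> Y"
proof -
  define G where "G n x = (\<Sum>i<2 * n. ennreal ((term_at f (- int n + int i) x)\<^sup>2))" for n :: nat and x
  have G: "G n x = ennreal (\<Sum>i<2 * n. (term_at f (- int n + int i) x)\<^sup>2)" for n x
    unfolding G_def by (rule sum_ennreal) simp
  have [measurable]: "G n \<in> borel_measurable w" for n unfolding G_def by measurable
  have "incseq (\<lambda>n. G n x)" for x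
    unfolding G_def by (rule incseq_symmetric_window)
  then have "incseq (\<lambda>n. G n)" by (simp add: incseq_def le_fun_def)
  have "(\<integral>\<^sup>+ x. epowr (sq_fun D b \<sigma> f x) q \<partial>w) = (\<integral>\<^sup>+ x. epowr (SUP n. G n x) (q / 2) \<partial>w)"
    unfolding sq_fun_eq epowr_esqrt G_def infsum_int_SUP ..
  also have "\<dots> = (SUP n. \<integral>\<^sup>+ x. epowr (G n x) (q / 2) \<partial>w)"
    by (rule nn_integral_epowr_SUP) (use \<open>incseq (\<lambda>n. G n)\<close> assms in auto)
  also have "\<dots> \<le> Y"
  proof (rule SUP_least)
    fix n
    show "(\<integral>\<^sup>+ x. epowr (G n x) (q / 2) \<partial>w) \<le> Y"
      using assms(1)[of "- int n" "2 * n"] by (simp add: G sum_nonneg)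
  qed
  finally show ?thesis .
qed

text \<open>
  A family of coefficients on the generations \<open>m, \<dots>, m + N - 1\<close>, made from functions that are constant on
  the cubes of the corresponding generation; any point of the cube yields the value.
\<close>

definition coef :: "int \<Rightarrow> nat \<Rightarrow> (nat \<Rightarrow> real ^ 'n \<Rightarrow> real) \<Rightarrow> (real ^ 'n) set \<Rightarrow> real" where
  "coef m N H Q = (\<Sum>i<N. if Q \<in> D (m + int i) then H i (SOME x. x \<in> Q) else 0)"

lemma mem_D_cube_iff: "cube k x \<in> D j \<longleftrightarrow> j = k"
  using D_inj[OF cube_in, of k x j] cube_in[of k x] by auto

lemma coef_cube:
  assumes "\<And>i. i < N \<Longrightarrow> adapted (m + int i) (H i)"
  shows "coef m N H (cube k x) = (\<Sum>i<N. if k = m + int i then H i x else 0)"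
  unfolding coef_def
proof (rule sum.cong[OF refl])
  fix i assume "i \<in> {..<N}"
  have "(SOME y. y \<in> cube k x) \<in> cube k x" by (rule someI) (rule mem_cube)
  then have "H i (SOME y. y \<in> cube k x) = H i x" if "k = m + int i"
    using adaptedD[OF assms[of i], of "SOME y. y \<in> cube k x" x] \<open>i \<in> {..<N}\<close> that
    unfolding mem_cube_iff by simp
  then show "(if cube k x \<in> D (m + int i) then H i (SOME y. y \<in> cube k x) else 0)
      = (if k = m + int i then H i x else 0)"
    by (auto simp: mem_D_cube_iff)
qed

lemma coef_cube_in:
  assumes "\<And>i. i < N \<Longrightarrow> adapted (m + int i) (H i)" "i < N"
  shows "coef m N H (cube (m + int i) x) = H i x"
  by (subst coef_cube) (use assms in auto)

lemma coef_cube_out: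
  assumes "\<And>i. i < N \<Longrightarrow> adapted (m + int i) (H i)" "k \<notin> (\<lambda>i. m + int i) ` {..<N}"
  shows "coef m N H (cube k x) = 0"
  by (subst coef_cube) (use assms in \<open>auto intro!: sum.neutral\<close>)

lemma coeff_norm_coef_le:
  assumes H: "\<And>i. i < N \<Longrightarrow> adapted (m + int i) (H i)" and "0 < p" "0 \<le> R"
    and le: "moment \<sigma> (p / 2) (\<lambda>x. \<Sum>i<N. (H i x)\<^sup>2) \<le> ennreal (R powr p)"
  shows "coeff_norm D \<sigma> p (coef m N H) \<le> ennreal R"
proof -
  have "(\<Sum>\<^sub>\<infinity>Q\<in>cubes D. ennreal ((coef m N H Q)\<^sup>2 * indicator Q x)) = ennreal (\<Sum>i<N. (H i x)\<^sup>2)" for x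
  proof -
    have "(\<Sum>\<^sub>\<infinity>Q\<in>cubes D. ennreal ((coef m N H Q)\<^sup>2 * indicator Q x))
        = (\<Sum>\<^sub>\<infinity>k. ennreal ((coef m N H (cube k x))\<^sup>2 * indicator (cube k x) x))"
      by (rule infsum_cubes_containing) simp
    also have "\<dots> = (\<Sum>i<N. ennreal ((coef m N H (cube (m + int i) x))\<^sup>2 * indicator (cube (m + int i) x) x))"
      by (rule infsum_window) (simp add: coef_cube_out[OF H])
    also have "\<dots> = (\<Sum>i<N. ennreal ((H i x)\<^sup>2))"
      by (intro sum.cong) (simp_all add: coef_cube_in[OF H])
    also have "\<dots> = ennreal (\<Sum>i<N. (H i x)\<^sup>2)" by simp
    finally show ?thesis .
  qed
  then show ?thesis
    using le assms(2,3) unfolding coeff_norm_def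
    by (subst Lnorm_le_iff) (simp_all add: epowr_esqrt sum_nonneg)
qed

lemma quadratic_A_window:
  assumes A: "quadratic_A D b \<sigma> w p q C" and "0 \<le> C" "0 < p" "0 < q" "0 \<le> R"
    and H: "\<And>i. i < N \<Longrightarrow> adapted (m + int i) (H i)"
    and le: "moment \<sigma> (p / 2) (\<lambda>x. \<Sum>i<N. (H i x)\<^sup>2) \<le> ennreal (R powr p)"
  shows "moment w (q / 2) (\<lambda>x. \<Sum>i<N. (b (cube (m + int i) x) * ratio (m + int i) x * H i x)\<^sup>2)
           \<le> ennreal ((C * R) powr q)"
proof -
  define t where "t Q x = ennreal ((coef m N H Q * b Q * (measure \<sigma> Q / vol Q))\<^sup>2 * indicator Q x)" for Q x
  have "Lnorm w q (\<lambda>x. esqrt (\<Sum>\<^sub>\<infinity>Q\<in>cubes D. t Q x)) \<le> ennreal C * coeff_norm D \<sigma> p (coef m N H)"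
    using A unfolding quadratic_A_def t_def by blast
  also have "\<dots> \<le> ennreal C * ennreal R"
    by (intro mult_left_mono coeff_norm_coef_le assms) auto
  also have "\<dots> = ennreal (C * R)" using assms by (simp add: ennreal_mult)
  finally have main: "(\<integral>\<^sup>+ x. epowr (\<Sum>\<^sub>\<infinity>Q\<in>cubes D. t Q x) (q / 2) \<partial>w) \<le> ennreal ((C * R) powr q)"
    using assms by (subst (asm) Lnorm_le_iff) (simp_all add: epowr_esqrt)
  have "ennreal ((\<Sum>i<N. (b (cube (m + int i) x) * ratio (m + int i) x * H i x)\<^sup>2) powr (q / 2))
      \<le> epowr (\<Sum>\<^sub>\<infinity>Q\<in>cubes D. t Q x) (q / 2)" for x
  proof -
    have "ennreal (\<Sum>i<N. (b (cube (m + int i) x) * ratio (m + int i) x * H i x)\<^sup>2)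
        = (\<Sum>i<N. t (cube (m + int i) x) x)"
      by (subst sum_ennreal[symmetric])
         (auto simp: t_def coef_cube_in[OF H] ratio_def mult_ac intro!: sum.cong)
    also have "\<dots> \<le> (\<Sum>\<^sub>\<infinity>k. t (cube k x) x)"
      by (rule sum_window_le_infsum)
    also have "\<dots> = (\<Sum>\<^sub>\<infinity>Q\<in>cubes D. t Q x)"
      by (rule infsum_cubes_containing[symmetric]) (simp add: t_def)
    finally have "epowr (ennreal (\<Sum>i<N. (b (cube (m + int i) x) * ratio (m + int i) x * H i x)\<^sup>2)) (q / 2)
        \<le> epowr (\<Sum>\<^sub>\<infinity>Q\<in>cubes D. t Q x) (q / 2)"
      using assms by (intro epowr_mono) auto
    then show ?thesis by (simp add: sum_nonneg)
  qed
  then show ?thesis by (intro order_trans[OF nn_integral_mono main])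
qed

lemma set_integral_cube_indicator:
  assumes "j \<le> k"
  shows "(LINT y:cube k x|\<sigma>. a * indicator (cube j x) y) = a * measure \<sigma> (cube k x)"
  unfolding set_integral_indicator_Int[OF cube_sets cube_sets finite_cube]
  using cube_antimono[OF assms, of x] by (simp add: Int_absorb2)

lemma term_at_indicator_coarser:
  assumes "j \<le> k"
  shows "term_at (\<lambda>y. a * indicator (cube j x) y) k x
           = b (cube k x) * (a * (ratio (k + 1) x - ratio k x))"
proof -
  have "j \<le> k + 1" using assms by simp
  then show ?thesis
    unfolding term_at_def Delta_cube set_integral_cube_indicator[OF assms]
      set_integral_cube_indicator[OF \<open>j \<le> k + 1\<close>]
    by (simp add: ratio_def algebra_simps)
qed

text \<open>
  Local testing, read at a point: a cube of the window is tested by itself and by all coarser cubes of the window, so its term is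
  multiplied by the sum of the squares of their coefficients.
\<close>

lemma local_testing_window:
  assumes L: "local_testing D b \<sigma> w p q C" and "0 \<le> C" "0 < p" "0 < q" "0 \<le> R"
    and H: "\<And>i. i < N \<Longrightarrow> adapted (m + int i) (H i)"
    and le: "moment \<sigma> (p / 2) (\<lambda>x. \<Sum>i<N. (H i x)\<^sup>2) \<le> ennreal (R powr p)"
  shows "moment w (q / 2) (\<lambda>x. \<Sum>j<N. (b (cube (m + int j) x) * (ratio (m + int j + 1) x - ratio (m + int j) x))\<^sup>2
             * (\<Sum>i\<le>j. (H i x)\<^sup>2)) \<le> ennreal ((C * R) powr q)"
proof -
  define a where "a = coef m N H"
  define L where "L Q x = (local_sq_fun D b \<sigma> Q (\<lambda>y. a Q * indicator Q y) x)\<^sup>2" for Q x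
  have "Lnorm w q (\<lambda>x. esqrt (\<Sum>\<^sub>\<infinity>Q\<in>cubes D. L Q x)) \<le> ennreal C * coeff_norm D \<sigma> p a"
    using assms(1) unfolding local_testing_def L_def by blast
  also have "\<dots> \<le> ennreal C * ennreal R"
    unfolding a_def by (intro mult_left_mono coeff_norm_coef_le assms) auto
  also have "\<dots> = ennreal (C * R)" using assms by (simp add: ennreal_mult)
  finally have main: "(\<integral>\<^sup>+ x. epowr (\<Sum>\<^sub>\<infinity>Q\<in>cubes D. L Q x) (q / 2) \<partial>w) \<le> ennreal ((C * R) powr q)"
    using assms by (subst (asm) Lnorm_le_iff) (simp_all add: epowr_esqrt)
  have "ennreal ((\<Sum>j<N. (b (cube (m + int j) x) * (ratio (m + int j + 1) x - ratio (m + int j) x))\<^sup>2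
             * (\<Sum>i\<le>j. (H i x)\<^sup>2)) powr (q / 2)) \<le> epowr (\<Sum>\<^sub>\<infinity>Q\<in>cubes D. L Q x) (q / 2)" for x
  proof -
    define \<beta> where "\<beta> j = b (cube (m + int j) x) * (ratio (m + int j + 1) x - ratio (m + int j) x)" for j
    have inner: "(\<Sum>j\<in>{i..<N}. ennreal ((H i x)\<^sup>2 * (\<beta> j)\<^sup>2)) \<le> L (cube (m + int i) x) x" if "i < N" for i
    proof -
      define P where "P = cube (m + int i) x"
      define h where "h = (\<lambda>y. a P * indicator P y)"
      have aP: "a P = H i x" unfolding a_def P_def by (rule coef_cube_in[OF H that])
      have inj: "inj_on (\<lambda>j. cube (m + int j) x) {i..<N}"
        by (auto simp: inj_on_def dest: cube_gen_inj)
      have "(\<Sum>j\<in>{i..<N}. ennreal ((H i x)\<^sup>2 * (\<beta> j)\<^sup>2))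
          = (\<Sum>j\<in>{i..<N}. ennreal ((term_at h (m + int j) x)\<^sup>2))"
      proof (rule sum.cong[OF refl])
        fix j assume "j \<in> {i..<N}"
        then have "term_at h (m + int j) x = H i x * \<beta> j"
          unfolding h_def aP unfolding P_def
          by (subst term_at_indicator_coarser) (auto simp: \<beta>_def)
        then show "ennreal ((H i x)\<^sup>2 * (\<beta> j)\<^sup>2) = ennreal ((term_at h (m + int j) x)\<^sup>2)"
          by (simp add: power_mult_distrib)
      qed
      also have "\<dots> = (\<Sum>Q\<in>(\<lambda>j. cube (m + int j) x) ` {i..<N}. ennreal ((b Q * Delta D \<sigma> h Q x)\<^sup>2))"
        by (simp add: sum.reindex[OF inj] term_at_def)
      also have "\<dots> \<le> (\<Sum>\<^sub>\<infinity>Q\<in>{Q \<in> cubes D. Q \<subseteq> P}. ennreal ((b Q * Delta D \<sigma> h Q x)\<^sup>2))"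
      proof (rule sum_le_infsum_ennreal)
        show "(\<lambda>j. cube (m + int j) x) ` {i..<N} \<subseteq> {Q \<in> cubes D. Q \<subseteq> P}"
        proof clarify
          fix j assume "j \<in> {i..<N}"
          then have "cube (m + int j) x \<subseteq> cube (m + int i) x" by (intro cube_antimono) simp
          then show "cube (m + int j) x \<in> cubes D \<and> cube (m + int j) x \<subseteq> P"
            by (simp add: P_def)
        qed
      qed simp
      also have "\<dots> = L P x" by (simp add: L_def h_def local_sq_fun_def)
      finally show ?thesis by (simp add: P_def)
    qed
    have inj: "inj_on (\<lambda>i. cube (m + int i) x) {..<N}"
      by (auto simp: inj_on_def dest: cube_gen_inj)
    have "(\<Sum>j<N. (\<beta> j)\<^sup>2 * (\<Sum>i\<le>j. (H i x)\<^sup>2)) = (\<Sum>i<N. \<Sum>j\<in>{i..<N}. (H i x)\<^sup>2 * (\<beta> j)\<^sup>2)"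
      unfolding sum_triangle by (simp add: sum_distrib_left mult.commute)
    also have "ennreal \<dots> = (\<Sum>i<N. \<Sum>j\<in>{i..<N}. ennreal ((H i x)\<^sup>2 * (\<beta> j)\<^sup>2))"
      by (simp add: sum_nonneg)
    also have "\<dots> \<le> (\<Sum>i<N. L (cube (m + int i) x) x)"
      by (intro sum_mono inner) simp
    also have "\<dots> = (\<Sum>Q\<in>(\<lambda>i. cube (m + int i) x) ` {..<N}. L Q x)"
      by (simp add: sum.reindex[OF inj])
    also have "\<dots> \<le> (\<Sum>\<^sub>\<infinity>Q\<in>cubes D. L Q x)"
      by (rule sum_le_infsum_ennreal) auto
    finally have "epowr (ennreal (\<Sum>j<N. (\<beta> j)\<^sup>2 * (\<Sum>i\<le>j. (H i x)\<^sup>2))) (q / 2)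
        \<le> epowr (\<Sum>\<^sub>\<infinity>Q\<in>cubes D. L Q x) (q / 2)"
      using assms by (intro epowr_mono) auto
    then show ?thesis by (simp add: sum_nonneg \<beta>_def)
  qed
  then show ?thesis by (intro order_trans[OF nn_integral_mono main])
qed

lemma measure_child_mult_le:
  assumes g: "adapted (k + 1) g" "\<And>x. 0 \<le> g x"
  shows "measure \<sigma> (cube (k + 1) x) * g x \<le> measure \<sigma> (cube k x) * cond k g x"
proof -
  define h :: "real ^ 'n \<Rightarrow> real" where "h z = g x * indicator (cube (k + 1) x) z" for z
  have adh: "adapted (k + 1) h"
    unfolding adapted_def h_def by (simp add: indicator_def mem_cube_iff)
  have lh: "loc_int k h" and lg: "loc_int k g"
    using adh g(1) by (auto intro: adapted_Suc_loc_int)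
  have hg: "h z \<le> g z" for z
  proof (cases "z \<in> cube (k + 1) x")
    case True
    then have "g z = g x" unfolding mem_cube_iff by (rule adaptedD[OF g(1)])
    then show ?thesis using True by (simp add: h_def)
  qed (simp add: h_def g)
  have "measure \<sigma> (cube (k + 1) x) * g x = (LINT z:cube k x|\<sigma>. h z)"
  proof -
    have "indicator (cube k x) z *\<^sub>R h z = g x * indicator (cube (k + 1) x) z" for z
      using cube_Suc_subset[of k x] by (auto simp: h_def indicator_def)
    then show ?thesis
      using finite_cube[of "k + 1" x]
      by (simp add: set_lebesgue_integral_def less_top)
  qed
  also have "\<dots> = measure \<sigma> (cube k x) * cond k h x"
    by (rule measure_mult_cond[OF lh, symmetric])
  also have "\<dots> \<le> measure \<sigma> (cube k x) * cond k g x"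
    by (intro mult_left_mono cond_mono lh lg hg) auto
  finally show ?thesis .
qed

text \<open>
  The increment is weighted by the measure of the child; the integral of its modulus over the
  parent is larger.
\<close>

lemma increment_ratio_le:
  "\<bar>cond (k + 1) f x - cond k f x\<bar> * ratio (k + 1) x \<le> 2 ^ CARD('n) * (dev k f x * ratio k x)"
proof -
  have ad: "adapted (k + 1) (\<lambda>z. \<bar>cond (k + 1) f z - cond k f z\<bar>)"
    by (rule adapted_comp2[OF adapted_cond adapted_mono[OF adapted_cond]]) simp
  have "measure \<sigma> (cube (k + 1) x) * \<bar>cond (k + 1) f x - cond k f x\<bar> \<le> measure \<sigma> (cube k x) * dev k f x"
    unfolding dev_def by (rule measure_child_mult_le[OF ad]) simp
  then have "measure \<sigma> (cube (k + 1) x) * \<bar>cond (k + 1) f x - cond k f x\<bar> / vol (cube (k + 1) x)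
      \<le> measure \<sigma> (cube k x) * dev k f x / vol (cube (k + 1) x)"
    using vol_cube_pos[of "k + 1" x] by (intro divide_right_mono) auto
  also have "\<dots> = 2 ^ CARD('n) * (dev k f x * ratio k x)"
    using vol_cube_pos[of "k + 1" x] by (simp add: ratio_def vol_cube_Suc[of k x])
  finally show ?thesis by (simp add: ratio_def mult.commute)
qed

lemma term_at_square_le:
  assumes "loc_int k f" "loc_int (k + 1) f"
  shows "(term_at f k x)\<^sup>2 \<le> 2 * 4 ^ CARD('n) *
           ((b (cube k x) * (ratio (k + 1) x - ratio k x))\<^sup>2 * (cond k f x)\<^sup>2
             + (b (cube k x) * ratio k x * dev k f x)\<^sup>2)"
proof -
  define u where "u = b (cube k x) * (ratio (k + 1) x - ratio k x) * cond k f x"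
  define v where "v = b (cube k x) * ((cond (k + 1) f x - cond k f x) * ratio (k + 1) x)"
  define v' where "v' = b (cube k x) * ratio k x * dev k f x"
  have one: "(1::real) \<le> 4 ^ CARD('n)" by simp
  have "\<bar>v\<bar> = \<bar>b (cube k x)\<bar> * (\<bar>cond (k + 1) f x - cond k f x\<bar> * ratio (k + 1) x)"
    using ratio_nonneg by (simp add: v_def abs_mult)
  also have "\<dots> \<le> \<bar>b (cube k x)\<bar> * (2 ^ CARD('n) * (dev k f x * ratio k x))"
    by (intro mult_left_mono increment_ratio_le) auto
  also have "\<dots> = \<bar>2 ^ CARD('n) * v'\<bar>"
    using ratio_nonneg dev_nonneg by (simp add: v'_def abs_mult)
  finally have "v\<^sup>2 \<le> (2 ^ CARD('n) * v')\<^sup>2" by (simp only: abs_le_square_iff)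
  also have "\<dots> = 4 ^ CARD('n) * v'\<^sup>2"
    by (simp add: power_mult_distrib power_mult[symmetric] mult.commute[of _ 2]) (simp add: power_mult)
  finally have v: "v\<^sup>2 \<le> 4 ^ CARD('n) * v'\<^sup>2" .
  have "term_at f k x = u + v"
    unfolding term_at_def Delta_cond[OF assms] u_def v_def by (simp add: algebra_simps)
  then have "(term_at f k x)\<^sup>2 \<le> 2 * (u\<^sup>2 + v\<^sup>2)"
    using sum_squares_bound[of u v] by (simp add: power2_sum)
  also have "\<dots> \<le> 2 * (4 ^ CARD('n) * u\<^sup>2 + 4 ^ CARD('n) * v'\<^sup>2)"
    using v mult_right_mono[OF one, of "u\<^sup>2"] by simp
  also have "\<dots> = 2 * 4 ^ CARD('n) * (u\<^sup>2 + v'\<^sup>2)" by (simp add: algebra_simps)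
  also have "u\<^sup>2 = (b (cube k x) * (ratio (k + 1) x - ratio k x))\<^sup>2 * (cond k f x)\<^sup>2"
    by (simp add: u_def power_mult_distrib)
  finally show ?thesis by (simp only: v'_def)
qed

text \<open>
  The coefficients for local testing: square roots of the increments of the squared maximal function.
\<close>

lemma runmax_as_square_sum:
  assumes "\<And>x. 0 \<le> f x"
  shows "\<exists>H. (\<forall>i. adapted (m + int i) (H i)) \<and> (\<forall>j x. (\<Sum>i\<le>j. (H i x)\<^sup>2) = (runmax m f j x)\<^sup>2)"
proof -
  define H where "H i x = (case i of 0 \<Rightarrow> runmax m f 0 x
      | Suc j \<Rightarrow> sqrt ((runmax m f i x)\<^sup>2 - (runmax m f j x)\<^sup>2))" for i x
  have "adapted (m + int i) (H i)" for i
  proof (cases i)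
    case 0
    then show ?thesis using adapted_runmax[of m 0 f] by (simp add: H_def[abs_def])
  next
    case (Suc j)
    have "adapted (m + int i) (runmax m f j)"
      by (rule adapted_mono[OF adapted_runmax]) (simp add: Suc)
    from adapted_comp2[OF adapted_runmax this, of "\<lambda>u v. sqrt (u\<^sup>2 - v\<^sup>2)"]
    show ?thesis by (simp add: H_def[abs_def] Suc)
  qed
  moreover have "(\<Sum>i\<le>j. (H i x)\<^sup>2) = (runmax m f j x)\<^sup>2" for j x
  proof (induction j)
    case (Suc j)
    have "(runmax m f j x)\<^sup>2 \<le> (runmax m f (Suc j) x)\<^sup>2"
      by (intro power_mono runmax_mono runmax_nonneg assms) simp
    then have "(H (Suc j) x)\<^sup>2 = (runmax m f (Suc j) x)\<^sup>2 - (runmax m f j x)\<^sup>2"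
      by (simp add: H_def del: runmax.simps)
    then show ?case using Suc by simp
  qed (simp add: H_def)
  ultimately show ?thesis by blast
qed

lemma window_bound_nonneg:
  assumes L: "local_testing D b \<sigma> w p q C\<^sub>1" and A: "quadratic_A D b \<sigma> w p q C\<^sub>2"
    and C: "0 \<le> C\<^sub>1" "0 \<le> C\<^sub>2" and p: "1 < p" and q: "1 < q" and R: "0 \<le> R"
    and f: "f \<in> borel_measurable borel" "\<And>x. 0 \<le> f x"
    and fR: "moment \<sigma> p f \<le> ennreal (R powr p)"
  shows "moment w (q / 2) (\<lambda>x. \<Sum>i<N. (term_at f (m + int i) x)\<^sup>2)
           \<le> ennreal ((local_const p CARD('n) * (C\<^sub>1 + C\<^sub>2) * R) powr q)"
proof -
  have fin: "moment \<sigma> p f < \<infinity>" using fR by (rule order.strict_trans1) simp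
  have li: "loc_int k f" for k by (rule loc_int_of_Lp[OF f _ fin]) (use p in auto)
  have E0: "0 \<le> cond k f x" for k x by (rule cond_nonneg) (rule f)
  define cD where "cD = doob_const p powr (1 / p)"
  define cS where "cS = square_const p powr (1 / p)"
  have c0: "0 \<le> cD" "0 \<le> cS" by (auto simp: cD_def cS_def)
  have cDp: "(cD * R) powr p = doob_const p * R powr p" and cSp: "(cS * R) powr p = square_const p * R powr p"
    using p R by (auto simp: cD_def cS_def powr_mult powr_powr doob_const_nonneg square_const_nonneg)
  obtain H where H: "\<And>i. adapted (m + int i) (H i)" "\<And>j x. (\<Sum>i\<le>j. (H i x)\<^sup>2) = (runmax m f j x)\<^sup>2"
    using runmax_as_square_sum[of f m, OF f(2)] by blast
  define X where "X x = (\<Sum>j<N. (b (cube (m + int j) x) * (ratio (m + int j + 1) x - ratio (m + int j) x))\<^sup>2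
             * (\<Sum>i\<le>j. (H i x)\<^sup>2))" for x
  define Y where "Y x = (\<Sum>i<N. (b (cube (m + int i) x) * ratio (m + int i) x * dev (m + int i) f x)\<^sup>2)" for x
  have bm [measurable]: "(\<lambda>x. b (cube k x)) \<in> borel_measurable borel" for k
    by (rule adapted_measurable[OF adapted_cube])
  have [measurable]: "ratio k \<in> borel_measurable borel" for k
    by (rule adapted_measurable[OF adapted_ratio])
  have [measurable]: "H i \<in> borel_measurable borel" for i
    by (rule adapted_measurable[OF H(1)])
  have [measurable]: "X \<in> borel_measurable w" "Y \<in> borel_measurable w"
    unfolding X_def Y_def by measurable
  have XI: "moment w (q / 2) X \<le> ennreal ((C\<^sub>1 * (cD * R)) powr q)"
    unfolding X_def
  proof (rule local_testing_window[OF L C(1)])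
    show "moment \<sigma> (p / 2) (\<lambda>x. \<Sum>i<N. (H i x)\<^sup>2) \<le> ennreal ((cD * R) powr p)"
    proof (cases N)
      case (Suc M)
      have "(\<Sum>i<N. (H i x)\<^sup>2) powr (p / 2) = runmax m f M x powr p" for x
        unfolding Suc lessThan_Suc_atMost H(2)
        using runmax_nonneg[of f m M x, OF f(2)]
        by (cases "runmax m f M x = 0") (auto simp: powr_powr simp flip: powr_numeral)
      then have "moment \<sigma> (p / 2) (\<lambda>x. \<Sum>i<N. (H i x)\<^sup>2)
          = moment \<sigma> p (runmax m f M)" by simp
      also have "\<dots> \<le> ennreal (doob_const p) * moment \<sigma> p f"
        by (rule maximal_ineq(1)[OF f fin p])
      also have "\<dots> \<le> ennreal (doob_const p) * ennreal (R powr p)"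
        by (intro mult_left_mono fR) simp
      also have "\<dots> = ennreal ((cD * R) powr p)"
        by (simp add: cDp ennreal_mult doob_const_nonneg)
      finally show ?thesis .
    qed simp
  qed (use p q R c0 H(1) in auto)
  have YI: "moment w (q / 2) Y \<le> ennreal ((C\<^sub>2 * (cS * R)) powr q)"
    unfolding Y_def
  proof (rule quadratic_A_window[OF A C(2)])
    have "moment \<sigma> (p / 2) (\<lambda>x. \<Sum>i<N. (dev (m + int i) f x)\<^sup>2)
        \<le> ennreal (square_const p) * moment \<sigma> p f"
      by (rule square_ineq[OF f fin p])
    also have "\<dots> \<le> ennreal (square_const p) * ennreal (R powr p)"
      by (intro mult_left_mono fR) simp
    also have "\<dots> = ennreal ((cS * R) powr p)"
      by (simp add: cSp ennreal_mult square_const_nonneg)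
    finally show "moment \<sigma> (p / 2) (\<lambda>x. \<Sum>i<N. (dev (m + int i) f x)\<^sup>2)
        \<le> ennreal ((cS * R) powr p)" .
  qed (use p q R c0 adapted_dev in auto)
  have pw: "(\<Sum>i<N. (term_at f (m + int i) x)\<^sup>2) \<le> 2 * 4 ^ CARD('n) * (X x + Y x)" for x
  proof -
    define A where "A i = (b (cube (m + int i) x) * (ratio (m + int i + 1) x - ratio (m + int i) x))\<^sup>2" for i
    define S where "S i = (\<Sum>j\<le>i. (H j x)\<^sup>2)" for i
    define B where "B i = (b (cube (m + int i) x) * ratio (m + int i) x * dev (m + int i) f x)\<^sup>2" for i
    have XY: "X x + Y x = (\<Sum>i<N. A i * S i + B i)"
      unfolding X_def Y_def A_def B_def S_def sum.distrib ..
    show ?thesis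
      unfolding XY sum_distrib_left
    proof (rule sum_mono)
      fix i
      have "(cond (m + int i) f x)\<^sup>2 \<le> S i"
        unfolding S_def H(2) using cond_le_runmax E0 by (intro power_mono) auto
      then have "A i * (cond (m + int i) f x)\<^sup>2 + B i \<le> A i * S i + B i"
        by (intro add_right_mono mult_left_mono) (auto simp: A_def)
      then have "2 * 4 ^ CARD('n) * (A i * (cond (m + int i) f x)\<^sup>2 + B i)
          \<le> 2 * 4 ^ CARD('n) * (A i * S i + B i)"
        by (rule mult_left_mono) simp
      with term_at_square_le[OF li li, of "m + int i" x]
      show "(term_at f (m + int i) x)\<^sup>2 \<le> 2 * 4 ^ CARD('n) * (A i * S i + B i)"
        unfolding A_def B_def by (rule order_trans)
    qed
  qed
  have "moment w (q / 2) (\<lambda>x. \<Sum>i<N. (term_at f (m + int i) x)\<^sup>2)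
      \<le> ennreal ((2 * sqrt (2 * (2 * 4 ^ CARD('n))) * (C\<^sub>1 * (cD * R) + C\<^sub>2 * (cS * R))) powr q)"
  proof (rule nn_integral_powr_combine[OF _ _ _ _ _ pw])
    show "0 \<le> X x" "0 \<le> Y x" for x
      by (auto simp: X_def Y_def intro!: sum_nonneg mult_nonneg_nonneg)
  qed (use XI YI q C R c0 in \<open>auto intro!: sum_nonneg\<close>)
  also have "\<dots> \<le> ennreal ((local_const p CARD('n) * (C\<^sub>1 + C\<^sub>2) * R) powr q)"
  proof (intro ennreal_leI powr_mono2)
    have "(2 * 2 ^ CARD('n))\<^sup>2 = 2 * (2 * (4::real) ^ CARD('n))"
      using power_mult_distrib[of "2::real" 2 "CARD('n)"] by (simp add: power2_eq_square)
    then have s: "sqrt (2 * (2 * 4 ^ CARD('n))) = 2 * 2 ^ CARD('n)"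
      by (rule real_sqrt_unique) simp
    have "C\<^sub>1 * (cD * R) + C\<^sub>2 * (cS * R) \<le> (cD + cS) * (C\<^sub>1 + C\<^sub>2) * R"
      using C R c0 by (simp add: algebra_simps)
    then show "2 * sqrt (2 * (2 * 4 ^ CARD('n))) * (C\<^sub>1 * (cD * R) + C\<^sub>2 * (cS * R))
        \<le> local_const p CARD('n) * (C\<^sub>1 + C\<^sub>2) * R"
      unfolding s local_const_def cD_def[symmetric] cS_def[symmetric] by (simp add: mult.assoc)
  qed (use q C R c0 in auto)
  finally show ?thesis .
qed

text \<open>
  The general case reduces to positive and negative parts, \<open>g 1\<close> and \<open>g (-1)\<close> below.
\<close>

lemma two_weight_from_local:
  assumes L: "local_testing D b \<sigma> w p q C\<^sub>1" and A: "quadratic_A D b \<sigma> w p q C\<^sub>2"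
    and C: "0 \<le> C\<^sub>1" "0 \<le> C\<^sub>2" and p: "1 < p" and q: "1 < q"
  shows "two_weight_ineq D b \<sigma> w p q (8 * local_const p CARD('n) * (C\<^sub>1 + C\<^sub>2))"
  unfolding two_weight_ineq_def
proof
  fix f assume f: "f \<in> Lspace \<sigma> p"
  then have [measurable]: "f \<in> borel_measurable borel"
    by (simp add: Lspace_def borel_measurable_iff)
  define K where "K = local_const p CARD('n) * (C\<^sub>1 + C\<^sub>2)"
  have K: "0 \<le> K" using C by (simp add: K_def local_const_nonneg)
  obtain R where R: "0 \<le> R" "Lnorm \<sigma> p (\<lambda>x. ennreal \<bar>f x\<bar>) = ennreal R"
    using f by (cases "Lnorm \<sigma> p (\<lambda>x. ennreal \<bar>f x\<bar>)") (auto simp: Lspace_def)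
  have fR: "moment \<sigma> p (\<lambda>x. \<bar>f x\<bar>) \<le> ennreal (R powr p)"
    using R p Lnorm_le_iff[of p \<sigma> "\<lambda>x. ennreal \<bar>f x\<bar>" "ennreal R"] by simp
  define g where "g s x = max (s * f x) 0" for s :: real and x
  have [measurable]: "g s \<in> borel_measurable borel" for s unfolding g_def by measurable
  have g0: "0 \<le> g s x" for s x by (simp add: g_def)
  have gR: "moment \<sigma> p (g s) \<le> ennreal (R powr p)" if "\<bar>s\<bar> = 1" for s
  proof (rule order_trans[OF nn_integral_mono fR])
    fix x
    have "\<bar>s * f x\<bar> = \<bar>f x\<bar>" using that by (simp add: abs_mult)
    then have "g s x \<le> \<bar>f x\<bar>" by (simp add: g_def)
    then show "ennreal (g s x powr p) \<le> ennreal (\<bar>f x\<bar> powr p)"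
      using p g0 by (intro ennreal_leI powr_mono2) auto
  qed
  have gli: "loc_int k (g s)" if "\<bar>s\<bar> = 1" for k s
    by (rule loc_int_of_Lp[OF _ g0 _ order.strict_trans1[OF gR[OF that]]]) (use p in auto)
  have f_eq: "f = (\<lambda>x. g 1 x + (-1) * g (-1) x)" by (auto simp: g_def)
  have split: "term_at f k x = term_at (g 1) k x - term_at (g (-1)) k x" for k x
  proof -
    have fli: "loc_int j f" for j
      unfolding f_eq by (intro loc_int_add loc_int_cmult gli) auto
    have gp: "loc_int j (g 1)" and gm: "loc_int j (g (-1))" for j
      by (intro gli; simp)+
    have diff: "cond j f y = cond j (g 1) y - cond j (g (-1)) y" for j y
      by (subst f_eq, subst cond_add, (intro loc_int_cmult gli, simp)+) (simp only: cond_cmult)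
    show ?thesis
      unfolding term_at_def Delta_cond[OF fli fli] Delta_cond[OF gp gp] Delta_cond[OF gm gm] diff
      by (simp add: algebra_simps)
  qed
  have win: "moment w (q / 2) (\<lambda>x. \<Sum>i<N. (term_at (g s) (m + int i) x)\<^sup>2)
           \<le> ennreal ((K * R) powr q)" if "\<bar>s\<bar> = 1" for m N s
    unfolding K_def by (rule window_bound_nonneg[OF L A C p q R(1) _ g0 gR[OF that]]) simp
  have "(\<integral>\<^sup>+ x. epowr (sq_fun D b \<sigma> f x) q \<partial>w) \<le> ennreal ((8 * K * R) powr q)"
  proof (rule sq_fun_from_windows)
    fix m :: int and N :: nat
    have "moment w (q / 2) (\<lambda>x. \<Sum>i<N. (term_at f (m + int i) x)\<^sup>2)
        \<le> ennreal ((2 * sqrt (2 * 2) * (K * R + K * R)) powr q)"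
    proof (rule nn_integral_powr_combine)
      fix x
      show "(\<Sum>i<N. (term_at f (m + int i) x)\<^sup>2) \<le> 2 * ((\<Sum>i<N. (term_at (g 1) (m + int i) x)\<^sup>2)
          + (\<Sum>i<N. (term_at (g (-1)) (m + int i) x)\<^sup>2))"
        unfolding sum.distrib[symmetric] sum_distrib_left
      proof (rule sum_mono)
        fix i
        show "(term_at f (m + int i) x)\<^sup>2 \<le> 2 * ((term_at (g 1) (m + int i) x)\<^sup>2 + (term_at (g (-1)) (m + int i) x)\<^sup>2)"
          unfolding split
          using zero_le_power2[of "term_at (g 1) (m + int i) x + term_at (g (-1)) (m + int i) x"]
          by (simp add: power2_sum power2_diff)
      qed
    qed (use win[of 1] win[of "-1"] q K R in \<open>auto intro!: sum_nonneg\<close>)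
    also have "2 * sqrt (2 * 2) * (K * R + K * R) = 8 * K * R" by simp
    finally show "moment w (q / 2) (\<lambda>x. \<Sum>i<N. (term_at f (m + int i) x)\<^sup>2)
        \<le> ennreal ((8 * K * R) powr q)" .
  qed (use q in auto)
  then have "Lnorm w q (sq_fun D b \<sigma> f) \<le> ennreal (8 * K * R)"
    using q K R by (subst Lnorm_le_iff) auto
  also have "\<dots> = ennreal (8 * local_const p CARD('n) * (C\<^sub>1 + C\<^sub>2)) * Lnorm \<sigma> p (\<lambda>x. ennreal \<bar>f x\<bar>)"
    unfolding R(2) using K R by (subst ennreal_mult[symmetric]) (auto simp: K_def mult.assoc)
  finally show "Lnorm w q (sq_fun D b \<sigma> f)
      \<le> ennreal (8 * local_const p CARD('n) * (C\<^sub>1 + C\<^sub>2)) * Lnorm \<sigma> p (\<lambda>x. ennreal \<bar>f x\<bar>)" .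
qed

section \<open>From the two weight inequality to global testing\<close>

lemma cond_sum_cmult:
  assumes "finite F" "\<And>Q. Q \<in> F \<Longrightarrow> loc_int k (g Q)"
  shows "cond k (\<lambda>y. \<Sum>Q\<in>F. c Q * g Q y) x = (\<Sum>Q\<in>F. c Q * cond k (g Q) x)"
    and "loc_int k (\<lambda>y. \<Sum>Q\<in>F. c Q * g Q y)"
proof -
  have "cond k (\<lambda>y. \<Sum>Q\<in>F. c Q * g Q y) x = (\<Sum>Q\<in>F. c Q * cond k (g Q) x)
      \<and> loc_int k (\<lambda>y. \<Sum>Q\<in>F. c Q * g Q y)"
    using assms
  proof (induction F rule: finite_induct)
    case empty
    then show ?case using cond_cmult[of k 0 "\<lambda>_. 0" x] loc_int_const[of k 0] by simp
  next
    case (insert Q F)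
    have IH: "cond k (\<lambda>y. \<Sum>Q\<in>F. c Q * g Q y) x = (\<Sum>Q\<in>F. c Q * cond k (g Q) x)"
      "loc_int k (\<lambda>y. \<Sum>Q\<in>F. c Q * g Q y)"
      using insert.IH insert.prems by auto
    have Q: "loc_int k (\<lambda>y. c Q * g Q y)" by (intro loc_int_cmult insert.prems) simp
    show ?case
      using insert.hyps cond_add[OF Q IH(2)] loc_int_add[OF Q IH(2)] by (simp add: IH(1) cond_cmult)
  qed
  then show "cond k (\<lambda>y. \<Sum>Q\<in>F. c Q * g Q y) x = (\<Sum>Q\<in>F. c Q * cond k (g Q) x)"
    "loc_int k (\<lambda>y. \<Sum>Q\<in>F. c Q * g Q y)" by auto
qed

lemma term_at_signed_sum:
  assumes "finite F" "\<And>Q k. Q \<in> F \<Longrightarrow> loc_int k (g Q)"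
  shows "term_at (\<lambda>y. signed_sum F (\<lambda>Q. g Q y) A) k x = signed_sum F (\<lambda>Q. term_at (g Q) k x) A"
proof -
  have c: "cond j (\<lambda>y. \<Sum>Q\<in>F. sgn_of A Q * g Q y) x = (\<Sum>Q\<in>F. sgn_of A Q * cond j (g Q) x)"
    and l: "loc_int j (\<lambda>y. \<Sum>Q\<in>F. sgn_of A Q * g Q y)" for j
    using cond_sum_cmult[OF assms(1), where g = g and k = j and c = "sgn_of A"] assms(2) by auto
  have "(\<Sum>Q\<in>F. sgn_of A Q * term_at (g Q) k x)
      = (\<Sum>Q\<in>F. sgn_of A Q * (b (cube k x) * (cond (k + 1) (g Q) x * ratio (k + 1) x - cond k (g Q) x * ratio k x)))"
    by (intro sum.cong refl) (simp add: term_at_def Delta_cond assms(2))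
  also have "\<dots> = b (cube k x) * ((\<Sum>Q\<in>F. sgn_of A Q * cond (k + 1) (g Q) x) * ratio (k + 1) x
      - (\<Sum>Q\<in>F. sgn_of A Q * cond k (g Q) x) * ratio k x)"
    by (simp add: sum_distrib_left sum_distrib_right sum_subtractf algebra_simps)
  finally show ?thesis
    unfolding signed_sum_def term_at_def Delta_cond[OF l l] c by simp
qed

text \<open>
  The random sums \<open>h A\<close> of the functions \<open>a\<^sub>Q 1\<^sub>Q\<close> are admissible in the two weight inequality, and their square
  functions average, by linearity, to the vector valued one. The norms of the \<open>h A\<close> are averaged with Jensen's
  inequality and Khintchine's inequality at each point.
\<close>

lemma global_window:
  assumes T: "two_weight_ineq D b \<sigma> w p q C" and "0 \<le> C" and p: "1 < p" and q: "1 < q" and "0 \<le> R"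
    and F: "finite F" "F \<subseteq> cubes D"
    and le: "moment \<sigma> (p / 2) (\<lambda>x. \<Sum>Q\<in>F. (a Q * indicator Q x)\<^sup>2) \<le> ennreal (R powr p)"
  shows "moment w (q / 2) (\<lambda>x. \<Sum>Q\<in>F. \<Sum>i<N. (term_at (\<lambda>y. a Q * indicator Q y) (m + int i) x)\<^sup>2)
           \<le> ennreal ((5 * khintchine_const p * C * R) powr q)"
proof -
  define g where "g Q y = a Q * (indicator Q y :: real)" for Q and y :: "real ^ 'n"
  have gm [measurable]: "g Q \<in> borel_measurable borel" if "Q \<in> F" for Q
    unfolding g_def using that F(2) cubes_borel by (intro borel_measurable_times borel_measurable_indicator) auto
  have gli: "loc_int k (g Q)" if "Q \<in> F" for Q k
    by (rule loc_int_bounded[OF gm[OF that]]) (auto simp: g_def indicator_def intro!: exI[of _ "\<bar>a Q\<bar>"])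
  define h where "h A y = signed_sum F (\<lambda>Q. g Q y) A" for A y
  have hm [measurable]: "h A \<in> borel_measurable borel" for A
    unfolding h_def signed_sum_def by measurable
  define n :: real where "n = 2 ^ card F"
  have n: "0 < n" by (simp add: n_def)
  define \<kappa> where "\<kappa> = 2 * p powr p * exp (1 / 2 :: real)"
  have \<kappa>: "0 < \<kappa>" using p by (simp add: \<kappa>_def)
  define I where "I A = moment \<sigma> p (\<lambda>x. \<bar>h A x\<bar>)" for A
  have "(\<Sum>A\<in>Pow F. I A) = (\<integral>\<^sup>+ x. ennreal (\<Sum>A\<in>Pow F. \<bar>h A x\<bar> powr p) \<partial>\<sigma>)"
    unfolding I_def by (subst nn_integral_sum[symmetric]) auto
  also have "\<dots> \<le> (\<integral>\<^sup>+ x. ennreal (n * \<kappa> * (\<Sum>Q\<in>F. (g Q x)\<^sup>2) powr (p / 2)) \<partial>\<sigma>)"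
    unfolding h_def n_def \<kappa>_def using p F(1)
    by (intro nn_integral_mono ennreal_leI khintchine_upper) auto
  also have "\<dots> = ennreal (n * \<kappa>) * moment \<sigma> (p / 2) (\<lambda>x. \<Sum>Q\<in>F. (g Q x)\<^sup>2)"
    using n \<kappa> by (intro nn_integral_cmult_real) auto
  also have "\<dots> \<le> ennreal (n * \<kappa>) * ennreal (R powr p)"
    using le by (intro mult_left_mono) (auto simp: g_def)
  also have "\<dots> = ennreal (n * \<kappa> * R powr p)"
    using n \<kappa> by (simp add: ennreal_mult)
  finally have sumI: "(\<Sum>A\<in>Pow F. I A) \<le> ennreal (n * \<kappa> * R powr p)" .
  have fin: "I A < \<infinity>" if "A \<in> Pow F" for A
  proof -
    have "I A \<le> (\<Sum>A\<in>Pow F. I A)" using that F(1) by (intro member_le_sum) auto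
    also have "\<dots> < \<infinity>" using sumI by (rule order.strict_trans1) simp
    finally show ?thesis .
  qed
  define r where "r A = enn2real (I A) powr (1 / p)" for A
  have r0: "0 \<le> r A" for A by (simp add: r_def)
  have rp: "ennreal (r A powr p) = I A" if "A \<in> Pow F" for A
    using fin[OF that] p by (simp add: r_def powr_powr less_top)
  have mean_r: "(\<Sum>A\<in>Pow F. 1 / n * r A) \<le> khintchine_const p * R"
  proof -
    have "ennreal (\<Sum>A\<in>Pow F. r A powr p) = (\<Sum>A\<in>Pow F. I A)"
      using rp by (subst sum_ennreal[symmetric]) auto
    with sumI have "ennreal (\<Sum>A\<in>Pow F. r A powr p) \<le> ennreal (n * \<kappa> * R powr p)"
      by (simp only:)
    then have "(\<Sum>A\<in>Pow F. r A powr p) \<le> n * \<kappa> * R powr p"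
      using n \<kappa> by (subst (asm) ennreal_le_iff) auto
    then have "(\<Sum>A\<in>Pow F. 1 / n * r A powr p) \<le> \<kappa> * R powr p"
      using n by (simp add: sum_divide_distrib[symmetric] field_simps)
    moreover have "(\<Sum>A\<in>Pow F. 1 / n * r A) powr p \<le> (\<Sum>A\<in>Pow F. 1 / n * r A powr p)"
      using n F(1) p r0 by (intro powr_jensen_sum) (auto simp: n_def card_Pow)
    moreover have "\<kappa> * R powr p = (khintchine_const p * R) powr p"
      using p \<kappa> \<open>0 \<le> R\<close> unfolding khintchine_const_def \<kappa>_def[symmetric]
      by (simp add: powr_mult powr_powr)
    ultimately have "(\<Sum>A\<in>Pow F. 1 / n * r A) powr p \<le> (khintchine_const p * R) powr p" by simp
    moreover have "0 \<le> khintchine_const p * R"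
      using \<open>0 \<le> R\<close> by (simp add: khintchine_const_def)
    ultimately show ?thesis
      using p powr_less_mono2[of p "khintchine_const p * R"] by (meson linorder_not_le order_less_trans zero_less_one)
  qed
  define u where "u A x = sqrt (\<Sum>i<N. (term_at (h A) (m + int i) x)\<^sup>2)" for A x
  have um [measurable]: "u A \<in> borel_measurable w" for A unfolding u_def by measurable
  have uI: "moment w q (\<lambda>x. 5 / n * u A x) \<le> ennreal ((5 / n * (C * r A)) powr q)"
    if A: "A \<in> Pow F" for A
  proof -
    have hL: "Lnorm \<sigma> p (\<lambda>x. ennreal \<bar>h A x\<bar>) = ennreal (r A)"
    proof -
      have "(\<integral>\<^sup>+ x. epowr (ennreal \<bar>h A x\<bar>) p \<partial>\<sigma>) = ennreal (r A powr p)"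
        using rp[OF A] by (simp add: I_def)
      then show ?thesis using p r0 by (simp add: Lnorm_def powr_powr)
    qed
    then have "h A \<in> Lspace \<sigma> p"
      by (simp add: Lspace_def borel_measurable_iff)
    then have "Lnorm w q (sq_fun D b \<sigma> (h A)) \<le> ennreal (C * r A)"
      using T \<open>0 \<le> C\<close> r0 unfolding two_weight_ineq_def by (force simp: hL ennreal_mult)
    then have sq: "(\<integral>\<^sup>+ x. epowr (sq_fun D b \<sigma> (h A) x) q \<partial>w) \<le> ennreal ((C * r A) powr q)"
      using q \<open>0 \<le> C\<close> r0 by (subst (asm) Lnorm_le_iff) auto
    have "ennreal (u A x powr q) \<le> epowr (sq_fun D b \<sigma> (h A) x) q" for x
    proof -
      have "ennreal (\<Sum>i<N. (term_at (h A) (m + int i) x)\<^sup>2) \<le> (\<Sum>\<^sub>\<infinity>k. ennreal ((term_at (h A) k x)\<^sup>2))"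
        using sum_window_le_infsum[of "\<lambda>k. ennreal ((term_at (h A) k x)\<^sup>2)" m N] by simp
      then have "epowr (ennreal (\<Sum>i<N. (term_at (h A) (m + int i) x)\<^sup>2)) (q / 2)
          \<le> epowr (\<Sum>\<^sub>\<infinity>k. ennreal ((term_at (h A) k x)\<^sup>2)) (q / 2)"
        using q by (intro epowr_mono) auto
      moreover have "u A x powr q = (\<Sum>i<N. (term_at (h A) (m + int i) x)\<^sup>2) powr (q / 2)"
        by (simp add: u_def powr_half_sqrt[symmetric] powr_powr sum_nonneg)
      ultimately show ?thesis by (simp add: sq_fun_eq epowr_esqrt sum_nonneg)
    qed
    then have "moment w q (u A) \<le> ennreal ((C * r A) powr q)"
      by (intro order_trans[OF nn_integral_mono sq])
    then have "ennreal ((5 / n) powr q) * moment w q (u A)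
        \<le> ennreal ((5 / n) powr q) * ennreal ((C * r A) powr q)"
      by (rule mult_left_mono) simp
    also have "ennreal ((5 / n) powr q) * moment w q (u A)
        = (\<integral>\<^sup>+ x. ennreal ((5 / n) powr q * u A x powr q) \<partial>w)"
      by (rule nn_integral_cmult_real[symmetric]) auto
    also have "\<dots> = moment w q (\<lambda>x. 5 / n * u A x)"
    by (simp only: powr_mult)
    also have "ennreal ((5 / n) powr q) * ennreal ((C * r A) powr q) = ennreal ((5 / n * (C * r A)) powr q)"
      unfolding powr_mult[of "5 / n" "C * r A"] by (rule ennreal_mult[symmetric]) auto
    finally show ?thesis .
  qed
  have "moment w (q / 2) (\<lambda>x. \<Sum>Q\<in>F. \<Sum>i<N. (term_at (g Q) (m + int i) x)\<^sup>2)
      \<le> moment w q (\<lambda>x. \<Sum>A\<in>Pow F. 5 / n * u A x)"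
  proof (intro nn_integral_mono ennreal_leI)
    fix x
    have "sqrt (\<Sum>Q\<in>F. \<Sum>i<N. (term_at (g Q) (m + int i) x)\<^sup>2)
        \<le> 5 / n * (\<Sum>A\<in>Pow F. sqrt (\<Sum>i<N. (signed_sum F (\<lambda>Q. term_at (g Q) (m + int i) x) A)\<^sup>2))"
      unfolding n_def by (rule khintchine_lower[OF F(1)]) simp
    also have "\<dots> = (\<Sum>A\<in>Pow F. 5 / n * u A x)"
      unfolding u_def h_def sum_distrib_left using F(1) gli
      by (intro sum.cong refl) (simp add: term_at_signed_sum)
    finally have "sqrt (\<Sum>Q\<in>F. \<Sum>i<N. (term_at (g Q) (m + int i) x)\<^sup>2) powr q
        \<le> (\<Sum>A\<in>Pow F. 5 / n * u A x) powr q"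
      using q by (intro powr_mono2) (auto intro!: sum_nonneg)
    then show "(\<Sum>Q\<in>F. \<Sum>i<N. (term_at (g Q) (m + int i) x)\<^sup>2) powr (q / 2)
        \<le> (\<Sum>A\<in>Pow F. 5 / n * u A x) powr q"
      by (simp add: powr_half_sqrt[symmetric] powr_powr sum_nonneg)
  qed
  also have "\<dots> \<le> ennreal ((\<Sum>A\<in>Pow F. 5 / n * (C * r A)) powr q)"
  proof (rule minkowski_sum)
    show "0 \<le> 5 / n * u A x" "0 \<le> 5 / n * (C * r A)" for A x
      using n \<open>0 \<le> C\<close> r0 by (auto simp: u_def intro!: sum_nonneg mult_nonneg_nonneg divide_nonneg_nonneg)
  qed (use F(1) q uI in auto)
  also have "\<dots> \<le> ennreal ((5 * khintchine_const p * C * R) powr q)"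
  proof (intro ennreal_leI powr_mono2)
    have "(\<Sum>A\<in>Pow F. 5 / n * (C * r A)) = 5 * C * (\<Sum>A\<in>Pow F. 1 / n * r A)"
      by (simp add: sum_distrib_left mult_ac)
    also have "\<dots> \<le> 5 * C * (khintchine_const p * R)"
      using \<open>0 \<le> C\<close> by (intro mult_left_mono mean_r) auto
    finally show "(\<Sum>A\<in>Pow F. 5 / n * (C * r A)) \<le> 5 * khintchine_const p * C * R"
      by (simp add: mult_ac)
  qed (use q n \<open>0 \<le> C\<close> r0 in \<open>auto intro!: sum_nonneg\<close>)
  finally show ?thesis unfolding g_def .
qed

text \<open>
  The larger constant \<open>C'\<close> is positive. This matters for families of infinite norm: \<open>0 * \<infinity> = 0\<close>, so with the
  constant zero the testing inequality is not vacuous for them.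
\<close>

lemma global_from_two_weight:
  assumes T: "two_weight_ineq D b \<sigma> w p q C" and C: "0 \<le> C" "C < C'" and p: "1 < p" and q: "1 < q"
  shows "global_testing D b \<sigma> w p q (5 * khintchine_const p * C')"
  unfolding global_testing_def
proof
  fix a :: "(real ^ 'n) set \<Rightarrow> real"
  define K where "K = 5 * khintchine_const p"
  have K: "0 < K" using p by (simp add: K_def khintchine_const_def)
  define t where "t Q k x = ennreal ((term_at (\<lambda>y. a Q * indicator Q y) k x)\<^sup>2)" for Q k x
  have [measurable]: "t Q k \<in> borel_measurable borel" for Q k unfolding t_def by measurable
  have lhs: "(sq_fun D b \<sigma> (\<lambda>y. a Q * indicator Q y) x)\<^sup>2 = (\<Sum>\<^sub>\<infinity>k. t Q k x)" for Q x
    by (simp add: sq_fun_eq t_def)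
  show "Lnorm w q (\<lambda>x. esqrt (\<Sum>\<^sub>\<infinity>Q\<in>cubes D. (sq_fun D b \<sigma> (\<lambda>y. a Q * indicator Q y) x)\<^sup>2))
      \<le> ennreal (5 * khintchine_const p * C') * coeff_norm D \<sigma> p a"
  proof (cases "coeff_norm D \<sigma> p a")
    case top
    then show ?thesis using K C by (simp add: K_def[symmetric] ennreal_mult_top)
  next
    case (real R)
    then have aR: "(\<integral>\<^sup>+ x. epowr (\<Sum>\<^sub>\<infinity>Q\<in>cubes D. ennreal ((a Q)\<^sup>2 * indicator Q x)) (p / 2) \<partial>\<sigma>)
        \<le> ennreal (R powr p)"
      using p Lnorm_le_iff[of p \<sigma> "\<lambda>x. esqrt (\<Sum>\<^sub>\<infinity>Q\<in>cubes D. ennreal ((a Q)\<^sup>2 * indicator Q x))" "ennreal R"]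
      by (simp add: coeff_norm_def epowr_esqrt)
    obtain E :: "nat \<Rightarrow> (real ^ 'n) set set" where E: "incseq E" "\<And>n. finite (E n)" "(\<Union>n. E n) = cubes D"
      using countable_exhaustion[OF countable_cubes] by blast
    define G where "G n j x = (\<Sum>Q\<in>E n. \<Sum>i<2 * j. t Q (- int j + int i) x)" for n j x
    have win: "(\<integral>\<^sup>+ x. epowr (G n j x) (q / 2) \<partial>w) \<le> ennreal ((K * C * R) powr q)" for n j
    proof -
      have sub: "E n \<subseteq> cubes D" using E(3) by blast
      have "moment \<sigma> (p / 2) (\<lambda>x. \<Sum>Q\<in>E n. (a Q * indicator Q x)\<^sup>2) \<le> ennreal (R powr p)"
      proof (rule order_trans[OF nn_integral_mono aR])
        fix x
        have "ennreal (\<Sum>Q\<in>E n. (a Q * indicator Q x)\<^sup>2) = (\<Sum>Q\<in>E n. ennreal ((a Q)\<^sup>2 * indicator Q x))"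
        proof -
          have "(a Q * indicator Q x)\<^sup>2 = (a Q)\<^sup>2 * indicator Q x" for Q
            by (simp add: indicator_def)
          then show ?thesis by (simp only:) (rule sum_ennreal[symmetric], simp)
        qed
        also have "\<dots> \<le> (\<Sum>\<^sub>\<infinity>Q\<in>cubes D. ennreal ((a Q)\<^sup>2 * indicator Q x))"
          by (rule sum_le_infsum_ennreal[OF E(2) sub])
        finally have "epowr (ennreal (\<Sum>Q\<in>E n. (a Q * indicator Q x)\<^sup>2)) (p / 2)
            \<le> epowr (\<Sum>\<^sub>\<infinity>Q\<in>cubes D. ennreal ((a Q)\<^sup>2 * indicator Q x)) (p / 2)"
          using p by (intro epowr_mono) auto
        then show "ennreal ((\<Sum>Q\<in>E n. (a Q * indicator Q x)\<^sup>2) powr (p / 2))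
            \<le> epowr (\<Sum>\<^sub>\<infinity>Q\<in>cubes D. ennreal ((a Q)\<^sup>2 * indicator Q x)) (p / 2)"
          by (simp add: sum_nonneg)
      qed
      from global_window[OF T C(1) p q real(1) E(2) sub this, of "- int j" "2 * j"]
      show ?thesis by (simp add: G_def t_def sum_nonneg K_def)
    qed
    have SUPj: "(\<Sum>Q\<in>E n. \<Sum>\<^sub>\<infinity>k. t Q k x) = (SUP j. G n j x)" for n x
      unfolding infsum_int_SUP G_def by (rule ennreal_SUP_sum[symmetric]) (rule incseq_symmetric_window)
    have incG: "incseq (G n)" for n
      unfolding incseq_def le_fun_def G_def
      by (intro allI impI sum_mono incseqD[OF incseq_symmetric_window])
    have [measurable]: "G n j \<in> borel_measurable w" for n j unfolding G_def by measurable
    have stage: "(\<integral>\<^sup>+ x. epowr (\<Sum>Q\<in>E n. \<Sum>\<^sub>\<infinity>k. t Q k x) (q / 2) \<partial>w) \<le> ennreal ((K * C * R) powr q)" for n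
      unfolding SUPj using q win by (subst nn_integral_epowr_SUP[OF incG]) (auto intro!: SUP_least)
    have "(\<integral>\<^sup>+ x. epowr (\<Sum>\<^sub>\<infinity>Q\<in>cubes D. \<Sum>\<^sub>\<infinity>k. t Q k x) (q / 2) \<partial>w)
        = (\<integral>\<^sup>+ x. epowr (SUP n. \<Sum>Q\<in>E n. \<Sum>\<^sub>\<infinity>k. t Q k x) (q / 2) \<partial>w)"
      unfolding infsum_ennreal_SUP_incseq[OF E] ..
    also have "\<dots> = (SUP n. \<integral>\<^sup>+ x. epowr (\<Sum>Q\<in>E n. \<Sum>\<^sub>\<infinity>k. t Q k x) (q / 2) \<partial>w)"
    proof (rule nn_integral_epowr_SUP)
      show "incseq (\<lambda>n x. \<Sum>Q\<in>E n. \<Sum>\<^sub>\<infinity>k. t Q k x)"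
        unfolding incseq_def le_fun_def
        by (intro allI impI sum_mono2 E(2) incseqD[OF E(1)]) (assumption, rule zero_le)
      show "(\<lambda>x. \<Sum>Q\<in>E n. \<Sum>\<^sub>\<infinity>k. t Q k x) \<in> borel_measurable w" for n
        by (intro borel_measurable_sum borel_measurable_infsum) auto
    qed (use q in auto)
    also have "\<dots> \<le> ennreal ((K * C * R) powr q)"
      by (rule SUP_least) (rule stage)
    finally have "Lnorm w q (\<lambda>x. esqrt (\<Sum>\<^sub>\<infinity>Q\<in>cubes D. \<Sum>\<^sub>\<infinity>k. t Q k x)) \<le> ennreal (K * C * R)"
      using q K C real(1) by (subst Lnorm_le_iff) (simp_all add: epowr_esqrt)
    also have "\<dots> \<le> ennreal (K * C' * R)"
      using K C real(1) by (intro ennreal_leI mult_right_mono mult_left_mono) auto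
    also have "\<dots> = ennreal (5 * khintchine_const p * C') * coeff_norm D \<sigma> p a"
      unfolding real(2) using K C real(1) by (subst ennreal_mult[symmetric]) (auto simp: K_def)
    finally show ?thesis unfolding lhs .
  qed
qed

section \<open>From global testing to local testing and the quadratic condition\<close>

lemma local_from_global:
  assumes G: "global_testing D b \<sigma> w p q C" and "0 < q"
  shows "local_testing D b \<sigma> w p q C"
  unfolding local_testing_def
proof
  fix a
  have "(local_sq_fun D b \<sigma> Q (\<lambda>y. a Q * indicator Q y) x)\<^sup>2 \<le> (sq_fun D b \<sigma> (\<lambda>y. a Q * indicator Q y) x)\<^sup>2" for Q x
    unfolding local_sq_fun_def sq_fun_def esqrt_power2 infsum_ennreal_SUP
    by (rule SUP_subset_mono) auto
  then have le: "(\<Sum>\<^sub>\<infinity>Q\<in>cubes D. (local_sq_fun D b \<sigma> Q (\<lambda>y. a Q * indicator Q y) x)\<^sup>2)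
      \<le> (\<Sum>\<^sub>\<infinity>Q\<in>cubes D. (sq_fun D b \<sigma> (\<lambda>y. a Q * indicator Q y) x)\<^sup>2)" for x
    unfolding infsum_ennreal_SUP by (intro SUP_mono) (blast intro: sum_mono)
  have "Lnorm w q (\<lambda>x. esqrt (\<Sum>\<^sub>\<infinity>Q\<in>cubes D. (local_sq_fun D b \<sigma> Q (\<lambda>y. a Q * indicator Q y) x)\<^sup>2))
      \<le> Lnorm w q (\<lambda>x. esqrt (\<Sum>\<^sub>\<infinity>Q\<in>cubes D. (sq_fun D b \<sigma> (\<lambda>y. a Q * indicator Q y) x)\<^sup>2))"
    unfolding Lnorm_def epowr_esqrt using \<open>0 < q\<close>
    by (intro epowr_mono nn_integral_mono le) auto
  also have "\<dots> \<le> ennreal C * coeff_norm D \<sigma> p a"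
    using G unfolding global_testing_def by blast
  finally show "Lnorm w q (\<lambda>x. esqrt (\<Sum>\<^sub>\<infinity>Q\<in>cubes D. (local_sq_fun D b \<sigma> Q (\<lambda>y. a Q * indicator Q y) x)\<^sup>2))
      \<le> ennreal C * coeff_norm D \<sigma> p a" .
qed

text \<open>
  The coefficient of the dyadic parent. Since the children partition their parent, the quadratic norm of
  the family does not change.
\<close>

definition parent_coef :: "((real ^ 'n) set \<Rightarrow> real) \<Rightarrow> (real ^ 'n) set \<Rightarrow> real" where
  "parent_coef a Q = a (cube ((THE k. Q \<in> D k) - 1) (SOME x. x \<in> Q))"

lemma parent_coef_cube: "parent_coef a (cube (k + 1) x) = a (cube k x)"
proof -
  let ?y = "SOME y. y \<in> cube (k + 1) x"
  have gen: "(THE j. cube (k + 1) x \<in> D j) = k + 1"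
    by (rule the_equality) (simp_all only: mem_D_cube_iff)
  have "?y \<in> cube (k + 1) x" by (rule someI) (rule mem_cube)
  then have "cube (k + 1) ?y = cube (k + 1) x" unfolding mem_cube_iff .
  then have "cube k ?y = cube k x" by (rule cube_coarser) simp
  then show ?thesis unfolding parent_coef_def gen by simp
qed

lemma parent_coef_child:
  assumes "Q \<in> children D (cube k x)"
  shows "parent_coef a Q = a (cube k x)"
proof -
  from assms have Q: "Q \<in> D (k + 1)" "Q \<subseteq> cube k x" by (simp_all add: children_cube)
  obtain z where z: "Q = cube (k + 1) z" using D_eq_cube[OF Q(1)] by blast
  then have "z \<in> cube k x" using Q(2) mem_cube[of z "k + 1"] by blast
  then have "cube k z = cube k x" unfolding mem_cube_iff .
  then show ?thesis by (simp only: z parent_coef_cube)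
qed

lemma coeff_norm_parent: "coeff_norm D \<sigma> p (parent_coef a) = coeff_norm D \<sigma> p a"
proof -
  have "(\<Sum>\<^sub>\<infinity>Q\<in>cubes D. ennreal ((parent_coef a Q)\<^sup>2 * indicator Q x))
      = (\<Sum>\<^sub>\<infinity>Q\<in>cubes D. ennreal ((a Q)\<^sup>2 * indicator Q x))" for x
  proof -
    have e: "(\<Sum>\<^sub>\<infinity>Q\<in>cubes D. ennreal ((c Q)\<^sup>2 * indicator Q x)) = (\<Sum>\<^sub>\<infinity>k. ennreal ((c (cube k x))\<^sup>2))" for c
      by (subst infsum_cubes_containing[of x]) auto
    have "(\<Sum>\<^sub>\<infinity>k. ennreal ((parent_coef a (cube k x))\<^sup>2))
        = (\<Sum>\<^sub>\<infinity>k\<in>range (\<lambda>k. k + 1). ennreal ((parent_coef a (cube k x))\<^sup>2))"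
    proof -
      have "range (\<lambda>k::int. k + 1) = UNIV" by (metis add_diff_cancel diff_add_cancel surj_def)
      then show ?thesis by simp
    qed
    also have "\<dots> = (\<Sum>\<^sub>\<infinity>k. ennreal ((a (cube k x))\<^sup>2))"
      by (subst infsum_reindex) (simp_all add: o_def parent_coef_cube)
    finally show ?thesis unfolding e .
  qed
  then show ?thesis by (simp add: coeff_norm_def)
qed

lemma measure_cube_children: "measure \<sigma> (cube k x) = (\<Sum>Q\<in>children D (cube k x). measure \<sigma> Q)"
proof -
  have "measure \<sigma> (\<Union>Q\<in>children D (cube k x). Q) = (\<Sum>Q\<in>children D (cube k x). measure \<sigma> Q)"
  proof (rule measure_finite_Union)
    show "(\<lambda>Q. Q) ` children D (cube k x) \<subseteq> sets \<sigma>"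
      using D_borel by (auto simp: children_cube sets_eq)
    show "disjoint_family_on (\<lambda>Q. Q) (children D (cube k x))"
      using D_disjoint[of _ "k + 1"] unfolding disjoint_family_on_def children_cube by blast
    fix Q assume "Q \<in> children D (cube k x)"
    then obtain z where "Q = cube (k + 1) z" using D_eq_cube[of Q "k + 1"] by (auto simp: children_cube)
    then show "emeasure \<sigma> Q \<noteq> \<infinity>" using finite_cube[of "k + 1" z] by simp
  qed (rule children_cube_lattice)
  then show ?thesis using children_cube_lattice(3)[of k x] by simp
qed

text \<open>
  On the parent the indicator of a child \<open>Q\<close> has the difference \<open>s (2\<^sup>N 1\<^sub>Q - 1)\<close> with \<open>s = \<sigma>(Q) / \<bar>parent\<bar>\<close>, and
  \<open>2\<^sup>N - 1 \<ge> 1\<close>.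
\<close>

lemma term_at_child_ge:
  assumes Q: "Q \<in> children D (cube k x)"
  shows "(a * b (cube k x) * (measure \<sigma> Q / vol (cube k x)))\<^sup>2
           \<le> (term_at (\<lambda>y. a * indicator Q y) k x)\<^sup>2"
proof -
  define s where "s = measure \<sigma> Q / vol (cube k x)"
  have s: "0 \<le> s" using vol_cube_pos[of k x] by (simp add: s_def)
  have QD: "Q \<in> D (k + 1)" "Q \<subseteq> cube k x" using Q by (simp_all add: children_cube)
  have Qs: "Q \<in> sets \<sigma>" using D_borel[OF QD(1)] by (simp add: sets_eq)
  have parent: "(LINT y:cube k x|\<sigma>. a * indicator Q y) = a * measure \<sigma> Q"
    unfolding set_integral_indicator_Int[OF cube_sets Qs finite_cube] using QD(2) by (simp add: Int_absorb1)
  have child: "(LINT y:cube (k + 1) x|\<sigma>. a * indicator Q y) / vol (cube (k + 1) x)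
      = (if x \<in> Q then 2 ^ CARD('n) * (a * s) else 0)"
  proof (cases "x \<in> Q")
    case True
    then have "cube (k + 1) x = Q" using cube_eq[OF QD(1)] by simp
    moreover have "vol (cube (k + 1) x) = vol (cube k x) / 2 ^ CARD('n)"
      by (simp add: vol_cube_Suc[of k x])
    ultimately show ?thesis
      unfolding set_integral_indicator_Int[OF cube_sets Qs finite_cube] using True by (simp add: s_def)
  next
    case False
    then have "cube (k + 1) x \<inter> Q = {}"
      using D_disjoint[OF cube_in QD(1)] mem_cube[of x "k + 1"] by blast
    then show ?thesis
      unfolding set_integral_indicator_Int[OF cube_sets Qs finite_cube] using False by simp
  qed
  have "\<bar>a * s\<bar> \<le> \<bar>(if x \<in> Q then 2 ^ CARD('n) * (a * s) else 0) - a * s\<bar>"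
  proof (cases "x \<in> Q")
    case True
    have "(2::real) ^ 1 \<le> 2 ^ CARD('n)" by (intro power_increasing) (simp_all add: Suc_leI)
    then have "1 * \<bar>a * s\<bar> \<le> (2 ^ CARD('n) - 1) * \<bar>a * s\<bar>"
      by (intro mult_right_mono) auto
    also have "\<dots> = \<bar>(2 ^ CARD('n) - 1) * (a * s)\<bar>" by (simp add: abs_mult)
    finally show ?thesis using True by (simp add: algebra_simps)
  qed simp
  then have "\<bar>b (cube k x)\<bar> * \<bar>a * s\<bar> \<le> \<bar>b (cube k x)\<bar> * \<bar>(if x \<in> Q then 2 ^ CARD('n) * (a * s) else 0) - a * s\<bar>"
    by (rule mult_left_mono) simp
  then have "\<bar>a * b (cube k x) * s\<bar> \<le> \<bar>term_at (\<lambda>y. a * indicator Q y) k x\<bar>"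
    unfolding term_at_def Delta_cube child parent by (simp add: s_def abs_mult mult_ac)
  then show ?thesis unfolding s_def by (simp only: abs_le_square_iff)
qed

lemma quadratic_term_le:
  "(a * b (cube k x) * ratio k x)\<^sup>2
     \<le> 2 ^ CARD('n) * (\<Sum>Q\<in>children D (cube k x). (term_at (\<lambda>y. a * indicator Q y) k x)\<^sup>2)"
proof -
  have "a * b (cube k x) * ratio k x
      = (\<Sum>Q\<in>children D (cube k x). a * b (cube k x) * (measure \<sigma> Q / vol (cube k x)))"
    by (simp add: ratio_def measure_cube_children sum_distrib_left sum_divide_distrib)
  then have "(a * b (cube k x) * ratio k x)\<^sup>2
      \<le> (\<Sum>Q\<in>children D (cube k x). (a * b (cube k x) * (measure \<sigma> Q / vol (cube k x)))\<^sup>2)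
          * card (children D (cube k x))"
    by (simp only: sum_squared_le_sum_of_squares)
  also have "\<dots> \<le> (\<Sum>Q\<in>children D (cube k x). (term_at (\<lambda>y. a * indicator Q y) k x)\<^sup>2)
      * card (children D (cube k x))"
    by (intro mult_right_mono sum_mono term_at_child_ge) auto
  finally show ?thesis by (simp add: children_cube_lattice(2) mult.commute)
qed

lemma quadratic_from_global:
  assumes G: "global_testing D b \<sigma> w p q C" and q: "0 < q" and "0 \<le> C"
  shows "quadratic_A D b \<sigma> w p q (sqrt (2 ^ CARD('n)) * C)"
  unfolding quadratic_A_def
proof
  fix a :: "(real ^ 'n) set \<Rightarrow> real"
  define c :: real where "c = 2 ^ CARD('n)"
  have c: "0 < c" by (simp add: c_def)
  define t where "t Q k x = ennreal ((term_at (\<lambda>y. parent_coef a Q * indicator Q y) k x)\<^sup>2)" for Q k x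
  define X where "X x = (\<Sum>\<^sub>\<infinity>Q\<in>cubes D. ennreal ((a Q * b Q * (measure \<sigma> Q / vol Q))\<^sup>2 * indicator Q x))" for x
  define Y where "Y x = (\<Sum>\<^sub>\<infinity>Q\<in>cubes D. (sq_fun D b \<sigma> (\<lambda>y. parent_coef a Q * indicator Q y) x)\<^sup>2)" for x
  have Y_eq: "Y x = (\<Sum>\<^sub>\<infinity>Q\<in>cubes D. \<Sum>\<^sub>\<infinity>k. t Q k x)" for x
    by (simp add: Y_def sq_fun_eq t_def)
  have [measurable]: "Y \<in> borel_measurable w"
    unfolding Y_eq[abs_def] t_def by (intro borel_measurable_infsum countable_cubes) auto
  have XY: "X x \<le> ennreal c * Y x" for x
  proof -
    have "X x = (\<Sum>\<^sub>\<infinity>k. ennreal ((a (cube k x) * b (cube k x) * ratio k x)\<^sup>2))"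
      unfolding X_def by (subst infsum_cubes_containing[of x]) (auto simp: ratio_def)
    also have "\<dots> \<le> ennreal c * Y x"
      unfolding infsum_ennreal_SUP
    proof (rule SUP_least, clarify)
      fix K :: "int set" assume K: "finite K"
      let ?ch = "\<lambda>k. children D (cube k x)"
      have fin: "finite (?ch k)" for k by (rule children_cube_lattice)
      have "(\<Sum>k\<in>K. ennreal ((a (cube k x) * b (cube k x) * ratio k x)\<^sup>2))
          \<le> (\<Sum>k\<in>K. ennreal c * (\<Sum>Q\<in>?ch k. t Q k x))"
      proof (rule sum_mono)
        fix k
        have "ennreal ((a (cube k x) * b (cube k x) * ratio k x)\<^sup>2)
            \<le> ennreal (c * (\<Sum>Q\<in>?ch k. (term_at (\<lambda>y. a (cube k x) * indicator Q y) k x)\<^sup>2))"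
          unfolding c_def by (intro ennreal_leI quadratic_term_le)
        also have "\<dots> = ennreal c * (\<Sum>Q\<in>?ch k. ennreal ((term_at (\<lambda>y. a (cube k x) * indicator Q y) k x)\<^sup>2))"
          using c by (simp add: ennreal_mult sum_nonneg)
        also have "\<dots> = ennreal c * (\<Sum>Q\<in>?ch k. t Q k x)"
          unfolding t_def by (intro arg_cong2[of _ _ _ _ "(*)"] sum.cong refl) (simp only: parent_coef_child)
        finally show "ennreal ((a (cube k x) * b (cube k x) * ratio k x)\<^sup>2) \<le> ennreal c * (\<Sum>Q\<in>?ch k. t Q k x)" .
      qed
      also have "\<dots> \<le> (\<Sum>k\<in>K. ennreal c * (\<Sum>Q\<in>?ch k. \<Sum>\<^sub>\<infinity>k. t Q k x))"
      proof (intro sum_mono mult_left_mono)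
        fix k Q
        show "t Q k x \<le> (\<Sum>\<^sub>\<infinity>k. t Q k x)"
          using sum_le_infsum_ennreal[of "{k}" UNIV "\<lambda>k. t Q k x"] by simp
      qed simp
      also have "\<dots> = ennreal c * (\<Sum>Q\<in>(\<Union>k\<in>K. ?ch k). \<Sum>\<^sub>\<infinity>k. t Q k x)"
      proof -
        have "(\<Sum>Q\<in>(\<Union>k\<in>K. ?ch k). \<Sum>\<^sub>\<infinity>k. t Q k x) = (\<Sum>k\<in>K. \<Sum>Q\<in>?ch k. \<Sum>\<^sub>\<infinity>k. t Q k x)"
        proof (rule sum.UNION_disjoint[OF K])
          show "\<forall>i\<in>K. \<forall>j\<in>K. i \<noteq> j \<longrightarrow> ?ch i \<inter> ?ch j = {}"
          proof (intro ballI impI)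
            fix i j :: int assume "i \<noteq> j"
            then show "?ch i \<inter> ?ch j = {}"
              using D_inj[of _ "i + 1" "j + 1"] unfolding children_cube by fastforce
          qed
        qed (simp add: fin)
        then show ?thesis by (simp add: sum_distrib_left)
      qed
      also have "\<dots> \<le> ennreal c * Y x"
        unfolding Y_eq using K fin
        by (intro mult_left_mono sum_le_infsum_ennreal) (auto simp: children_def cubes_def)
      finally show "(\<Sum>k\<in>K. ennreal ((a (cube k x) * b (cube k x) * ratio k x)\<^sup>2)) \<le> ennreal c * Y x" .
    qed
    finally show ?thesis .
  qed
  define y where "y = ennreal C * coeff_norm D \<sigma> p a"
  have "Lnorm w q (\<lambda>x. esqrt (Y x)) \<le> y"
    using G unfolding global_testing_def Y_def y_def coeff_norm_parent[of p a, symmetric] by blast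
  then have Yy: "(\<integral>\<^sup>+ x. epowr (Y x) (q / 2) \<partial>w) \<le> epowr y q"
    using q by (simp add: Lnorm_le_iff epowr_esqrt)
  have "(\<integral>\<^sup>+ x. epowr (X x) (q / 2) \<partial>w) \<le> (\<integral>\<^sup>+ x. epowr (ennreal c) (q / 2) * epowr (Y x) (q / 2) \<partial>w)"
    using q XY by (intro nn_integral_mono) (auto simp: epowr_mult[symmetric] intro: epowr_mono)
  also have "\<dots> = epowr (ennreal c) (q / 2) * (\<integral>\<^sup>+ x. epowr (Y x) (q / 2) \<partial>w)"
    by (rule nn_integral_cmult) measurable
  also have "\<dots> \<le> epowr (ennreal c) (q / 2) * epowr y q"
    by (intro mult_left_mono Yy) simp
  also have "epowr (ennreal c) (q / 2) = epowr (ennreal (sqrt c)) q"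
    using c by (simp add: powr_half_sqrt[symmetric] powr_powr)
  also have "epowr (ennreal (sqrt c)) q * epowr y q = epowr (ennreal (sqrt c) * y) q"
    using q by (simp add: epowr_mult)
  finally have "Lnorm w q (\<lambda>x. esqrt (X x)) \<le> ennreal (sqrt c) * y"
    using q by (simp add: Lnorm_le_iff epowr_esqrt)
  also have "\<dots> = ennreal (sqrt (2 ^ CARD('n)) * C) * coeff_norm D \<sigma> p a"
    using \<open>0 \<le> C\<close> by (simp add: y_def c_def ennreal_mult mult.assoc)
  finally show "Lnorm w q (\<lambda>x. esqrt (\<Sum>\<^sub>\<infinity>Q\<in>cubes D. ennreal ((a Q * b Q * (measure \<sigma> Q / vol Q))\<^sup>2 * indicator Q x)))
      \<le> ennreal (sqrt (2 ^ CARD('n)) * C) * coeff_norm D \<sigma> p a"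
    unfolding X_def .
qed

end

section \<open>Best constants and the characterization\<close>

lemma best_const_near:
  assumes "best_const P = ennreal c" "0 \<le> c" "0 < e"
  shows "\<exists>C\<ge>0. P C \<and> C < c + e"
proof -
  have "best_const P < ennreal (c + e)" using assms by (simp add: ennreal_less_iff del: ennreal_plus)
  then obtain C where C: "0 \<le> C" "P C" "ennreal C < ennreal (c + e)"
    unfolding best_const_def INF_less_iff by auto
  then have "C < c + e" using assms by (simp add: ennreal_less_iff del: ennreal_plus)
  then show ?thesis using C by blast
qed

text \<open>
  The infimum need not be attained, so implications between the inequalities may lose an arbitrarily small
  amount in the constant.
\<close>

lemma best_const_le:
  assumes step: "\<And>C C'. 0 \<le> C \<Longrightarrow> P C \<Longrightarrow> C < C' \<Longrightarrow> R (K * C')" and K: "0 < K"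
  shows "best_const R \<le> ennreal K * best_const P"
proof (cases "best_const P")
  case (real c)
  have "best_const R \<le> ennreal ((K * c + d) powr 1)" if "0 < d" for d
  proof -
    define e where "e = d / K"
    have "0 < e" using that K by (simp add: e_def)
    obtain C where C: "0 \<le> C" "P C" "C < c + e"
      using best_const_near[OF real(2,1) \<open>0 < e\<close>] by blast
    then have "R (K * (c + e))" by (rule step)
    moreover have "0 \<le> K * (c + e)" using real \<open>0 < e\<close> K by simp
    ultimately have "best_const R \<le> ennreal (K * (c + e))"
      unfolding best_const_def by (intro INF_lower) simp
    also have "K * (c + e) = (K * c + d) powr 1"
      using K real that by (simp add: e_def distrib_left)
    finally show ?thesis .
  qed
  then have "best_const R \<le> ennreal ((K * c) powr 1)"
    by (rule ennreal_le_powr_limit) (use real K in auto)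
  then show ?thesis using real K by (simp add: ennreal_mult)
qed (use K in \<open>simp add: ennreal_mult_top\<close>)

lemma best_const_finite_iff: "best_const P < \<infinity> \<longleftrightarrow> (\<exists>C\<ge>0. P C)"
  unfolding best_const_def INF_less_iff by auto

lemma best_const_le_add:
  assumes step: "\<And>C\<^sub>1 C\<^sub>2. 0 \<le> C\<^sub>1 \<Longrightarrow> P\<^sub>1 C\<^sub>1 \<Longrightarrow> 0 \<le> C\<^sub>2 \<Longrightarrow> P\<^sub>2 C\<^sub>2 \<Longrightarrow> R (K * (C\<^sub>1 + C\<^sub>2))" and K: "0 < K"
  shows "best_const R \<le> ennreal K * (best_const P\<^sub>1 + best_const P\<^sub>2)"
proof (cases "best_const P\<^sub>1 + best_const P\<^sub>2 = \<infinity>")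
  case False
  then obtain c\<^sub>1 c\<^sub>2 where c: "best_const P\<^sub>1 = ennreal c\<^sub>1" "0 \<le> c\<^sub>1" "best_const P\<^sub>2 = ennreal c\<^sub>2" "0 \<le> c\<^sub>2"
    by (cases "best_const P\<^sub>1"; cases "best_const P\<^sub>2") auto
  have "best_const R \<le> ennreal ((K * (c\<^sub>1 + c\<^sub>2) + d) powr 1)" if "0 < d" for d
  proof -
    define e where "e = d / (2 * K)"
    have "0 < e" using that K by (simp add: e_def)
    obtain C\<^sub>1 C\<^sub>2 where C: "0 \<le> C\<^sub>1" "P\<^sub>1 C\<^sub>1" "C\<^sub>1 < c\<^sub>1 + e" "0 \<le> C\<^sub>2" "P\<^sub>2 C\<^sub>2" "C\<^sub>2 < c\<^sub>2 + e"
      using best_const_near[OF c(1,2) \<open>0 < e\<close>] best_const_near[OF c(3,4) \<open>0 < e\<close>] by blast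
    have "best_const R \<le> ennreal (K * (C\<^sub>1 + C\<^sub>2))"
      unfolding best_const_def using step[OF C(1,2,4,5)] C K by (intro INF_lower) simp
    also have "\<dots> \<le> ennreal ((K * (c\<^sub>1 + c\<^sub>2) + d) powr 1)"
    proof (rule ennreal_leI)
      have "K * (C\<^sub>1 + C\<^sub>2) \<le> K * (c\<^sub>1 + c\<^sub>2 + 2 * e)" using C K by (intro mult_left_mono) auto
      also have "\<dots> = K * (c\<^sub>1 + c\<^sub>2) + d" using K by (simp add: e_def field_simps)
      finally show "K * (C\<^sub>1 + C\<^sub>2) \<le> (K * (c\<^sub>1 + c\<^sub>2) + d) powr 1"
        using c K that by simp
    qed
    finally show ?thesis .
  qed
  then have "best_const R \<le> ennreal ((K * (c\<^sub>1 + c\<^sub>2)) powr 1)"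
    by (rule ennreal_le_powr_limit) (use c K in auto)
  then show ?thesis using c K by (simp add: ennreal_mult del: ennreal_plus flip: ennreal_plus)
qed (use K in \<open>auto simp: ennreal_mult_top\<close>)

lemma global_testing_mono:
  assumes "global_testing D b \<sigma> w p q C" "C \<le> C'"
  shows "global_testing D b \<sigma> w p q C'"
  unfolding global_testing_def
proof
  fix a
  have "Lnorm w q (\<lambda>x. esqrt (\<Sum>\<^sub>\<infinity>Q\<in>cubes D. (sq_fun D b \<sigma> (\<lambda>y. a Q * indicator Q y) x)\<^sup>2))
      \<le> ennreal C * coeff_norm D \<sigma> p a"
    using assms(1) unfolding global_testing_def by blast
  also have "\<dots> \<le> ennreal C' * coeff_norm D \<sigma> p a"
    by (intro mult_right_mono ennreal_leI assms) simp
  finally show "Lnorm w q (\<lambda>x. esqrt (\<Sum>\<^sub>\<infinity>Q\<in>cubes D. (sq_fun D b \<sigma> (\<lambda>y. a Q * indicator Q y) x)\<^sup>2))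
      \<le> ennreal C' * coeff_norm D \<sigma> p a" .
qed

lemma two_weights_radon:
  assumes D: "dyadic_lattice D" and \<sigma>: "radon_measure \<sigma>" and w: "radon_measure w"
  shows "two_weights D \<sigma> w"
proof -
  interpret dyadic_grid D by unfold_locales (rule D)
  show ?thesis
  proof
    show "sets \<sigma> = sets borel" "sets w = sets borel"
      using \<sigma> w by (auto simp: radon_measure_def)
    fix k x
    have "compact (closure (cube k x))"
      using D_bounded[OF cube_in] by (simp add: compact_closure)
    then have "emeasure \<sigma> (closure (cube k x)) < \<infinity>"
      using \<sigma> unfolding radon_measure_def by blast
    moreover have "emeasure \<sigma> (cube k x) \<le> emeasure \<sigma> (closure (cube k x))"
      using \<sigma> by (intro emeasure_mono closure_subset) (auto simp: radon_measure_def)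
    ultimately show "emeasure \<sigma> (cube k x) < \<infinity>" by (rule order.strict_trans1[rotated])
  qed
qed

lemma ennreal_mult_chain:
  fixes X Y Z :: ennreal
  assumes "X \<le> ennreal a * Y" "Y \<le> ennreal b * Z" "0 \<le> a" "0 \<le> b" "a * b \<le> c"
  shows "X \<le> ennreal c * Z"
proof -
  have "X \<le> ennreal a * (ennreal b * Z)"
    by (rule order_trans[OF assms(1) mult_left_mono[OF assms(2)]]) simp
  also have "\<dots> = ennreal (a * b) * Z" using assms by (simp add: ennreal_mult mult.assoc)
  also have "\<dots> \<le> ennreal c * Z" using assms by (intro mult_right_mono ennreal_leI) auto
  finally show ?thesis .
qed

theorem theorem4p1:
  fixes p q :: real
  assumes "1 < p" and "1 < q"
  shows "\<exists>K>0. \<forall>(D :: int \<Rightarrow> (real ^ 'n::finite) set set) (\<sigma> :: (real ^ 'n) measure)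
           (w :: (real ^ 'n) measure) (b :: (real ^ 'n) set \<Rightarrow> real).
    dyadic_lattice D \<longrightarrow> radon_measure \<sigma> \<longrightarrow> radon_measure w \<longrightarrow>
      ((\<exists>C\<ge>0. two_weight_ineq D b \<sigma> w p q C) \<longleftrightarrow> (\<exists>C\<ge>0. global_testing D b \<sigma> w p q C))
    \<and> ((\<exists>C\<ge>0. two_weight_ineq D b \<sigma> w p q C) \<longleftrightarrow>
         (\<exists>C\<ge>0. local_testing D b \<sigma> w p q C) \<and> best_const (quadratic_A D b \<sigma> w p q) < \<infinity>)
    \<and> ((\<exists>C\<ge>0. two_weight_ineq D b \<sigma> w p q C) \<longrightarrow>
         comparable K (best_const (two_weight_ineq D b \<sigma> w p q))
                      (best_const (global_testing D b \<sigma> w p q))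
       \<and> comparable K (best_const (global_testing D b \<sigma> w p q))
                      (best_const (local_testing D b \<sigma> w p q)
                         + best_const (quadratic_A D b \<sigma> w p q)))"
proof -
  define K\<^sub>1 where "K\<^sub>1 = 8 * local_const p CARD('n)"
  define K\<^sub>2 where "K\<^sub>2 = 5 * khintchine_const p"
  define K\<^sub>3 :: real where "K\<^sub>3 = sqrt (2 ^ CARD('n))"
  have "0 < doob_const p" using assms by (simp add: doob_const_def)
  then have "0 < doob_const p powr (1 / p) + square_const p powr (1 / p)"
    by (intro add_pos_nonneg) auto
  then have K: "0 < K\<^sub>1" "0 < K\<^sub>2" "0 < K\<^sub>3"
    using assms by (simp_all add: K\<^sub>1_def K\<^sub>2_def K\<^sub>3_def local_const_def khintchine_const_def)
  define K where "K = K\<^sub>1 * (1 + K\<^sub>3) + K\<^sub>2 + K\<^sub>2 * K\<^sub>1 + (1 + K\<^sub>3)"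
  have Kge: "K\<^sub>1 * (1 + K\<^sub>3) \<le> K" "K\<^sub>2 \<le> K" "K\<^sub>2 * K\<^sub>1 \<le> K" "1 + K\<^sub>3 \<le> K" "0 < K"
    using K by (auto simp: K_def intro!: add_nonneg_nonneg add_pos_pos)
  show ?thesis
  proof (intro exI[of _ K] conjI allI impI Kge)
    fix D :: "int \<Rightarrow> (real ^ 'n) set set" and \<sigma> w :: "(real ^ 'n) measure"
      and b :: "(real ^ 'n) set \<Rightarrow> real"
    assume "dyadic_lattice D" "radon_measure \<sigma>" "radon_measure w"
    then interpret two_weights D \<sigma> w b by (rule two_weights_radon)
    let ?S = "best_const (two_weight_ineq D b \<sigma> w p q)"
    let ?G = "best_const (global_testing D b \<sigma> w p q)"
    let ?L = "best_const (local_testing D b \<sigma> w p q)"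
    let ?A = "best_const (quadratic_A D b \<sigma> w p q)"
    have SLA: "?S \<le> ennreal K\<^sub>1 * (?L + ?A)"
      by (rule best_const_le_add[OF _ K(1)]) (unfold K\<^sub>1_def, intro two_weight_from_local assms)
    have GS: "?G \<le> ennreal K\<^sub>2 * ?S"
      by (rule best_const_le[OF _ K(2)]) (unfold K\<^sub>2_def, intro global_from_two_weight assms)
    have LG: "?L \<le> ennreal 1 * ?G"
    proof (rule best_const_le)
      fix C C' :: real assume C: "0 \<le> C" "global_testing D b \<sigma> w p q C" "C < C'"
      have "global_testing D b \<sigma> w p q C'"
        by (rule global_testing_mono[OF C(2)]) (use C(3) in simp)
      then show "local_testing D b \<sigma> w p q (1 * C')" using assms by (simp add: local_from_global)
    qed simp
    have AG: "?A \<le> ennreal K\<^sub>3 * ?G"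
    proof (rule best_const_le[OF _ K(3)])
      fix C C' :: real assume C: "0 \<le> C" "global_testing D b \<sigma> w p q C" "C < C'"
      have "global_testing D b \<sigma> w p q C'"
        by (rule global_testing_mono[OF C(2)]) (use C(3) in simp)
      then show "quadratic_A D b \<sigma> w p q (K\<^sub>3 * C')"
        unfolding K\<^sub>3_def by (rule quadratic_from_global) (use C assms in auto)
    qed
    have LAG: "?L + ?A \<le> ennreal (1 + K\<^sub>3) * ?G"
      using add_mono[OF LG AG] K by (simp add: distrib_right)
    have SG: "?S \<le> ennreal K * ?G" and GLA: "?G \<le> ennreal K * (?L + ?A)"
      using ennreal_mult_chain[OF SLA LAG _ _ Kge(1)] ennreal_mult_chain[OF GS SLA _ _ Kge(3)] K by auto
    have GS': "?G \<le> ennreal K * ?S" and LAG': "?L + ?A \<le> ennreal K * ?G"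
      using order_trans[OF GS mult_right_mono[OF ennreal_leI[OF Kge(2)]]]
        order_trans[OF LAG mult_right_mono[OF ennreal_leI[OF Kge(4)]]] by auto
    have finite_mult: "ennreal c * X < \<infinity>" if "X < \<infinity>" for c X
      using that by (simp add: ennreal_mult_less_top)
    have SG_fin: "?S < \<infinity> \<longleftrightarrow> ?G < \<infinity>"
      using order.strict_trans1[OF SG finite_mult] order.strict_trans1[OF GS finite_mult] by blast
    have "?L + ?A < \<infinity> \<longleftrightarrow> ?L < \<infinity> \<and> ?A < \<infinity>" by simp
    then have GLA_fin: "?G < \<infinity> \<longleftrightarrow> ?L < \<infinity> \<and> ?A < \<infinity>"
      using order.strict_trans1[OF GLA finite_mult] order.strict_trans1[OF LAG finite_mult] by blast
    show "(\<exists>C\<ge>0. two_weight_ineq D b \<sigma> w p q C) \<longleftrightarrow> (\<exists>C\<ge>0. global_testing D b \<sigma> w p q C)"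
      using SG_fin unfolding best_const_finite_iff .
    show "(\<exists>C\<ge>0. two_weight_ineq D b \<sigma> w p q C) \<longleftrightarrow>
        (\<exists>C\<ge>0. local_testing D b \<sigma> w p q C) \<and> ?A < \<infinity>"
      using SG_fin GLA_fin unfolding best_const_finite_iff[of "two_weight_ineq D b \<sigma> w p q"]
        best_const_finite_iff[of "local_testing D b \<sigma> w p q"] by blast
    show "comparable K ?S ?G" "comparable K ?G (?L + ?A)"
      unfolding comparable_def using SG GS' GLA LAG' by auto
  qed
qed

end
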